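(* Suppose that $F$ satisfies conditions (P1), (P2), (P3), (G1), (G2$_\infty$) and (G3) of the context. Then there exist constants $D\in\mathbb{R}$ and $0\le\beta_3<1$ such that, for every signed measure $\mu\in\mathbf{V}^\infty$, $$\|\overline{\mathrm F}_{\Phi,h}^{\,n}\mu\|_\infty\le D\,\beta_3^{\,n}\,\|\mu\|_{\mathbf{S}^\infty}\qquad\text{for all } n\ge 1 .$$
   Context: Setting. $M$ is a complete separable metric space and $K$ a compact metric space (Borel $\sigma$-algebras), $\Sigma=M\times K$, and $F:\Sigma\to\Sigma$, $F(x,y)=(f(x),G(x,y))$, with $f:M\to M$ and $G:\Sigma\to K$ measurable. $\pi_1(x,y)=x$, $\pi_2(x,y)=y$; a subscript $*$ denotes push-forward of measures. (P1) There is a class $\mathscr P_M$ of potentials $\varphi:M\to\mathbb R$ such that for each $\varphi\in\mathscr P_M$: (P1.1) there is an equilibrium state $m=m(\varphi)$ of $f$ for $\varphi$ (a probability measure) of the form $m=h\,\nu$ with $0<\inf h\le\sup h<\infty$ and $\mathcal L_\varphi h=\lambda h$ for some $\lambda>0$, where $\mathcal L_\varphi g(x)=\sum_{y\in f^{-1}(x)}g(y)e^{\varphi(y)}$, and $\nu$ is a conformal measure with Jacobian $\lambda e^{-\varphi}$ (i.e. $\nu(f(A))=\int_A\lambda e^{-\varphi}d\nu$ for measurable $A$ on which $f$ is injective); (P1.2) there are normed spaces (not necessarily Banach) of real functions on $M$, closed under pointwise multiplication, $h,h^{-1}\in(B_s,|\cdot|_s)\subset(B_w,|\cdot|_w)$,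 $|\cdot|_w\le|\cdot|_s$, such that $\mathcal L_\varphi:B_s\to B_s$ has spectrum $\{\lambda\}\cup\mathcal U$ with $\mathcal U$ contained in a disk of radius strictly smaller than $|\lambda|$; in particular $\overline{\mathcal L}_\varphi:=\lambda^{-1}\mathcal L_\varphi=\mathcal P_f+\mathcal N_f$ with $\mathcal P_f^2=\mathcal P_f$, $\dim\operatorname{Im}\mathcal P_f=1$, $\mathcal N_f\mathcal P_f=\mathcal P_f\mathcal N_f=0$, and there are $C_0>0$, $0\le r<1$ with $|\mathcal N_f^n g|_s\le C_0r^n|g|_s$ for all $g\in B_s$, $n\ge1$. Consequently $\overline{\mathcal L}_\varphi^*\nu=\nu$. (P2) There is a measurable partition of $M$ (up to $\nu$-null sets) into disjoint sets $P_1,\dots,P_{\deg(f)}$ such that each $f|_{P_i}:P_i\to M$ is a bijection and $\nu(\bigcup_iP_i)=\nu(M)$. Fix $\varphi\in\mathscr P_M$ with its $m,h,\nu,\lambda$, and let $\Phi=\varphi\circ\pi_1$. (P3) There is an $F$-invariant probability measure $\mu_0$ with $\pi_{1*}\mu_0=m$. A point $\gamma\in M$ is identified with the fibre $\{\gamma\}\times K$, and $F_\gamma:K\to K$ is $F_\gamma(y)=G(\gamma,y)$. (G1) There are a norm $\|\cdot\|_o$ on the space $\mathcal{SM}(K)$ of finite signed Borel measures on $K$ and $0\le\alpha<1$ such that, for every $\mu\in\mathcal{SM}(K)$: $\|F_{\gamma*}\mu\|_o\le\alpha\|\mu\|_o+|\mu(K)|$ for $\nu$-a.e. $\gamma$,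 and $\|F_{\gamma*}\mu\|_o\le\|\mu\|_o$ for every $\gamma$. (G3) $\|\mu\|_o=1$ for every probability measure $\mu$ on $K$. Measures and spaces. For a finite signed Borel measure $\mu$ on $\Sigma$ with Jordan decomposition $\mu=\mu^+-\mu^-$, write $\mu\in\mathbf{AB}_m$ if $\pi_{1*}\mu^\pm\ll m$. For positive $\mu\in\mathbf{AB}_m$ let $(\{\mu_\gamma\}_\gamma,\phi_1m)$ be its (Rokhlin) disintegration along the fibres, $\mu_\gamma$ probability measures and $\phi_1=d\pi_{1*}\mu/dm$; the restriction $\mu|_\gamma$ is the measure $\phi_1(\gamma)\,\pi_{2*}\mu_\gamma$ on $K$. For signed $\mu$: $\mu|_\gamma=\mu^+|_\gamma-\mu^-|_\gamma$ and $\phi_1=\phi_1^+-\phi_1^-$. Set $\|\mu\|_\infty=\operatorname{ess\,sup}_{\gamma}\|\mu|_\gamma\|_o$ (with respect to $m$), $\mathbf L^\infty=\{\mu\in\mathbf{AB}_m:\|\mu\|_\infty<\infty\}$, $\mathbf S^\infty=\{\mu\in\mathbf L^\infty:\phi_1\in B_s\}$, $\|\mu\|_{\mathbf S^\infty}=|\phi_1|_s+\|\mu\|_\infty$. (G2$_\infty$) $B_w\subset L^\infty_\nu$ and for every $\mu\in\mathbf L^\infty$ its marginal density satisfies $|\phi_1|_\infty\le|\phi_1|_w\le\|\mu\|_\infty$ (in particular $|\phi_1|_w$ is assumed defined). Operators. $\mathcal L_{\varphi,h}(g)=\mathcal L_\varphi(gh)/h$ and $\overline{\mathcal L}_{\varphi,h}=\lambda^{-1}\mathcal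 L_{\varphi,h}$. For a.e. $\gamma$ let $\gamma_i\in P_i$ be the point with $f(\gamma_i)=\gamma$. $\mathrm F_{\Phi,h}:\mathbf{AB}_m\to\mathbf{AB}_m$ is the linear operator such that, for positive $\mu$, the marginal of $\mathrm F_{\Phi,h}\mu$ is $\mathcal L_{\varphi,h}(\phi_1)m$ and its conditional measure on the fibre over $\gamma$ is $\frac{1}{h(\gamma)\mathcal L_{\varphi,h}(\phi_1)(\gamma)}\sum_i\phi_1(\gamma_i)h(\gamma_i)e^{\varphi(\gamma_i)}F_*\mu_{\gamma_i}$ where $\mathcal L_{\varphi,h}(\phi_1)(\gamma)\ne0$ (a fixed probability elsewhere). Equivalently, for all $\mu$ and a.e. $\gamma$, $(\mathrm F_{\Phi,h}\mu)|_\gamma=\frac1{h(\gamma)}\sum_{i=1}^{\deg(f)}h(\gamma_i)e^{\varphi(\gamma_i)}F_{\gamma_i*}(\mu|_{\gamma_i})$. Put $\overline{\mathrm F}_{\Phi,h}=\lambda^{-1}\mathrm F_{\Phi,h}$. Zero-average space: $\mathbf V^\infty=\{\mu\in\mathbf S^\infty:\phi_1\in\operatorname{Ker}(\mathcal P_{f,h})\}$, where $\mathcal P_{f,h}(g)=h^{-1}\mathcal P_f(hg)$ is the rank-one spectral projection of $\overline{\mathcal L}_{\varphi,h}$.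
   Formalization: In (G1) the exceptional ν-null set of γ is taken to be the same for all μ, and in (P1.2) multiplication by h is assumed to be a bounded operator on B_s; without either of these the claim fails. *)

theory Defs
  imports "HOL-Probability.Probability"
begin

section \<open>Essential suprema\<close>

text \<open>
  The library's \<open>esssup\<close> is this \<open>Limsup\<close> for measurable functions and \<open>top\<close> otherwise.  The guard is
  dropped because \<open>\<gamma> \<mapsto> \<parallel>\<mu>|\<^sub>\<gamma>\<parallel>\<close> need not be measurable for an arbitrary norm on signed measures.
\<close>

definition ess_sup :: "'a measure \<Rightarrow> ('a \<Rightarrow> ereal) \<Rightarrow> ereal" where
  "ess_sup M u = Limsup (ae_filter M) u"

abbreviation sup_norm_ae :: "'a measure \<Rightarrow> ('a \<Rightarrow> real) \<Rightarrow> ereal" where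
  "sup_norm_ae M g \<equiv> ess_sup M (\<lambda>x. ereal \<bar>g x\<bar>)"

section \<open>Finite signed Borel measures\<close>

text \<open>
  A signed measure is a real set function, made extensional by the value 0 on non-Borel sets, so
  that signed measures form a linear space under the pointwise operations.
\<close>

definition signed_measures :: "('a::topological_space set \<Rightarrow> real) set" where
  "signed_measures = {\<mu>. (\<forall>A. A \<notin> sets borel \<longrightarrow> \<mu> A = 0) \<and>
     (\<forall>A :: nat \<Rightarrow> 'a set. range A \<subseteq> sets borel \<longrightarrow> disjoint_family A \<longrightarrow>
        (\<lambda>i. \<mu> (A i)) sums \<mu> (\<Union>i. A i))}"

definition jordan_decomposition ::
    "('a::topological_space set \<Rightarrow> real) \<Rightarrow> 'a measure \<Rightarrow> 'a measure \<Rightarrow> bool" where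
  "jordan_decomposition \<mu> p q \<longleftrightarrow>
     finite_measure p \<and> sets p = sets borel \<and> finite_measure q \<and> sets q = sets borel \<and>
     (\<exists>S\<in>sets borel. emeasure p (- S) = 0 \<and> emeasure q S = 0) \<and>
     (\<forall>A\<in>sets borel. \<mu> A = measure p A - measure q A)"

definition pos_part :: "('a::topological_space set \<Rightarrow> real) \<Rightarrow> 'a measure" where
  "pos_part \<mu> = (THE p. \<exists>q. jordan_decomposition \<mu> p q)"

definition neg_part :: "('a::topological_space set \<Rightarrow> real) \<Rightarrow> 'a measure" where
  "neg_part \<mu> = (THE q. \<exists>p. jordan_decomposition \<mu> p q)"

definition push_signed :: "('a::topological_space \<Rightarrow> 'b::topological_space) \<Rightarrow>
    ('a set \<Rightarrow> real) \<Rightarrow> 'b set \<Rightarrow> real" where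
  "push_signed T \<mu> A = (if A \<in> sets borel then \<mu> (T -` A) else 0)"

definition is_norm_on_signed :: "(('a::topological_space set \<Rightarrow> real) \<Rightarrow> real) \<Rightarrow> bool" where
  "is_norm_on_signed N \<longleftrightarrow>
     (\<forall>\<mu>\<in>signed_measures. 0 \<le> N \<mu> \<and> (N \<mu> = 0 \<longleftrightarrow> \<mu> = (\<lambda>A. 0))) \<and>
     (\<forall>\<mu>\<in>signed_measures. \<forall>c. N (\<lambda>A. c * \<mu> A) = \<bar>c\<bar> * N \<mu>) \<and>
     (\<forall>\<mu>\<in>signed_measures. \<forall>\<eta>\<in>signed_measures. N (\<lambda>A. \<mu> A + \<eta> A) \<le> N \<mu> + N \<eta>)"

section \<open>Equilibrium states\<close>

definition invariant_prob :: "('a::topological_space \<Rightarrow> 'a) \<Rightarrow> 'a measure \<Rightarrow> bool" where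
  "invariant_prob T \<eta> \<longleftrightarrow> prob_space \<eta> \<and> sets \<eta> = sets borel \<and> distr \<eta> borel T = \<eta>"

text \<open>
  A finite measurable partition is given by a labelling \<open>c\<close> of the points with finitely many
  labels; \<open>itinerary T c n\<close> then labels the atoms of its refinement
  under \<open>T\<^sup>0, \<dots>, T\<^sup>n\<^sup>-\<^sup>1\<close>.
\<close>

definition itinerary :: "('a \<Rightarrow> 'a) \<Rightarrow> ('a \<Rightarrow> nat) \<Rightarrow> nat \<Rightarrow> 'a \<Rightarrow> nat list" where
  "itinerary T c n x = map (\<lambda>i. c ((T ^^ i) x)) [0..<n]"

definition partition_entropy :: "('a \<Rightarrow> 'a) \<Rightarrow> 'a measure \<Rightarrow> ('a \<Rightarrow> nat) \<Rightarrow> real" where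
  "partition_entropy T \<eta> c =
     lim (\<lambda>n. prob_space.entropy \<eta> (exp 1) (count_space (range (itinerary T c n)))
                (itinerary T c n) / real n)"

definition KS_entropy :: "('a::topological_space \<Rightarrow> 'a) \<Rightarrow> 'a measure \<Rightarrow> ereal" where
  "KS_entropy T \<eta> =
     (SUP c\<in>{c. c \<in> borel \<rightarrow>\<^sub>M count_space UNIV \<and> finite (range c)}. ereal (partition_entropy T \<eta> c))"

definition pressure :: "('a::topological_space \<Rightarrow> 'a) \<Rightarrow> ('a \<Rightarrow> real) \<Rightarrow> ereal" where
  "pressure T \<phi> =
     (SUP \<eta>\<in>{\<eta>. invariant_prob T \<eta> \<and> integrable \<eta> \<phi>}. KS_entropy T \<eta> + ereal (\<integral>x. \<phi> x \<partial>\<eta>))"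

definition equilibrium_state ::
    "('a::topological_space \<Rightarrow> 'a) \<Rightarrow> ('a \<Rightarrow> real) \<Rightarrow> 'a measure \<Rightarrow> bool" where
  "equilibrium_state T \<phi> m \<longleftrightarrow> invariant_prob T m \<and> integrable m \<phi> \<and>
     KS_entropy T m + ereal (\<integral>x. \<phi> x \<partial>m) = pressure T \<phi>"

section \<open>Transfer operators and function spaces on the base\<close>

definition transfer_op :: "('a \<Rightarrow> 'a) \<Rightarrow> ('a \<Rightarrow> real) \<Rightarrow>
    ('a \<Rightarrow> 'v::real_normed_vector) \<Rightarrow> 'a \<Rightarrow> 'v" where
  "transfer_op f \<phi> g x = (\<Sum>\<^sub>\<infinity>y\<in>f -` {x}. exp (\<phi> y) *\<^sub>R g y)"

definition transfer_op_h :: "('a \<Rightarrow> 'a) \<Rightarrow> ('a \<Rightarrow> real) \<Rightarrow> ('a \<Rightarrow> real) \<Rightarrow>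
    ('a \<Rightarrow> real) \<Rightarrow> 'a \<Rightarrow> real" where
  "transfer_op_h f \<phi> h g x = transfer_op f \<phi> (\<lambda>y. g y * h y) x / h x"

text \<open>
  By the Lusin--Souslin theorem the images \<open>f ` A\<close> below are Borel anyway when \<open>f\<close> is a Borel map of
  a Polish space; measurability is recorded because \<open>emeasure\<close> is 0 on non-measurable sets.
\<close>

definition conformal_measure :: "('a::topological_space \<Rightarrow> 'a) \<Rightarrow> ('a \<Rightarrow> real) \<Rightarrow> 'a measure \<Rightarrow> bool" where
  "conformal_measure f J \<nu> \<longleftrightarrow> sets \<nu> = sets borel \<and>
     (\<forall>A\<in>sets borel. inj_on f A \<longrightarrow>
        f ` A \<in> sets borel \<and> emeasure \<nu> (f ` A) = (\<integral>\<^sup>+x\<in>A. ennreal (J x) \<partial>\<nu>))"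

text \<open>
  Functions are identified when they agree \<open>\<nu>\<close>-almost everywhere: a space is a set of functions
  saturated under that relation, and all identities between its elements are
  \<open>\<nu>\<close>-almost everywhere identities.
\<close>

definition normed_function_space ::
    "'a measure \<Rightarrow> ('a \<Rightarrow> real) set \<Rightarrow> (('a \<Rightarrow> real) \<Rightarrow> real) \<Rightarrow> bool" where
  "normed_function_space \<nu> B nrm \<longleftrightarrow>
     (\<lambda>x. 0) \<in> B \<and>
     (\<forall>g\<in>B. \<forall>k\<in>B. (\<lambda>x. g x + k x) \<in> B \<and> nrm (\<lambda>x. g x + k x) \<le> nrm g + nrm k) \<and>
     (\<forall>g\<in>B. \<forall>c. (\<lambda>x. c * g x) \<in> B \<and> nrm (\<lambda>x. c * g x) = \<bar>c\<bar> * nrm g) \<and>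
     (\<forall>g\<in>B. 0 \<le> nrm g \<and> (nrm g = 0 \<longleftrightarrow> (AE x in \<nu>. g x = 0))) \<and>
     (\<forall>g\<in>B. \<forall>k. (AE x in \<nu>. k x = g x) \<longrightarrow> k \<in> B)"

definition closed_under_mult :: "('a \<Rightarrow> real) set \<Rightarrow> bool" where
  "closed_under_mult B \<longleftrightarrow> (\<forall>g\<in>B. \<forall>k\<in>B. (\<lambda>x. g x * k x) \<in> B)"

definition linear_operator_on ::
    "'a measure \<Rightarrow> ('a \<Rightarrow> real) set \<Rightarrow> (('a \<Rightarrow> real) \<Rightarrow> 'a \<Rightarrow> real) \<Rightarrow> bool" where
  "linear_operator_on \<nu> B T \<longleftrightarrow>
     (\<forall>g\<in>B. T g \<in> B) \<and>
     (\<forall>g\<in>B. \<forall>k\<in>B. (AE x in \<nu>. g x = k x) \<longrightarrow> (AE x in \<nu>. T g x = T k x)) \<and>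
     (\<forall>g\<in>B. \<forall>k\<in>B. \<forall>a b. AE x in \<nu>. T (\<lambda>y. a * g y + b * k y) x = a * T g x + b * T k x)"

text \<open>
  The spectrum of an operator on a real normed space is that of its complexification.  The
  estimate in \<open>resolvent_point\<close> makes \<open>z - T\<close> injective with bounded inverse; since completeness is
  not assumed, boundedness of the inverse is not automatic.
\<close>

definition complexification :: "('a \<Rightarrow> real) set \<Rightarrow> ('a \<Rightarrow> complex) set" where
  "complexification B = {u. (\<lambda>x. Re (u x)) \<in> B \<and> (\<lambda>x. Im (u x)) \<in> B}"

definition complex_norm :: "(('a \<Rightarrow> real) \<Rightarrow> real) \<Rightarrow> ('a \<Rightarrow> complex) \<Rightarrow> real" where
  "complex_norm nrm u = nrm (\<lambda>x. Re (u x)) + nrm (\<lambda>x. Im (u x))"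

definition resolvent_point :: "'a measure \<Rightarrow> ('a \<Rightarrow> real) set \<Rightarrow> (('a \<Rightarrow> real) \<Rightarrow> real) \<Rightarrow>
    (('a \<Rightarrow> complex) \<Rightarrow> 'a \<Rightarrow> complex) \<Rightarrow> complex \<Rightarrow> bool" where
  "resolvent_point \<nu> B nrm T z \<longleftrightarrow>
     (\<forall>g\<in>complexification B. \<exists>u\<in>complexification B. AE x in \<nu>. z * u x - T u x = g x) \<and>
     (\<exists>C. \<forall>u\<in>complexification B. complex_norm nrm u \<le> C * complex_norm nrm (\<lambda>x. z * u x - T u x))"

definition spectrum_on :: "'a measure \<Rightarrow> ('a \<Rightarrow> real) set \<Rightarrow> (('a \<Rightarrow> real) \<Rightarrow> real) \<Rightarrow>
    (('a \<Rightarrow> complex) \<Rightarrow> 'a \<Rightarrow> complex) \<Rightarrow> complex set" where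
  "spectrum_on \<nu> B nrm T = {z. \<not> resolvent_point \<nu> B nrm T z}"

section \<open>The hypotheses on the base dynamics\<close>

definition P1_1 :: "('m::polish_space \<Rightarrow> 'm) \<Rightarrow> ('m \<Rightarrow> real) \<Rightarrow> 'm measure \<Rightarrow> ('m \<Rightarrow> real) \<Rightarrow>
    'm measure \<Rightarrow> real \<Rightarrow> bool" where
  "P1_1 f \<phi> m h \<nu> lam \<longleftrightarrow>
     \<phi> \<in> borel_measurable borel \<and> h \<in> borel_measurable borel \<and> 0 < lam \<and>
     equilibrium_state f \<phi> m \<and> m = density \<nu> (\<lambda>x. ennreal (h x)) \<and>
     (\<exists>a>0. \<exists>b. \<forall>x. a \<le> h x \<and> h x \<le> b) \<and>
     (AE x in \<nu>. transfer_op f \<phi> h x = lam * h x) \<and>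
     conformal_measure f (\<lambda>x. lam * exp (- \<phi> x)) \<nu>"

text \<open>
  Boundedness on \<open>Bs\<close> of multiplication by \<open>h\<close> belongs to the reading of \<open>Bs\<close> as a normed space
  closed under multiplication: it is what makes \<open>g \<mapsto> h\<^sup>-\<^sup>1 P (h g)\<close> a spectral projection of the
  normalised operator, with \<open>h\<^sup>-\<^sup>1 N\<^sup>n (h g)\<close> controlled by the norm of \<open>g\<close>.
\<close>

definition P1_2 :: "('m::polish_space \<Rightarrow> 'm) \<Rightarrow> ('m \<Rightarrow> real) \<Rightarrow> ('m \<Rightarrow> real) \<Rightarrow> 'm measure \<Rightarrow> real \<Rightarrow>
    ('m \<Rightarrow> real) set \<Rightarrow> (('m \<Rightarrow> real) \<Rightarrow> real) \<Rightarrow> ('m \<Rightarrow> real) set \<Rightarrow> (('m \<Rightarrow> real) \<Rightarrow> real) \<Rightarrow>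
    (('m \<Rightarrow> real) \<Rightarrow> 'm \<Rightarrow> real) \<Rightarrow> (('m \<Rightarrow> real) \<Rightarrow> 'm \<Rightarrow> real) \<Rightarrow> bool" where
  "P1_2 f \<phi> h \<nu> lam Bs norm_s Bw norm_w Pf Nf \<longleftrightarrow>
     normed_function_space \<nu> Bs norm_s \<and> closed_under_mult Bs \<and>
     normed_function_space \<nu> Bw norm_w \<and> closed_under_mult Bw \<and>
     h \<in> Bs \<and> (\<lambda>x. 1 / h x) \<in> Bs \<and> Bs \<subseteq> Bw \<and> (\<forall>g\<in>Bs. norm_w g \<le> norm_s g) \<and>
     (\<exists>C. \<forall>g\<in>Bs. norm_s (\<lambda>x. h x * g x) \<le> C * norm_s g) \<and>
     (\<forall>g\<in>Bs. transfer_op f \<phi> g \<in> Bs) \<and>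
     (\<exists>U. \<exists>\<rho><\<bar>lam\<bar>. spectrum_on \<nu> Bs norm_s (transfer_op f \<phi>) = {complex_of_real lam} \<union> U \<and>
        U \<subseteq> cball 0 \<rho>) \<and>
     linear_operator_on \<nu> Bs Pf \<and> linear_operator_on \<nu> Bs Nf \<and>
     (\<forall>g\<in>Bs. AE x in \<nu>. inverse lam * transfer_op f \<phi> g x = Pf g x + Nf g x) \<and>
     (\<forall>g\<in>Bs. AE x in \<nu>. Pf (Pf g) x = Pf g x) \<and>
     (\<exists>e\<in>Bs. \<not> (AE x in \<nu>. Pf e x = 0) \<and> (\<forall>g\<in>Bs. \<exists>c. AE x in \<nu>. Pf g x = c * Pf e x)) \<and>
     (\<forall>g\<in>Bs. (AE x in \<nu>. Nf (Pf g) x = 0) \<and> (AE x in \<nu>. Pf (Nf g) x = 0)) \<and>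
     (\<exists>C0>0. \<exists>r. 0 \<le> r \<and> r < 1 \<and>
        (\<forall>g\<in>Bs. \<forall>n\<ge>1. norm_s ((Nf ^^ n) g) \<le> C0 * r ^ n * norm_s g))"

definition P2 :: "('m::polish_space \<Rightarrow> 'm) \<Rightarrow> 'm measure \<Rightarrow> nat \<Rightarrow> (nat \<Rightarrow> 'm set) \<Rightarrow> bool" where
  "P2 f \<nu> d P \<longleftrightarrow>
     (\<forall>i<d. P i \<in> sets borel \<and> bij_betw f (P i) UNIV) \<and> disjoint_family_on P {..<d} \<and>
     emeasure \<nu> (\<Union>i<d. P i) = emeasure \<nu> UNIV"

section \<open>The skew product and its hypotheses\<close>

definition skew_product :: "('m \<Rightarrow> 'm) \<Rightarrow> ('m \<times> 'k \<Rightarrow> 'k) \<Rightarrow> 'm \<times> 'k \<Rightarrow> 'm \<times> 'k" where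
  "skew_product f G z = (f (fst z), G z)"

abbreviation fibre_map :: "('m \<times> 'k \<Rightarrow> 'k) \<Rightarrow> 'm \<Rightarrow> 'k \<Rightarrow> 'k" where
  "fibre_map G \<gamma> \<equiv> (\<lambda>y. G (\<gamma>, y))"

definition P3 :: "('m::polish_space \<Rightarrow> 'm) \<Rightarrow> ('m \<times> 'k::topological_space \<Rightarrow> 'k) \<Rightarrow> 'm measure \<Rightarrow> bool" where
  "P3 f G m \<longleftrightarrow> (\<exists>\<mu>\<^sub>0. invariant_prob (skew_product f G) \<mu>\<^sub>0 \<and> distr \<mu>\<^sub>0 borel fst = m)"

text \<open>The null set of exceptional \<open>\<gamma>\<close> is the same for all \<open>\<mu>\<close>.\<close>

definition G1 :: "('m \<times> 'k::topological_space \<Rightarrow> 'k) \<Rightarrow> 'm measure \<Rightarrow> (('k set \<Rightarrow> real) \<Rightarrow> real) \<Rightarrow> bool" where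
  "G1 G \<nu> norm_o \<longleftrightarrow> is_norm_on_signed norm_o \<and>
     (\<exists>\<alpha>. 0 \<le> \<alpha> \<and> \<alpha> < 1 \<and>
        (AE \<gamma> in \<nu>. \<forall>\<mu>\<in>signed_measures.
           norm_o (push_signed (fibre_map G \<gamma>) \<mu>) \<le> \<alpha> * norm_o \<mu> + \<bar>\<mu> UNIV\<bar>)) \<and>
     (\<forall>\<gamma>. \<forall>\<mu>\<in>signed_measures. norm_o (push_signed (fibre_map G \<gamma>) \<mu>) \<le> norm_o \<mu>)"

definition G3 :: "(('k::topological_space set \<Rightarrow> real) \<Rightarrow> real) \<Rightarrow> bool" where
  "G3 norm_o \<longleftrightarrow> (\<forall>p. prob_space p \<and> sets p = sets borel \<longrightarrow> norm_o (measure p) = 1)"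

section \<open>Disintegration along the fibres\<close>

definition AB :: "'m measure \<Rightarrow> (('m::topological_space \<times> 'k::topological_space) set \<Rightarrow> real) set" where
  "AB m = {\<mu>\<in>signed_measures. absolutely_continuous m (distr (pos_part \<mu>) borel fst) \<and>
                              absolutely_continuous m (distr (neg_part \<mu>) borel fst)}"

definition is_disintegration :: "('m::topological_space \<times> 'k::topological_space) measure \<Rightarrow>
    ('m \<Rightarrow> ('m \<times> 'k) measure) \<Rightarrow> bool" where
  "is_disintegration p \<kappa> \<longleftrightarrow>
     \<kappa> \<in> borel \<rightarrow>\<^sub>M prob_algebra borel \<and>
     (AE \<gamma> in distr p borel fst. emeasure (\<kappa> \<gamma>) ({\<gamma>} \<times> UNIV) = 1) \<and>
     (\<forall>A\<in>sets borel. emeasure p A = (\<integral>\<^sup>+\<gamma>. emeasure (\<kappa> \<gamma>) A \<partial>distr p borel fst))"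

definition disintegration :: "('m::topological_space \<times> 'k::topological_space) measure \<Rightarrow>
    'm \<Rightarrow> ('m \<times> 'k) measure" where
  "disintegration p = (SOME \<kappa>. is_disintegration p \<kappa>)"

definition marginal_density :: "'m measure \<Rightarrow> ('m::topological_space \<times> 'k::topological_space) measure \<Rightarrow>
    'm \<Rightarrow> real" where
  "marginal_density m p \<gamma> = enn2real (RN_deriv m (distr p borel fst) \<gamma>)"

definition restriction_pos :: "'m measure \<Rightarrow> ('m::topological_space \<times> 'k::topological_space) measure \<Rightarrow>
    'm \<Rightarrow> 'k set \<Rightarrow> real" where
  "restriction_pos m p \<gamma> A = marginal_density m p \<gamma> * measure (distr (disintegration p \<gamma>) borel snd) A"

definition restriction :: "'m measure \<Rightarrow> (('m::topological_space \<times> 'k::topological_space) set \<Rightarrow> real) \<Rightarrow>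
    'm \<Rightarrow> 'k set \<Rightarrow> real" where
  "restriction m \<mu> \<gamma> A = restriction_pos m (pos_part \<mu>) \<gamma> A - restriction_pos m (neg_part \<mu>) \<gamma> A"

definition phi1 :: "'m measure \<Rightarrow> (('m::topological_space \<times> 'k::topological_space) set \<Rightarrow> real) \<Rightarrow>
    'm \<Rightarrow> real" where
  "phi1 m \<mu> \<gamma> = marginal_density m (pos_part \<mu>) \<gamma> - marginal_density m (neg_part \<mu>) \<gamma>"

definition norm_inf :: "'m measure \<Rightarrow> (('k set \<Rightarrow> real) \<Rightarrow> real) \<Rightarrow>
    (('m::topological_space \<times> 'k::topological_space) set \<Rightarrow> real) \<Rightarrow> ereal" where
  "norm_inf m norm_o \<mu> = ess_sup m (\<lambda>\<gamma>. ereal (norm_o (restriction m \<mu> \<gamma>)))"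

definition L_inf :: "'m measure \<Rightarrow> (('k set \<Rightarrow> real) \<Rightarrow> real) \<Rightarrow>
    (('m::topological_space \<times> 'k::topological_space) set \<Rightarrow> real) set" where
  "L_inf m norm_o = {\<mu>\<in>AB m. norm_inf m norm_o \<mu> < \<infinity>}"

definition S_inf :: "'m measure \<Rightarrow> (('k set \<Rightarrow> real) \<Rightarrow> real) \<Rightarrow> ('m \<Rightarrow> real) set \<Rightarrow>
    (('m::topological_space \<times> 'k::topological_space) set \<Rightarrow> real) set" where
  "S_inf m norm_o Bs = {\<mu>\<in>L_inf m norm_o. phi1 m \<mu> \<in> Bs}"

definition norm_S_inf :: "'m measure \<Rightarrow> (('k set \<Rightarrow> real) \<Rightarrow> real) \<Rightarrow> (('m \<Rightarrow> real) \<Rightarrow> real) \<Rightarrow>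
    (('m::topological_space \<times> 'k::topological_space) set \<Rightarrow> real) \<Rightarrow> ereal" where
  "norm_S_inf m norm_o norm_s \<mu> = ereal (norm_s (phi1 m \<mu>)) + norm_inf m norm_o \<mu>"

text \<open>
  \<open>L\<^sup>\<infinity>\<^sub>\<nu>\<close> is rendered with \<open>completion \<nu>\<close> so that it is saturated under almost everywhere equality.
\<close>

definition G2_inf :: "'m measure \<Rightarrow> 'm measure \<Rightarrow>
    (('k::topological_space set \<Rightarrow> real) \<Rightarrow> real) \<Rightarrow>
    ('m::topological_space \<Rightarrow> real) set \<Rightarrow> (('m \<Rightarrow> real) \<Rightarrow> real) \<Rightarrow> bool" where
  "G2_inf m \<nu> norm_o Bw norm_w \<longleftrightarrow>
     (\<forall>g\<in>Bw. g \<in> borel_measurable (completion \<nu>) \<and> sup_norm_ae \<nu> g < \<infinity>) \<and>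
     (\<forall>\<mu>\<in>(L_inf m norm_o :: (('m \<times> 'k) set \<Rightarrow> real) set).
        phi1 m \<mu> \<in> Bw \<and> sup_norm_ae \<nu> (phi1 m \<mu>) \<le> ereal (norm_w (phi1 m \<mu>)) \<and>
        ereal (norm_w (phi1 m \<mu>)) \<le> norm_inf m norm_o \<mu>)"

section \<open>The transfer operator on signed measures\<close>

text \<open>
  In \<open>transfer_conditional\<close> the point \<open>inv_into (P i) f \<gamma>\<close> is the preimage of \<open>\<gamma>\<close> in \<open>P i\<close>.  Where
  the marginal density \<open>transfer_op_h f \<phi> h (marginal_density m p)\<close> vanishes, the choice of the
  conditional measure is irrelevant and division by zero makes it the zero measure.  The integral
  in \<open>transfer_pos\<close> has a nonnegative integrand; as a nonnegative integral it does not depend on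
  the values of that integrand on \<open>m\<close>-null sets, where it may fail to be Borel.
\<close>

definition transfer_conditional :: "('m \<Rightarrow> 'm) \<Rightarrow> ('m \<times> 'k \<Rightarrow> 'k) \<Rightarrow> ('m \<Rightarrow> real) \<Rightarrow> ('m \<Rightarrow> real) \<Rightarrow>
    nat \<Rightarrow> (nat \<Rightarrow> 'm set) \<Rightarrow> 'm measure \<Rightarrow>
    ('m::topological_space \<times> 'k::topological_space) measure \<Rightarrow> 'm \<Rightarrow> ('m \<times> 'k) set \<Rightarrow> real" where
  "transfer_conditional f G \<phi> h d P m p \<gamma> A =
     1 / (h \<gamma> * transfer_op_h f \<phi> h (marginal_density m p) \<gamma>) *
     (\<Sum>i<d. let \<gamma>\<^sub>i = inv_into (P i) f \<gamma> in
        marginal_density m p \<gamma>\<^sub>i * h \<gamma>\<^sub>i * exp (\<phi> \<gamma>\<^sub>i) *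
        measure (distr (disintegration p \<gamma>\<^sub>i) borel (skew_product f G)) A)"

definition transfer_pos :: "('m \<Rightarrow> 'm) \<Rightarrow> ('m \<times> 'k \<Rightarrow> 'k) \<Rightarrow> ('m \<Rightarrow> real) \<Rightarrow> ('m \<Rightarrow> real) \<Rightarrow>
    nat \<Rightarrow> (nat \<Rightarrow> 'm set) \<Rightarrow> 'm measure \<Rightarrow>
    ('m::topological_space \<times> 'k::topological_space) measure \<Rightarrow> ('m \<times> 'k) set \<Rightarrow> real" where
  "transfer_pos f G \<phi> h d P m p A =
     enn2real (\<integral>\<^sup>+\<gamma>. ennreal (transfer_conditional f G \<phi> h d P m p \<gamma> A *
                               transfer_op_h f \<phi> h (marginal_density m p) \<gamma>) \<partial>m)"

definition transfer_F :: "('m \<Rightarrow> 'm) \<Rightarrow> ('m \<times> 'k \<Rightarrow> 'k) \<Rightarrow> ('m \<Rightarrow> real) \<Rightarrow> ('m \<Rightarrow> real) \<Rightarrow>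
    nat \<Rightarrow> (nat \<Rightarrow> 'm set) \<Rightarrow> 'm measure \<Rightarrow>
    (('m::topological_space \<times> 'k::topological_space) set \<Rightarrow> real) \<Rightarrow> ('m \<times> 'k) set \<Rightarrow> real" where
  "transfer_F f G \<phi> h d P m \<mu> A =
     transfer_pos f G \<phi> h d P m (pos_part \<mu>) A - transfer_pos f G \<phi> h d P m (neg_part \<mu>) A"

definition normalized_transfer_F :: "('m \<Rightarrow> 'm) \<Rightarrow> ('m \<times> 'k \<Rightarrow> 'k) \<Rightarrow> ('m \<Rightarrow> real) \<Rightarrow> ('m \<Rightarrow> real) \<Rightarrow>
    real \<Rightarrow> nat \<Rightarrow> (nat \<Rightarrow> 'm set) \<Rightarrow> 'm measure \<Rightarrow>
    (('m::topological_space \<times> 'k::topological_space) set \<Rightarrow> real) \<Rightarrow> ('m \<times> 'k) set \<Rightarrow> real" where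
  "normalized_transfer_F f G \<phi> h lam d P m \<mu> A = inverse lam * transfer_F f G \<phi> h d P m \<mu> A"

definition projection_h :: "('m \<Rightarrow> real) \<Rightarrow> (('m \<Rightarrow> real) \<Rightarrow> 'm \<Rightarrow> real) \<Rightarrow> ('m \<Rightarrow> real) \<Rightarrow> 'm \<Rightarrow> real" where
  "projection_h h Pf g x = inverse (h x) * Pf (\<lambda>y. h y * g y) x"

definition V_inf :: "'m measure \<Rightarrow> 'm measure \<Rightarrow> (('k set \<Rightarrow> real) \<Rightarrow> real) \<Rightarrow> ('m \<Rightarrow> real) set \<Rightarrow>
    ('m \<Rightarrow> real) \<Rightarrow> (('m \<Rightarrow> real) \<Rightarrow> 'm \<Rightarrow> real) \<Rightarrow>
    (('m::topological_space \<times> 'k::topological_space) set \<Rightarrow> real) set" where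
  "V_inf m \<nu> norm_o Bs h Pf =
     {\<mu>\<in>S_inf m norm_o Bs. AE x in \<nu>. projection_h h Pf (phi1 m \<mu>) x = 0}"

end

theory Submission
  imports Defs
begin

text \<open>
  Since \<open>m = h \<nu>\<close> and \<open>\<nu>\<close> is conformal, the normalised transfer operator \<open>T\<close> is just the push-forward
  by the skew product, and its restriction to the fibre over \<open>\<gamma>\<close> is the average of the push-forwards of
  the restrictions over the preimages \<open>\<gamma>\<^sub>i\<close>, with weights \<open>h \<gamma>\<^sub>i exp (\<phi> \<gamma>\<^sub>i) / (lam * h \<gamma>)\<close> of sum 1.
  Averaging (G1) gives
  \<open>\<parallel>T\<^sup>n\<^sup>+\<^sup>1 \<mu>\<parallel> \<le> \<alpha> \<parallel>T\<^sup>n \<mu>\<parallel> + \<bar>\<phi>\<^sub>1 (T\<^sup>n \<mu>)\<bar>\<close>, and on the kernel of the projection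
  \<open>h \<phi>\<^sub>1 (T\<^sup>n \<mu>) = N\<^sub>f\<^sup>n (h \<phi>\<^sub>1 \<mu>)\<close> decays exponentially in the strong norm, hence in the sup norm.
  The restrictions exist because \<open>M \<times> K\<close> admits disintegrations, which are obtained from
  conditional distribution functions after embedding \<open>K\<close> into the real line as a Borel retract.
\<close>

section \<open>Signed measures\<close>

text \<open>The obstacle is that \<open>restriction\<close> is defined through a Jordan
  decomposition and an arbitrarily chosen disintegration. Jordan decompositions are not compatible
  with push-forwards: the skew product may map the positive and the negative part onto overlapping
  regions, where they cancel, so the Jordan parts of the image need not be the images of the Jordan
  parts. The way out is \<open>fibre_density\<close>, which says that a signed measure is an
  integral of signed measures on the fibres. This relation passes through push-forwards and
  determines the fibre measures up to a null set, so the restriction of an image can be recognised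
  without ever decomposing the image. A second mismatch lies in the base: \<open>transfer_op\<close>
  sums over all preimages of a point, whereas the operator on measures sums over the branches of the
  partition, and the two have to be shown to agree almost everywhere. Conformality enters in the
  form of inverse branches: it makes them absolutely continuous, so that null sets can be
  transported along them, and it gives the change of variables under which m is stationary for the
  averaging.\<close>

lemma signed_measure_sums:
  fixes A :: "nat \<Rightarrow> 'a::topological_space set"
  assumes "\<mu> \<in> signed_measures" "\<And>i. A i \<in> sets borel" "disjoint_family A"
  shows "(\<lambda>i. \<mu> (A i)) sums \<mu> (\<Union>i. A i)"
  using assms by (auto simp: signed_measures_def)

lemma signed_measure_notin: "\<mu> \<in> signed_measures \<Longrightarrow> A \<notin> sets borel \<Longrightarrow> \<mu> A = 0"
  by (auto simp: signed_measures_def)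

lemma signed_measure_empty:
  fixes \<mu> :: "'a::topological_space set \<Rightarrow> real"
  assumes "\<mu> \<in> signed_measures"
  shows "\<mu> {} = 0"
proof -
  have "(\<lambda>i::nat. \<mu> {}) sums \<mu> (\<Union>i::nat. {})"
    by (rule signed_measure_sums[OF assms, of "\<lambda>_. {}"]) (auto simp: disjoint_family_on_def)
  then have "(\<lambda>i::nat. \<mu> {}) \<longlonglongrightarrow> 0"
    using summable_LIMSEQ_zero sums_summable by blast
  then show ?thesis
    using LIMSEQ_const_iff by blast
qed

lemma signed_measure_Un:
  fixes \<mu> :: "'a::topological_space set \<Rightarrow> real"
  assumes \<mu>: "\<mu> \<in> signed_measures" and A: "A \<in> sets borel" "B \<in> sets borel" "A \<inter> B = {}"
  shows "\<mu> (A \<union> B) = \<mu> A + \<mu> B"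
proof -
  have "(\<lambda>i. \<mu> (binaryset A B i)) sums \<mu> (\<Union>i. binaryset A B i)"
    using A by (intro signed_measure_sums[OF \<mu>])
      (auto simp: binaryset_def disjoint_family_on_def)
  moreover have "(\<lambda>i. \<mu> (binaryset A B i)) sums (\<mu> A + \<mu> B)"
    using binaryset_sums[of \<mu> A B] signed_measure_empty[OF \<mu>] by simp
  ultimately show ?thesis
    by (simp add: UN_binaryset_eq sums_unique2)
qed

lemma signed_measure_Diff:
  fixes \<mu> :: "'a::topological_space set \<Rightarrow> real"
  assumes "\<mu> \<in> signed_measures" "A \<in> sets borel" "B \<in> sets borel" "B \<subseteq> A"
  shows "\<mu> (A - B) = \<mu> A - \<mu> B"
proof -
  have "\<mu> ((A - B) \<union> B) = \<mu> (A - B) + \<mu> B"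
    using assms by (intro signed_measure_Un) auto
  moreover have "(A - B) \<union> B = A" using assms(4) by auto
  ultimately show ?thesis by simp
qed

lemma signed_measure_split:
  fixes \<mu> :: "'a::topological_space set \<Rightarrow> real"
  assumes "\<mu> \<in> signed_measures" "A \<in> sets borel" "S \<in> sets borel"
  shows "\<mu> A = \<mu> (A \<inter> S) + \<mu> (A - S)"
proof -
  have "\<mu> ((A \<inter> S) \<union> (A - S)) = \<mu> (A \<inter> S) + \<mu> (A - S)"
    using assms by (intro signed_measure_Un) auto
  moreover have "(A \<inter> S) \<union> (A - S) = A" by auto
  ultimately show ?thesis by simp
qed

section \<open>Hahn and Jordan decompositions\<close>

text \<open>The successive differences partition \<open>A 0\<close> minus the intersection, and
  their masses telescope. This uses countable additivity only, as signed masses need not be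
  monotone.\<close>

lemma signed_measure_decseq:
  fixes A :: "nat \<Rightarrow> 'a::topological_space set"
  assumes \<mu>: "\<mu> \<in> signed_measures" and A: "\<And>i. A i \<in> sets borel" "decseq A"
  shows "(\<lambda>i. \<mu> (A i)) \<longlonglongrightarrow> \<mu> (\<Inter>i. A i)"
proof -
  define D where "D i = A i - A (Suc i)" for i
  have mono: "A j \<subseteq> A i" if "i \<le> j" for i j using A(2) that by (auto simp: decseq_def)
  have "D i \<inter> D j = {}" if "i < j" for i j
    using mono[of "Suc i" j] that by (auto simp: D_def)
  then have "disjoint_family D"
    unfolding disjoint_family_on_def by (metis Int_commute linorder_neqE_nat)
  then have "(\<lambda>i. \<mu> (D i)) sums \<mu> (\<Union>i. D i)"
    using A by (intro signed_measure_sums[OF \<mu>] \<open>disjoint_family D\<close>) (auto simp: D_def)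
  moreover have "\<mu> (D i) = \<mu> (A i) - \<mu> (A (Suc i))" for i
    unfolding D_def using A mono by (intro signed_measure_Diff[OF \<mu>]) auto
  ultimately have "(\<lambda>n. \<Sum>i<n. \<mu> (A i) - \<mu> (A (Suc i))) \<longlonglongrightarrow> \<mu> (\<Union>i. D i)"
    by (simp add: sums_def)
  then have *: "(\<lambda>n. \<mu> (A 0) - \<mu> (A n)) \<longlonglongrightarrow> \<mu> (\<Union>i. D i)"
    by (simp only: sum_lessThan_telescope'[of "\<lambda>i. \<mu> (A i)"])
  have eq: "(\<Union>i. D i) = A 0 - (\<Inter>i. A i)"
  proof (intro equalityI subsetI)
    fix x assume "x \<in> (\<Union>i. D i)" then show "x \<in> A 0 - (\<Inter>i. A i)" using mono[of 0] by (auto simp: D_def)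
  next
    fix x assume "x \<in> A 0 - (\<Inter>i. A i)"
    then obtain i where "x \<in> A 0" "x \<notin> A i" by auto
    then obtain k where "x \<in> A k" "x \<notin> A (Suc k)"
      by (induction i) auto
    then show "x \<in> (\<Union>i. D i)" by (auto simp: D_def)
  qed
  have "\<mu> (\<Union>i. D i) = \<mu> (A 0) - \<mu> (\<Inter>i. A i)"
    unfolding eq using A by (intro signed_measure_Diff[OF \<mu>]) auto
  with tendsto_diff[OF tendsto_const[of "\<mu> (A 0)"] *] show ?thesis by simp
qed

text \<open>Otherwise every candidate B still contains a piece of mass below -e. Cutting off such
  pieces only raises the mass, so the process never stops. The pieces are disjoint, so their masses
  form a convergent series, which is impossible for terms below -e.\<close>

lemma signed_measure_almost_positive_subset:
  fixes \<mu> :: "'a::topological_space set \<Rightarrow> real"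
  assumes \<mu>: "\<mu> \<in> signed_measures" and A: "A \<in> sets borel" and e: "0 < e"
  obtains B where "B \<in> sets borel" "B \<subseteq> A" "\<mu> A \<le> \<mu> B"
    "\<And>C. C \<in> sets borel \<Longrightarrow> C \<subseteq> B \<Longrightarrow> - e \<le> \<mu> C"
proof (rule ccontr)
  note obt = that
  assume no: "\<not> thesis"
  have ex: "\<exists>C. C \<in> sets borel \<and> C \<subseteq> B \<and> \<mu> C < - e"
    if B: "B \<in> sets borel" "B \<subseteq> A" "\<mu> A \<le> \<mu> B" for B
  proof (rule ccontr)
    assume "\<not> ?thesis"
    then have "thesis" by (intro obt[OF B]) (auto simp: not_less)
    with no show False ..
  qed
  define c where "c B = (SOME C. C \<in> sets borel \<and> C \<subseteq> B \<and> \<mu> C < - e)" for B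
  have c: "c B \<in> sets borel \<and> c B \<subseteq> B \<and> \<mu> (c B) < - e"
    if "B \<in> sets borel" "B \<subseteq> A" "\<mu> A \<le> \<mu> B" for B
    unfolding c_def using ex[OF that] by (rule someI_ex)
  define B where "B n = ((\<lambda>B. B - c B) ^^ n) A" for n
  have BS: "B (Suc n) = B n - c (B n)" for n by (simp add: B_def)
  have inv: "B n \<in> sets borel \<and> B n \<subseteq> A \<and> \<mu> A \<le> \<mu> (B n)" for n
  proof (induction n)
    case 0 then show ?case using A by (simp add: B_def)
  next
    case (Suc n)
    then have *: "c (B n) \<in> sets borel" "c (B n) \<subseteq> B n" "\<mu> (c (B n)) < - e" using c by auto
    then have "\<mu> (B (Suc n)) = \<mu> (B n) - \<mu> (c (B n))"
      unfolding BS using Suc by (intro signed_measure_Diff[OF \<mu>]) auto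
    with Suc * e show ?case by (auto simp: BS)
  qed
  have dec: "B j \<subseteq> B i" if "i \<le> j" for i j
    using that by (induction rule: dec_induct) (auto simp: BS)
  have cB: "c (B i) \<subseteq> B i" "c (B i) \<in> sets borel" "\<mu> (c (B i)) < - e" for i using c inv by auto
  have "c (B i) \<inter> c (B j) = {}" if "i < j" for i j
    using dec[of "Suc i" j] cB[of j] that by (auto simp: BS)
  then have "disjoint_family (\<lambda>i. c (B i))"
    unfolding disjoint_family_on_def by (metis Int_commute linorder_neqE_nat)
  then have "(\<lambda>i. \<mu> (c (B i))) sums \<mu> (\<Union>i. c (B i))"
    using cB by (intro signed_measure_sums[OF \<mu>]) auto
  then have "(\<lambda>i. \<mu> (c (B i))) \<longlonglongrightarrow> 0"
    using summable_LIMSEQ_zero sums_summable by blast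
  then have "0 \<le> - e"
    by (rule LIMSEQ_le_const2) (use cB(3) in \<open>auto intro: less_imp_le\<close>)
  with e show False by simp
qed

text \<open>Almost positive subsets for the tolerances 1/(n+1) are chosen one inside the other.
  Continuity from above carries the lower bound on the mass to their intersection, where all
  tolerances apply at once.\<close>

lemma signed_measure_positive_subset:
  fixes \<mu> :: "'a::topological_space set \<Rightarrow> real"
  assumes \<mu>: "\<mu> \<in> signed_measures" and A: "A \<in> sets borel"
  obtains B where "B \<in> sets borel" "B \<subseteq> A" "\<mu> A \<le> \<mu> B"
    "\<And>C. C \<in> sets borel \<Longrightarrow> C \<subseteq> B \<Longrightarrow> 0 \<le> \<mu> C"
proof -
  define s where "s n B = (SOME B'. B' \<in> sets borel \<and> B' \<subseteq> B \<and> \<mu> B \<le> \<mu> B' \<and>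
     (\<forall>C\<in>sets borel. C \<subseteq> B' \<longrightarrow> - inverse (real (Suc n)) \<le> \<mu> C))" for n B
  have s: "s n B \<in> sets borel \<and> s n B \<subseteq> B \<and> \<mu> B \<le> \<mu> (s n B) \<and>
     (\<forall>C\<in>sets borel. C \<subseteq> s n B \<longrightarrow> - inverse (real (Suc n)) \<le> \<mu> C)" if "B \<in> sets borel" for n B
    unfolding s_def
    by (rule someI_ex, rule signed_measure_almost_positive_subset[OF \<mu> that, of "inverse (real (Suc n))"]) auto
  define B where "B = rec_nat A s"
  have B0: "B 0 = A" and BS: "B (Suc n) = s n (B n)" for n by (auto simp: B_def)
  have Bm: "B n \<in> sets borel" for n by (induction n) (auto simp: B0 BS A s)
  have dec: "decseq B" by (rule decseq_SucI) (use s Bm BS in auto)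
  have ge: "\<mu> A \<le> \<mu> (B n)" for n 
  proof (induction n)
    case (Suc n)
    then show ?case using s[OF Bm[of n], of n] by (auto simp: BS)
  qed (simp add: B0)
  show thesis
  proof (rule that)
    show "(\<Inter>n. B n) \<in> sets borel" using Bm by auto
    show "(\<Inter>n. B n) \<subseteq> A" using B0 by auto
    show "\<mu> A \<le> \<mu> (\<Inter>n. B n)"
      by (rule LIMSEQ_le_const[OF signed_measure_decseq[OF \<mu> Bm dec]]) (use ge in auto)
    fix C assume C: "C \<in> sets borel" "C \<subseteq> (\<Inter>n. B n)"
    have "- inverse (real (Suc n)) \<le> \<mu> C" for n
      using s[OF Bm[of n], of n] C BS[of n] by blast
    then have "(- 0) \<le> \<mu> C"
      by (intro LIMSEQ_le_const2[OF tendsto_minus[OF LIMSEQ_inverse_real_of_nat]]) auto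
    then show "0 \<le> \<mu> C" by simp
  qed
qed

text \<open>S is a union of positive sets whose masses approach the supremum of \<mu>. Being
  positive itself, S attains the supremum, so a disjoint set of positive mass would lead beyond
  it.\<close>

lemma hahn_decomposition:
  fixes \<mu> :: "'a::topological_space set \<Rightarrow> real"
  assumes \<mu>: "\<mu> \<in> signed_measures"
  obtains S where "S \<in> sets borel"
    "\<And>C. C \<in> sets borel \<Longrightarrow> C \<subseteq> S \<Longrightarrow> 0 \<le> \<mu> C"
    "\<And>C. C \<in> sets borel \<Longrightarrow> C \<inter> S = {} \<Longrightarrow> \<mu> C \<le> 0"
proof -
  \<comment> \<open>The supremum is extended-valued because its finiteness is not known yet; it
    follows once S attains it.\<close>
  define s where "s = (SUP A\<in>sets borel. ereal (\<mu> A))"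
  obtain t :: "nat \<Rightarrow> ereal" where t: "range t \<subseteq> (\<lambda>A. ereal (\<mu> A)) ` sets borel" "s = (SUP n. t n)"
    unfolding s_def using Sup_countable_SUP[of "(\<lambda>A. ereal (\<mu> A)) ` sets borel"] by auto
  from t(1) have "\<exists>A. \<forall>n. A n \<in> sets borel \<and> t n = ereal (\<mu> (A n))"
    by (intro choice) (auto simp: image_subset_iff image_iff)
  then obtain A where A: "\<And>n. A n \<in> sets borel" "\<And>n. t n = ereal (\<mu> (A n))" by auto
  have "\<exists>B. \<forall>n. B n \<in> sets borel \<and> \<mu> (A n) \<le> \<mu> (B n) \<and> (\<forall>C\<in>sets borel. C \<subseteq> B n \<longrightarrow> 0 \<le> \<mu> C)"
    by (intro choice allI) (metis signed_measure_positive_subset[OF \<mu> A(1)])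
  then obtain B where B: "\<And>n. B n \<in> sets borel" "\<And>n. \<mu> (A n) \<le> \<mu> (B n)"
    "\<And>n C. C \<in> sets borel \<Longrightarrow> C \<subseteq> B n \<Longrightarrow> 0 \<le> \<mu> C" by blast
  define S where "S = (\<Union>n. B n)"
  have S: "S \<in> sets borel" using B by (auto simp: S_def)
  have pos: "0 \<le> \<mu> C" if C: "C \<in> sets borel" "C \<subseteq> S" for C
  proof -
    have eq: "C = (\<Union>n. C \<inter> disjointed B n)"
      using C(2) by (simp add: UN_disjointed_eq S_def flip: Int_UN_distrib) blast
    have dm: "disjointed B n \<in> sets borel" for n
      using B(1) by (meson range_subsetD sets.range_disjointed_sets image_subset_iff)
    have "(\<lambda>n. \<mu> (C \<inter> disjointed B n)) sums \<mu> (\<Union>n. C \<inter> disjointed B n)" (is "?f sums ?r")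
      using C dm by (intro signed_measure_sums[OF \<mu>] disjoint_family_on_bisimulation[OF disjoint_family_disjointed[of B]]) auto
    moreover have nn: "0 \<le> \<mu> (C \<inter> disjointed B n)" for n
      using C dm disjointed_subset[of B n] by (intro B(3)[where n=n]) auto
    ultimately have "0 \<le> ?r"
      using sums_le[of "\<lambda>_. 0" ?f 0 ?r] sums_zero by blast
    then show ?thesis by (subst eq)
  qed
  have max: "s = ereal (\<mu> S)"
  proof (rule antisym)
    have "t n \<le> ereal (\<mu> S)" for n
    proof -
      have "\<mu> S = \<mu> (S \<inter> B n) + \<mu> (S - B n)" using S B(1) by (intro signed_measure_split[OF \<mu>])
      moreover have "S \<inter> B n = B n" by (auto simp: S_def)
      moreover have "0 \<le> \<mu> (S - B n)" using S B(1) by (intro pos) auto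
      ultimately show ?thesis using A(2)[of n] B(2)[of n] by simp
    qed
    then show "s \<le> ereal (\<mu> S)" unfolding t(2) by (intro SUP_least)
    show "ereal (\<mu> S) \<le> s" unfolding s_def using S by (intro SUP_upper)
  qed
  show thesis
  proof (rule that[OF S pos])
    fix C :: "'a set" assume C: "C \<in> sets borel" "C \<inter> S = {}"
    have "ereal (\<mu> (C \<union> S)) \<le> s" unfolding s_def using S C by (intro SUP_upper) auto
    then show "\<mu> C \<le> 0" using signed_measure_Un[OF \<mu> C(1) S C(2)] max by simp
  qed auto
qed

lemma nonneg_signed_measure_eq_measure:
  fixes \<eta> :: "'a::topological_space set \<Rightarrow> real"
  assumes \<eta>: "\<eta> \<in> signed_measures" and nn: "\<And>A. 0 \<le> \<eta> A"
  obtains p where "finite_measure p" "sets p = sets borel" "\<And>A. A \<in> sets borel \<Longrightarrow> measure p A = \<eta> A"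
proof -
  define p where "p = measure_of UNIV (sets borel) (\<lambda>A. ennreal (\<eta> A))"
  have sa: "sigma_algebra UNIV (sets (borel :: 'a measure))"
    using sets.sigma_algebra_axioms[of "borel :: 'a measure"] by simp
  have sets_p: "sets p = sets borel"
    unfolding p_def using sigma_algebra.sets_measure_of_eq[OF sa] by simp
  have e: "emeasure p A = ennreal (\<eta> A)" if "A \<in> sets borel" for A
    unfolding p_def
  proof (rule emeasure_measure_of_sigma[OF sa _ _ that])
    show "positive (sets borel) (\<lambda>A. ennreal (\<eta> A))"
      by (simp add: positive_def signed_measure_empty[OF \<eta>])
    show "countably_additive (sets borel) (\<lambda>A. ennreal (\<eta> A))"
      unfolding countably_additive_def
    proof safe
      fix A :: "nat \<Rightarrow> 'a set" assume A: "range A \<subseteq> sets borel" "disjoint_family A"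
      then have "(\<lambda>i. \<eta> (A i)) sums \<eta> (\<Union>i. A i)" by (intro signed_measure_sums[OF \<eta>]) auto
      then show "(\<Sum>i. ennreal (\<eta> (A i))) = ennreal (\<eta> (\<Union>i. A i))"
        using suminf_ennreal2[OF nn] by (metis sums_summable sums_unique)
    qed
  qed
  show thesis
  proof (rule that)
    show "finite_measure p"
      by (rule finite_measureI) (simp add: sets_eq_imp_space_eq[OF sets_p] e)
    show "measure p A = \<eta> A" if "A \<in> sets borel" for A
      using e[OF that] nn[of A] by (simp add: measure_def)
  qed (rule sets_p)
qed

lemma measure_diff_signed_measure:
  assumes p: "finite_measure p" "sets p = sets borel" and q: "finite_measure q" "sets q = sets borel"
  shows "(\<lambda>A. a * measure p A - b * measure q A) \<in> signed_measures"
  unfolding signed_measures_def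
proof safe
  fix A :: "'a set" assume "A \<notin> sets borel"
  then show "a * measure p A - b * measure q A = 0"
    using p q by (simp add: measure_notin_sets)
next
  fix A :: "nat \<Rightarrow> 'a set" assume A: "range A \<subseteq> sets borel" "disjoint_family A"
  then show "(\<lambda>i. a * measure p (A i) - b * measure q (A i)) sums
      (a * measure p (\<Union>i. A i) - b * measure q (\<Union>i. A i))"
    using finite_measure.finite_measure_UNION[OF p(1), of A]
      finite_measure.finite_measure_UNION[OF q(1), of A] p q
    by (intro sums_diff sums_mult) auto
qed

lemma signed_measure_restrict:
  fixes \<mu> :: "'a::topological_space set \<Rightarrow> real"
  assumes \<mu>: "\<mu> \<in> signed_measures" and S: "S \<in> sets borel"
  shows "(\<lambda>A. if A \<in> sets borel then c * \<mu> (A \<inter> S) else 0) \<in> signed_measures"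
  unfolding signed_measures_def
proof safe
  fix A :: "nat \<Rightarrow> 'a set" assume A: "range A \<subseteq> sets borel" "disjoint_family A"
  then have "(\<lambda>i. \<mu> (A i \<inter> S)) sums \<mu> (\<Union>i. A i \<inter> S)"
    using S by (intro signed_measure_sums[OF \<mu>] disjoint_family_on_bisimulation[OF A(2)]) auto
  then have "(\<lambda>i. c * \<mu> (A i \<inter> S)) sums (c * \<mu> (\<Union>i. A i \<inter> S))"
    by (rule sums_mult)
  moreover have "A i \<in> sets borel" for i using A by auto
  moreover have "(\<Union>i. A i \<inter> S) = (\<Union>i. A i) \<inter> S" by blast
  ultimately show "(\<lambda>i. if A i \<in> sets borel then c * \<mu> (A i \<inter> S) else 0) sums
      (if (\<Union>i. A i) \<in> sets borel then c * \<mu> ((\<Union>i. A i) \<inter> S) else 0)"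
    by auto
qed auto

text \<open>Jordan parts are minimal: p lives on the Hahn set S, where it coincides with \<mu> and
  is therefore at most p', and q is treated in the same way off S. Uniqueness follows by comparing
  two Jordan decompositions in both directions.\<close>

lemma jordan_decomposition_le:
  assumes j: "jordan_decomposition \<mu> p q" and p': "finite_measure p'"
    and q': "finite_measure q'" and eq: "\<And>A. A \<in> sets borel \<Longrightarrow> \<mu> A = measure p' A - measure q' A"
    and A: "A \<in> sets borel" and sets': "sets p' = sets borel" "sets q' = sets borel"
  shows "measure p A \<le> measure p' A" and "measure q A \<le> measure q' A"
proof -
  from j obtain S where S: "S \<in> sets borel" "emeasure p (- S) = 0" "emeasure q S = 0"
    and p: "finite_measure p" "sets p = sets borel" and q: "finite_measure q" "sets q = sets borel"
    and \<mu>: "\<And>A. A \<in> sets borel \<Longrightarrow> \<mu> A = measure p A - measure q A"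
    by (auto simp: jordan_decomposition_def)
  note [simp] = p(2) q(2) sets'
  have S': "- S \<in> sets borel" using S(1) by auto
  have "measure p (A - S) = 0" "measure q (A \<inter> S) = 0"
  proof -
    have "emeasure p (A - S) \<le> emeasure p (- S)" "emeasure q (A \<inter> S) \<le> emeasure q S"
      using S(1) S' A by (auto intro!: emeasure_mono)
    then show "measure p (A - S) = 0" "measure q (A \<inter> S) = 0" using S by (auto simp: measure_def)
  qed
  moreover have split: "measure N A = measure N (A \<inter> S) + measure N (A - S)"
    if "finite_measure N" "sets N = sets borel" for N
    using finite_measure.finite_measure_Union[OF that(1), of "A \<inter> S" "A - S"] A S that
    by (auto simp: Int_Diff_Un)
  moreover note split[OF p] split[OF q] split[OF p' sets'(1)] split[OF q' sets'(2)]
  moreover have "A \<inter> S \<in> sets borel" "A - S \<in> sets borel" using A S by auto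
  moreover note \<mu>[OF this(1)] \<mu>[OF this(2)] eq[OF this(1)] eq[OF this(2)]
  ultimately show "measure p A \<le> measure p' A" "measure q A \<le> measure q' A"
    using measure_nonneg[of q' "A \<inter> S"] measure_nonneg[of p' "A - S"] p q p' q' sets' by linarith+
qed

lemma jordan_decomposition_unique:
  assumes "jordan_decomposition \<mu> p q" "jordan_decomposition \<mu> p' q'"
  shows "p = p'" and "q = q'"
proof -
  from assms have f: "finite_measure p" "finite_measure p'" "finite_measure q" "finite_measure q'"
    and s: "sets p = sets borel" "sets p' = sets borel" "sets q = sets borel" "sets q' = sets borel"
    and \<mu>: "\<And>A. A \<in> sets borel \<Longrightarrow> \<mu> A = measure p A - measure q A"
      "\<And>A. A \<in> sets borel \<Longrightarrow> \<mu> A = measure p' A - measure q' A"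
    by (auto simp: jordan_decomposition_def)
  have "measure p A = measure p' A \<and> measure q A = measure q' A" if "A \<in> sets borel" for A
    using jordan_decomposition_le[OF assms(1) f(2,4) \<mu>(2) that s(2,4)]
      jordan_decomposition_le[OF assms(2) f(1,3) \<mu>(1) that s(1,3)] by auto
  then show "p = p'" "q = q'"
    using f s by (auto intro!: measure_eqI simp: finite_measure.emeasure_eq_measure)
qed

lemma jordan_decomposition_exists:
  fixes \<mu> :: "'a::topological_space set \<Rightarrow> real"
  assumes \<mu>: "\<mu> \<in> signed_measures"
  shows "\<exists>p q. jordan_decomposition \<mu> p q"
proof -
  obtain S where S: "S \<in> sets borel"
    and pos: "\<And>C. C \<in> sets borel \<Longrightarrow> C \<subseteq> S \<Longrightarrow> 0 \<le> \<mu> C"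
    and neg: "\<And>C. C \<in> sets borel \<Longrightarrow> C \<inter> S = {} \<Longrightarrow> \<mu> C \<le> 0"
    using hahn_decomposition[OF \<mu>] by blast
  have S': "- S \<in> sets borel" using S by auto
  obtain p where p: "finite_measure p" "sets p = sets borel"
    "\<And>A. A \<in> sets borel \<Longrightarrow> measure p A = (if A \<in> sets borel then 1 * \<mu> (A \<inter> S) else 0)"
    by (rule nonneg_signed_measure_eq_measure[OF signed_measure_restrict[OF \<mu> S, of 1]]) (auto intro!: pos S)
  obtain q where q: "finite_measure q" "sets q = sets borel"
    "\<And>A. A \<in> sets borel \<Longrightarrow> measure q A = (if A \<in> sets borel then (- 1) * \<mu> (A \<inter> - S) else 0)"
    by (rule nonneg_signed_measure_eq_measure[OF signed_measure_restrict[OF \<mu> S', of "- 1"]])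
      (auto intro!: neg S')
  have "jordan_decomposition \<mu> p q"
    unfolding jordan_decomposition_def
  proof (intro conjI p q bexI[OF _ S] ballI)
    show "emeasure p (- S) = 0" "emeasure q S = 0"
      using S S' p(3)[OF S'] q(3)[OF S] signed_measure_empty[OF \<mu>]
      by (simp_all add: finite_measure.emeasure_eq_measure[OF p(1)] finite_measure.emeasure_eq_measure[OF q(1)])
    fix A :: "'a set" assume A: "A \<in> sets borel"
    show "\<mu> A = measure p A - measure q A"
      using signed_measure_split[OF \<mu> A S] p(3)[OF A] q(3)[OF A] A by (simp add: Diff_eq)
  qed
  then show ?thesis by blast
qed

text \<open>Existence together with uniqueness makes the definite descriptions in
  \<open>pos_part\<close> and \<open>neg_part\<close> meaningful.\<close>

lemma jordan_parts:
  fixes \<mu> :: "'a::topological_space set \<Rightarrow> real"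
  assumes "\<mu> \<in> signed_measures"
  shows "jordan_decomposition \<mu> (pos_part \<mu>) (neg_part \<mu>)"
proof -
  obtain p q where j: "jordan_decomposition \<mu> p q" using jordan_decomposition_exists[OF assms] by blast
  have "pos_part \<mu> = p" "neg_part \<mu> = q"
    unfolding pos_part_def neg_part_def using j jordan_decomposition_unique[OF _ j] by blast+
  with j show ?thesis by simp
qed

text \<open>The uniqueness theorem for intersection-stable generators, for signed measures. UNIV in
  the generator gives equal total masses, which is what the complement step uses.\<close>

lemma signed_measure_eqI_generator:
  fixes \<mu> \<eta> :: "'a::topological_space set \<Rightarrow> real"
  assumes \<mu>: "\<mu> \<in> signed_measures" "\<eta> \<in> signed_measures"
    and E: "Int_stable E" "sets borel = sigma_sets UNIV E" "UNIV \<in> E"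
    and eq: "\<And>A. A \<in> E \<Longrightarrow> \<mu> A = \<eta> A"
  shows "\<mu> = \<eta>"
proof
  fix A
  show "\<mu> A = \<eta> A"
  proof (cases "A \<in> sets borel")
    case True
    then have "E \<subseteq> Pow UNIV" "A \<in> sigma_sets UNIV E" using E by auto
    with E(1) show ?thesis
    proof (induction rule: sigma_sets_induct_disjoint[consumes 3, case_names basic empty compl union])
      case (compl A)
      then have "A \<in> sets borel" using E by simp
      then show ?case
        using compl signed_measure_Diff[OF \<mu>(1), of UNIV A] signed_measure_Diff[OF \<mu>(2), of UNIV A] eq[OF E(3)]
        by simp
    next
      case (union A)
      then have "A i \<in> sets borel" for i using E by auto
      then show ?case
        using union signed_measure_sums[OF \<mu>(1), of A] signed_measure_sums[OF \<mu>(2), of A] sums_unique2 by force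
    qed (auto simp: eq signed_measure_empty[OF \<mu>(1)] signed_measure_empty[OF \<mu>(2)])
  qed (simp add: signed_measure_notin \<mu>)
qed

lemma signed_measure_sum:
  assumes "finite I" "\<And>i. i \<in> I \<Longrightarrow> \<eta> i \<in> signed_measures"
  shows "(\<lambda>A. \<Sum>i\<in>I. c i * \<eta> i A) \<in> signed_measures"
  using assms(2)
  unfolding signed_measures_def by (auto intro!: sums_sum sums_mult sum.neutral)

lemma push_signed_in_signed_measures:
  assumes [measurable]: "T \<in> borel \<rightarrow>\<^sub>M borel" and \<mu>: "\<mu> \<in> signed_measures"
  shows "push_signed T \<mu> \<in> signed_measures"
  unfolding signed_measures_def
proof safe
  fix A :: "nat \<Rightarrow> 'b set" assume A: "range A \<subseteq> sets borel" "disjoint_family A"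
  have m: "T -` B \<in> sets borel" if "B \<in> sets borel" for B
    using measurable_sets[OF assms(1) that] by simp
  have Ai: "A i \<in> sets borel" for i using A by auto
  from A have "(\<lambda>i. \<mu> (T -` A i)) sums \<mu> (\<Union>i. T -` A i)"
    by (intro signed_measure_sums[OF \<mu>] m) (auto simp: disjoint_family_on_def)
  then show "(\<lambda>i. push_signed T \<mu> (A i)) sums push_signed T \<mu> (\<Union>i. A i)"
    using Ai by (simp add: push_signed_def vimage_UN sets.countable_UN)
qed (auto simp: push_signed_def)

section \<open>Disintegration along the fibres\<close>

lemma integrable_imp_set_integrable:
  fixes f :: "'a \<Rightarrow> real"
  shows "integrable M f \<Longrightarrow> A \<in> sets M \<Longrightarrow> set_integrable M A f"
  unfolding set_integrable_def by (rule integrable_mult_indicator)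

text \<open>The Radon-Nikodym derivative is made real-valued because densities are compared later
  through their differences.\<close>

lemma ex_real_density:
  assumes "finite_measure Q" "finite_measure N" "sets N = sets Q" "absolutely_continuous Q N"
  obtains D :: "'a \<Rightarrow> real" where "integrable Q D"
    "\<And>A. A \<in> sets Q \<Longrightarrow> (\<integral>x\<in>A. D x \<partial>Q) = measure N A"
proof -
  interpret Q: finite_measure Q by fact
  interpret N: finite_measure N by fact
  note [measurable_cong] = assms(3)
  define R where "R = RN_deriv Q N"
  have R[measurable]: "R \<in> borel_measurable Q" by (simp add: R_def)
  have e: "(\<integral>\<^sup>+x\<in>A. R x \<partial>Q) = emeasure N A" if "A \<in> sets Q" for A
    using Q.density_RN_deriv[OF assms(4,3)] that by (metis R R_def emeasure_density)
  have "AE x in Q. R x \<noteq> \<infinity>"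
    unfolding R_def using Q.RN_deriv_finite[OF N.sigma_finite_measure_axioms assms(4,3)] .
  then have AE: "AE x in Q. ennreal (enn2real (R x)) = R x"
    by eventually_elim (simp add: less_top)
  have i: "(\<integral>\<^sup>+x\<in>A. ennreal (enn2real (R x)) \<partial>Q) = emeasure N A" if "A \<in> sets Q" for A
    unfolding e[OF that, symmetric] using AE by (intro nn_integral_cong_AE) auto
  show thesis
  proof (rule that)
    have "(\<integral>\<^sup>+x. ennreal (enn2real (R x)) \<partial>Q) = (\<integral>\<^sup>+x\<in>space Q. ennreal (enn2real (R x)) \<partial>Q)"
      by (intro nn_integral_cong) auto
    also have "\<dots> < \<infinity>" using i[OF sets.top] N.emeasure_finite by (simp add: less_top[symmetric])
    finally show "integrable Q (\<lambda>x. enn2real (R x))"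
      by (intro integrableI_nonneg) auto
    fix A assume A[measurable]: "A \<in> sets Q"
    have "(\<integral>x\<in>A. enn2real (R x) \<partial>Q) = enn2real (\<integral>\<^sup>+x. ennreal (indicator A x * enn2real (R x)) \<partial>Q)"
      unfolding set_lebesgue_integral_def by (subst integral_eq_nn_integral) auto
    also have "(\<integral>\<^sup>+x. ennreal (indicator A x * enn2real (R x)) \<partial>Q) = (\<integral>\<^sup>+x\<in>A. ennreal (enn2real (R x)) \<partial>Q)"
      by (intro nn_integral_cong) (auto split: split_indicator)
    finally show "(\<integral>x\<in>A. enn2real (R x) \<partial>Q) = measure N A" by (simp add: i[OF A] measure_def)
  qed
qed

text \<open>E is a version of the conditional probability that the second coordinate is at most t,
  given the first. Its values for t < 0 and for t \<ge> 1 are prescribed at every x, so that the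
  distribution functions assembled from different t have the right limits everywhere.\<close>

lemma conditional_probability_below:
  fixes p :: "('m::second_countable_topology \<times> real) measure"
  assumes p: "finite_measure p" "sets p = sets borel" "emeasure p (UNIV \<times> - {0..1}) = 0"
  obtains E :: "'m \<Rightarrow> real" where "E \<in> borel_measurable borel" "\<And>x. 0 \<le> E x" "\<And>x. E x \<le> 1"
    "t < 0 \<Longrightarrow> E = (\<lambda>x. 0)" "1 \<le> t \<Longrightarrow> E = (\<lambda>x. 1)"
    "\<And>A. A \<in> sets borel \<Longrightarrow> (\<integral>x\<in>A. E x \<partial>distr p borel fst) = measure p (A \<times> {..t})"
proof -
  interpret p: finite_measure p by fact
  note [measurable_cong] = p(2)
  define Q where "Q = distr p borel fst"
  define N where "N = distr (density p (indicator (UNIV \<times> {..t}))) borel fst"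
  have setsQ[measurable_cong]: "sets Q = sets borel" by (simp add: Q_def)
  have fst_p: "fst \<in> p \<rightarrow>\<^sub>M borel"
    unfolding measurable_cong_sets[OF p(2) refl]
    by (intro borel_measurable_continuous_onI continuous_intros)
  interpret Q: finite_measure Q unfolding Q_def by (rule p.finite_measure_distr[OF fst_p])
  have rect: "A \<times> B \<in> sets p" if "A \<in> sets borel" "B \<in> sets borel" for A B
    using that unfolding p(2) by (rule borel_Times)
  have vim: "fst -` A \<inter> space p = A \<times> UNIV" for A using sets_eq_imp_space_eq[OF p(2)] by auto
  have N: "emeasure N A = emeasure p (A \<times> {..t})" if A: "A \<in> sets borel" for A
  proof -
    have "emeasure N A = emeasure (density p (indicator (UNIV \<times> {..t}))) (A \<times> UNIV)"
      unfolding N_def using A fst_p by (subst emeasure_distr) (auto simp: vim)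
    also have "\<dots> = (\<integral>\<^sup>+z. indicator (A \<times> {..t}) z \<partial>p)"
      using A by (subst emeasure_density) (auto intro!: rect nn_integral_cong borel_measurable_indicator split: split_indicator)
    also have "\<dots> = emeasure p (A \<times> {..t})" using A by (intro nn_integral_indicator rect) auto
    finally show ?thesis .
  qed
  have Q: "emeasure Q A = emeasure p (A \<times> UNIV)" if "A \<in> sets borel" for A
    unfolding Q_def using that fst_p by (simp add: emeasure_distr vim)
  have mQ: "measure Q A = measure p (A \<times> UNIV)" if "A \<in> sets borel" for A
    using Q[OF that] by (simp add: measure_def)
  have mN: "measure N A = measure p (A \<times> {..t})" if "A \<in> sets borel" for A
    using N[OF that] by (simp add: measure_def)
  have setsN: "sets N = sets Q" by (simp add: N_def Q_def)
  have "finite_measure N"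
    by (rule finite_measureI) (simp add: N sets_eq_imp_space_eq[OF setsN] sets_eq_imp_space_eq[OF setsQ])
  moreover have "absolutely_continuous Q N"
    unfolding absolutely_continuous_def null_sets_def
  proof safe
    fix A assume A: "A \<in> sets Q" "emeasure Q A = 0"
    then have "emeasure p (A \<times> {..t}) \<le> emeasure p (A \<times> UNIV)"
      using setsQ by (intro emeasure_mono rect) auto
    with A show "emeasure N A = 0" by (simp add: N Q setsQ)
  qed (simp add: setsN)
  ultimately obtain D where D: "integrable Q D" "\<And>A. A \<in> sets Q \<Longrightarrow> (\<integral>x\<in>A. D x \<partial>Q) = measure N A"
    using ex_real_density[OF Q.finite_measure_axioms _ setsN] by metis
  have c: "(\<integral>x\<in>A. (c::real) \<partial>Q) = c * measure Q A" if "A \<in> sets borel" for A c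
    using that setsQ by (simp add: set_lebesgue_integral_def)
  \<comment> \<open>An almost everywhere inequality between densities is read off from their
    integrals over all Borel sets. The four bounds on D below are instances.\<close>
  have cmp: "AE x in Q. f x \<le> g x" if f: "integrable Q f" "integrable Q g"
    "\<And>A. A \<in> sets borel \<Longrightarrow> (\<integral>x\<in>A. f x \<partial>Q) \<le> (\<integral>x\<in>A. g x \<partial>Q)" for f g :: "'m \<Rightarrow> real"
  proof -
    have "AE x in Q. 0 \<le> g x - f x"
    proof (rule Q.density_nonneg)
      fix A assume A: "A \<in> sets Q"
      have "(\<integral>x\<in>A. g x - f x \<partial>Q) = (\<integral>x\<in>A. g x \<partial>Q) - (\<integral>x\<in>A. f x \<partial>Q)"
        using f A by (intro set_integral_diff integrable_imp_set_integrable)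
      then show "0 \<le> (\<integral>x\<in>A. g x - f x \<partial>Q)" using f(3) A setsQ by simp
    qed (use f in auto)
    then show ?thesis by simp
  qed
  have D0: "AE x in Q. 0 \<le> D x"
    by (rule cmp) (use D setsQ in \<open>auto simp: c\<close>)
  have D1: "AE x in Q. D x \<le> 1"
    by (rule cmp) (use D setsQ in \<open>auto simp: c mN mQ intro!: p.finite_measure_mono rect\<close>)
  have Dn: "AE x in Q. D x = 0" if "t < 0"
  proof -
    have "emeasure p (A \<times> {..t}) \<le> emeasure p (UNIV \<times> - {0..1})" if "A \<in> sets borel" for A
      using \<open>t < 0\<close> that by (intro emeasure_mono rect) auto
    then have "measure N A = 0" if "A \<in> sets borel" for A
      using that p(3) by (simp add: N measure_def)
    then have "AE x in Q. D x \<le> 0"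
      by (intro cmp) (use D setsQ in \<open>auto simp: c\<close>)
    with D0 show ?thesis by eventually_elim auto
  qed
  have Dp: "AE x in Q. D x = 1" if "1 \<le> t"
  proof -
    have "measure p (A \<times> {..t}) = measure p (A \<times> UNIV)" if A: "A \<in> sets borel" for A
    proof -
      have "AE z in p. z \<notin> UNIV \<times> - {0..1}"
        using p(3) by (intro AE_not_in) (auto simp: null_sets_def intro!: rect)
      then show ?thesis using A \<open>1 \<le> t\<close>
        by (intro p.finite_measure_eq_AE rect) (auto elim!: eventually_mono)
    qed
    then have "AE x in Q. 1 \<le> D x"
      by (intro cmp) (use D setsQ in \<open>auto simp: c mQ mN\<close>)
    with D1 show ?thesis by eventually_elim auto
  qed
  \<comment> \<open>By the four bounds this clipping changes D on a null set only, and it turns the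
    bounds into pointwise ones.\<close>
  define E where "E x = (if t < 0 then 0 else if 1 \<le> t then 1 else max 0 (min 1 (D x)))" for x
  have [measurable]: "D \<in> borel_measurable borel"
    using borel_measurable_integrable[OF D(1)] setsQ by (simp cong: measurable_cong_sets)
  have AE: "AE x in Q. E x = D x"
    using D0 D1 Dn Dp by (cases "t < 0"; cases "1 \<le> t") (auto simp: E_def)
  show thesis
  proof (rule that[of E])
    show Em: "E \<in> borel_measurable borel" unfolding E_def by measurable
    fix A :: "'m set" assume A: "A \<in> sets borel"
    have "(\<integral>x\<in>A. E x \<partial>Q) = (\<integral>x\<in>A. D x \<partial>Q)"
      unfolding set_lebesgue_integral_def using AE Em A setsQ
      by (intro integral_cong_AE) auto
    then show "(\<integral>x\<in>A. E x \<partial>distr p borel fst) = measure p (A \<times> {..t})"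
      using D(2)[of A] A mN setsQ by (simp add: Q_def[symmetric])
  qed (auto simp: E_def)
qed

lemma ex_conditional_distribution_real:
  fixes p :: "('m::second_countable_topology \<times> real) measure"
  assumes p: "finite_measure p" "sets p = sets borel" "emeasure p (UNIV \<times> - {0..1}) = 0"
  obtains \<kappa> where "\<kappa> \<in> borel \<rightarrow>\<^sub>M prob_algebra (borel :: real measure)"
    "\<And>A B. A \<in> sets borel \<Longrightarrow> B \<in> sets borel \<Longrightarrow>
      emeasure p (A \<times> B) = (\<integral>\<^sup>+x\<in>A. emeasure (\<kappa> x) B \<partial>distr p borel fst)"
proof -
  interpret p: finite_measure p by fact
  note [measurable_cong] = p(2)
  define Q where "Q = distr p borel fst"
  have setsQ[measurable_cong]: "sets Q = sets borel" by (simp add: Q_def)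
  have fst_p: "fst \<in> p \<rightarrow>\<^sub>M borel"
    unfolding measurable_cong_sets[OF p(2) refl]
    by (intro borel_measurable_continuous_onI continuous_intros)
  interpret Q: finite_measure Q unfolding Q_def by (rule p.finite_measure_distr[OF fst_p])
  have rect: "A \<times> B \<in> sets p" if "A \<in> sets borel" "B \<in> sets borel" for A B
    using that unfolding p(2) by (rule borel_Times)
  have "\<exists>E. \<forall>t. E t \<in> borel_measurable borel \<and> (\<forall>x. 0 \<le> E t x \<and> E t x \<le> 1) \<and>
      (t < 0 \<longrightarrow> E t = (\<lambda>x. 0)) \<and> (1 \<le> t \<longrightarrow> E t = (\<lambda>x. 1)) \<and>
      (\<forall>A\<in>sets borel. (\<integral>x\<in>A. E t x \<partial>Q) = measure p (A \<times> {..t}))"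
    unfolding Q_def
    apply (intro choice allI)
    subgoal for t by (rule conditional_probability_below[OF p, of t]) blast
    done
  then obtain E :: "real \<Rightarrow> 'm \<Rightarrow> real" where
    E[measurable]: "\<And>t. E t \<in> borel_measurable borel"
    and E01: "\<And>t x. 0 \<le> E t x" "\<And>t x. E t x \<le> 1"
    and Eneg: "\<And>t. t < 0 \<Longrightarrow> E t = (\<lambda>x. 0)" and Eone: "\<And>t. 1 \<le> t \<Longrightarrow> E t = (\<lambda>x. 1)"
    and Eint: "\<And>t A. A \<in> sets borel \<Longrightarrow> (\<integral>x\<in>A. E t x \<partial>Q) = measure p (A \<times> {..t})"
    by blast
  have iE: "integrable Q (E t)" for t
    by (rule Q.integrable_const_bound[of _ 1]) (use E01 in \<open>auto\<close>)
  define R where "R t = {q\<in>\<rat>. t < q}" for t :: real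
  have R: "countable (R t)" "R t \<noteq> {}" for t
    using countable_rat Rats_dense_in_real[of t "t + 1"]
    by (auto simp: R_def intro: countable_subset[OF _ countable_rat])
  \<comment> \<open>The versions \<open>E t\<close> for different t need not be monotone in t at a
    given x. The infimum over rational q > t is monotone and right-continuous for every x regardless
    of the versions chosen, and it stays measurable because only countably many q enter.\<close>
  define F where "F x t = (INF q\<in>R t. E q x)" for x t
  have bdd: "bdd_below ((\<lambda>q. E q x) ` R t)" for x t using E01 by (auto intro!: bdd_belowI[of _ 0])
  have F[measurable]: "(\<lambda>x. F x t) \<in> borel_measurable borel" for t
    unfolding F_def using R bdd by (intro borel_measurable_cINF) auto
  have mono: "F x s \<le> F x t" if "s \<le> t" for x s t
    unfolding F_def using that R bdd by (intro cINF_superset_mono) (auto simp: R_def)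
  have F01: "0 \<le> F x t" "F x t \<le> 1" for x t
    unfolding F_def using R[of t] E01 bdd[of x t] by (auto intro!: cINF_greatest intro: cINF_lower2)
  have Fneg: "F x t = 0" if "t < 0" for x t
  proof -
    obtain q where q: "q \<in> \<rat>" "t < q" "q < 0" using Rats_dense_in_real[OF \<open>t < 0\<close>] by auto
    then have "F x t \<le> E q x" unfolding F_def using bdd by (intro cINF_lower) (auto simp: R_def)
    with q Eneg F01[of x t] show ?thesis by simp
  qed
  have Fone: "F x t = 1" if "1 \<le> t" for x t
  proof -
    have "1 \<le> F x t" unfolding F_def
      using R[of t] that by (intro cINF_greatest) (auto simp: R_def Eone)
    with F01[of x t] show ?thesis by simp
  qed
  have rc: "continuous (at_right a) (F x)" for a x
    unfolding continuous_within
  proof (rule order_tendstoI)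
    fix c assume "c < F x a"
    then show "\<forall>\<^sub>F t in at_right a. c < F x t"
      using mono by (auto simp: eventually_at_filter intro!: always_eventually) (meson less_le_trans less_imp_le)
  next
    fix c assume "F x a < c"
    then obtain q where q: "q \<in> R a" "E q x < c"
      unfolding F_def using R bdd by (auto simp: cINF_less_iff)
    then have "F x t < c" if "a < t" "t < q" for t
      using that bdd by (intro le_less_trans[OF _ q(2)]) (auto simp: F_def R_def intro!: cINF_lower)
    then show "\<forall>\<^sub>F t in at_right a. F x t < c"
      using q by (auto simp: eventually_at_right_field R_def)
  qed
  have bot: "(F x \<longlongrightarrow> 0) at_bot" for x
    by (rule tendsto_eventually) (auto simp: eventually_at_bot_dense Fneg intro!: exI[of _ 0])
  have top: "(F x \<longlongrightarrow> 1) at_top" for x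
    by (rule tendsto_eventually) (auto simp: eventually_at_top_linorder Fone intro!: exI[of _ 1])
  define \<kappa> where "\<kappa> x = interval_measure (F x)" for x
  have \<kappa>_Iic: "emeasure (\<kappa> x) {..t} = F x t" for x t
    unfolding \<kappa>_def by (rule emeasure_interval_measure_Iic[OF mono rc bot])
  have prob: "prob_space (\<kappa> x)" for x
    using real_distribution_interval_measure[OF mono rc bot top] by (simp add: \<kappa>_def real_distribution_def)
  have gen: "sets borel = sigma_sets UNIV (range (\<lambda>t::real. {..t}))"
    by (simp add: borel_eq_atMost)
  have stable: "Int_stable (range (\<lambda>t::real. {..t}))" by (auto simp: Int_stable_def)
  have \<kappa>: "\<kappa> \<in> borel \<rightarrow>\<^sub>M prob_algebra borel"
    by (rule measurable_prob_algebra_generated[OF gen stable]) (auto simp: \<kappa>_Iic prob, auto simp: \<kappa>_def)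
  have iF: "integrable Q (\<lambda>x. F x t)" for t
    by (rule Q.integrable_const_bound[of _ 1]) (use F01 in \<open>auto\<close>)
  \<comment> \<open>Passing from E to F changes no integral. One inequality uses rational q slightly
    above t and continuity of p from above; the other uses that \<open>E t x\<close> is below
    \<open>E q x\<close> for all of the countably many q, off a single null set.\<close>
  have Fint: "(\<integral>x\<in>A. F x t \<partial>Q) = measure p (A \<times> {..t})" if A: "A \<in> sets borel" for A t
  proof (rule antisym)
    have si: "set_integrable Q A (E q)" "set_integrable Q A (\<lambda>x. F x q)" for q
      using A setsQ iE iF by (auto intro!: integrable_imp_set_integrable)
    define u where "u n = t + inverse (real (Suc n))" for n
    have "(\<lambda>n. measure p (A \<times> {..u n})) \<longlonglongrightarrow> measure p (\<Inter>n. A \<times> {..u n})"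
      by (intro p.finite_Lim_measure_decseq)
        (auto simp: decseq_def u_def A frac_le inverse_eq_divide intro!: rect elim!: order.trans)
    also have "(\<Inter>n. A \<times> {..u n}) = A \<times> {..t}"
    proof -
      have "y \<le> t" if "\<And>n. y \<le> u n" for y
        using that LIMSEQ_inverse_real_of_nat_add[of t] by (intro LIMSEQ_le_const) (auto simp: u_def)
      moreover have "t \<le> u n" for n by (simp add: u_def)
      ultimately show ?thesis by (auto intro: order.trans)
    qed
    finally have lim: "(\<lambda>n. measure p (A \<times> {..u n})) \<longlonglongrightarrow> measure p (A \<times> {..t})" .
    show "(\<integral>x\<in>A. F x t \<partial>Q) \<le> measure p (A \<times> {..t})"
    proof (rule LIMSEQ_le_const[OF lim], intro exI[of _ 0] allI impI)
      fix n
      obtain q where q: "q \<in> \<rat>" "t < q" "q < u n"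
        using Rats_dense_in_real[of t "u n"] by (auto simp: u_def)
      have "(\<integral>x\<in>A. F x t \<partial>Q) \<le> (\<integral>x\<in>A. E q x \<partial>Q)"
        using q bdd by (intro set_integral_mono si) (auto simp: F_def R_def intro!: cINF_lower)
      also have "\<dots> \<le> measure p (A \<times> {..u n})"
        unfolding Eint[OF A] using q A by (intro p.finite_measure_mono rect) auto
      finally show "(\<integral>x\<in>A. F x t \<partial>Q) \<le> measure p (A \<times> {..u n})" .
    qed
    have "AE x in Q. \<forall>q\<in>R t. 0 \<le> E q x - E t x"
    proof (subst AE_ball_countable[OF R(1)], safe)
      fix q assume q: "q \<in> R t"
      show "AE x in Q. 0 \<le> E q x - E t x"
      proof (rule Q.density_nonneg)
        fix A assume A: "A \<in> sets Q"
        have "(\<integral>x\<in>A. E q x - E t x \<partial>Q) = (\<integral>x\<in>A. E q x \<partial>Q) - (\<integral>x\<in>A. E t x \<partial>Q)"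
          using iE A by (intro set_integral_diff integrable_imp_set_integrable)
        also have "\<dots> \<ge> 0"
          using A setsQ q by (auto simp: Eint R_def intro!: p.finite_measure_mono rect)
        finally show "0 \<le> (\<integral>x\<in>A. E q x - E t x \<partial>Q)" by simp
      qed (use iE in auto)
    qed
    then have "AE x in Q. E t x \<le> F x t"
      by eventually_elim (use R in \<open>auto simp: F_def intro!: cINF_greatest\<close>)
    then have "(\<integral>x\<in>A. E t x \<partial>Q) \<le> (\<integral>x\<in>A. F x t \<partial>Q)"
      by (intro set_integral_mono_AE si) auto
    then show "measure p (A \<times> {..t}) \<le> (\<integral>x\<in>A. F x t \<partial>Q)" by (simp add: Eint[OF A])
  qed
  show thesis
  proof (rule that[OF \<kappa>])
    fix A :: "'m set" and B :: "real set" assume A: "A \<in> sets borel" and B: "B \<in> sets borel"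
    \<comment> \<open>With A fixed, both sides are measures in B. They agree on half-lines, where
      the identity is \<open>Fint\<close>, and half-lines generate the Borel sets.\<close>
    define P1 where "P1 = distr (density p (indicator (A \<times> UNIV))) borel snd"
    define P2 where "P2 = density Q (indicator A) \<bind> \<kappa>"
    have \<kappa>': "\<kappa> \<in> density Q (indicator A) \<rightarrow>\<^sub>M subprob_algebra borel"
      using measurable_prob_algebraD[OF \<kappa>] setsQ by (simp cong: measurable_cong_sets)
    have sp: "space Q = UNIV" "space p = UNIV" using sets_eq_imp_space_eq[OF setsQ] sets_eq_imp_space_eq[OF p(2)] by auto
    have snd_p: "snd \<in> p \<rightarrow>\<^sub>M borel"
      unfolding measurable_cong_sets[OF p(2) refl]
      by (intro borel_measurable_continuous_onI continuous_intros)
    have e1: "emeasure P1 B = emeasure p (A \<times> B)" if B: "B \<in> sets borel" for B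
    proof -
      have "emeasure P1 B = emeasure (density p (indicator (A \<times> UNIV))) (UNIV \<times> B)"
        unfolding P1_def using B snd_p by (subst emeasure_distr) (auto simp: sp intro!: arg_cong2[where f=emeasure])
      also have "\<dots> = (\<integral>\<^sup>+z. indicator (A \<times> B) z \<partial>p)"
        using A B by (subst emeasure_density) (auto intro!: rect nn_integral_cong borel_measurable_indicator split: split_indicator)
      also have "\<dots> = emeasure p (A \<times> B)" using A B by (intro nn_integral_indicator rect) auto
      finally show ?thesis .
    qed
    have e2: "emeasure P2 B = (\<integral>\<^sup>+x\<in>A. emeasure (\<kappa> x) B \<partial>Q)" if B: "B \<in> sets borel" for B
      unfolding P2_def using A B \<kappa> setsQ
      by (subst emeasure_bind[OF _ \<kappa>' B], simp add: sp, subst nn_integral_density)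
        (auto simp: mult.commute intro!: measurable_emeasure_kernel measurable_prob_algebraD cong: measurable_cong_sets)
    have "P1 = P2"
    proof (rule measure_eqI_generator_eq[OF stable, where \<Omega>=UNIV and A="\<lambda>n. {..real n}"])
      show "sets P1 = sigma_sets UNIV (range atMost)" by (simp add: P1_def gen)
      show "sets P2 = sigma_sets UNIV (range atMost)"
        unfolding P2_def gen[symmetric] by (rule sets_bind[OF sets_kernel[OF \<kappa>']]) (auto simp: sp)
      show "(\<Union>i. {..real i}) = UNIV" by (auto intro: real_arch_simple)
      show "emeasure P1 {..real i} \<noteq> \<infinity>" for i by (simp add: e1)
      fix X assume "X \<in> range (atMost :: real \<Rightarrow> real set)"
      then obtain t where X: "X = {..t}" by auto
      have "emeasure P2 X = (\<integral>\<^sup>+x. ennreal (indicator A x *\<^sub>R F x t) \<partial>Q)"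
        unfolding X by (subst e2) (auto simp: \<kappa>_Iic intro!: nn_integral_cong split: split_indicator)
      also have "\<dots> = ennreal (\<integral>x. indicator A x *\<^sub>R F x t \<partial>Q)"
        using A setsQ iF F01 by (intro nn_integral_eq_integral integrable_mult_indicator) auto
      also have "\<dots> = emeasure p (A \<times> {..t})"
        using Fint[OF A, of t] by (simp add: set_lebesgue_integral_def p.emeasure_eq_measure)
      finally show "emeasure P1 X = emeasure P2 X" by (simp add: X e1)
    qed auto
    then show "emeasure p (A \<times> B) = (\<integral>\<^sup>+x\<in>A. emeasure (\<kappa> x) B \<partial>distr p borel fst)"
      using e1[OF B] e2[OF B] by (simp add: Q_def)
  qed
qed

section \<open>Compact metric spaces as Borel retracts of the real line\<close>

text \<open>The code e x lists, as digits 0 and 1 in base 4, which sets of a countable basis contain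
  x. Base 4 leaves a gap: if two codes first differ at digit j, the later digits amount to at most a
  third of that digit, so the codes stay 2/3 of it apart. Hence e is injective with continuous
  inverse on its range, and s extends this inverse to a Borel map as a limit of countably valued
  maps.\<close>

lemma borel_retract_of_real:
  assumes "compact (UNIV :: 'k::{metric_space, second_countable_topology} set)"
  obtains e :: "'k::{metric_space, second_countable_topology} \<Rightarrow> real" and s :: "real \<Rightarrow> 'k::{metric_space, second_countable_topology}" where
    "e \<in> borel_measurable borel" "s \<in> borel_measurable borel" "\<And>x. s (e x) = x" "\<And>x. e x \<in> {0..1}"
proof -
  obtain \<B> :: "'k set set" where \<B>: "countable \<B>" "topological_basis \<B>"
    using ex_countable_basis by blast
  have ne: "\<B> \<noteq> {}"
    using topological_basisE[OF \<B>(2), of UNIV undefined] by auto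
  define U where "U = from_nat_into \<B>"
  have U: "range U = \<B>" unfolding U_def using ne \<B>(1) by simp
  have oU: "open (U k)" for k using U \<B>(2) by (auto simp: topological_basis_open)
  define b where "b x k = (indicator (U k) x :: real)" for x k
  define e where "e x = (\<Sum>k. b x k * (1/4) ^ Suc k)" for x
  have g: "(\<lambda>k. (1/4::real) ^ Suc k) sums (1/3)"
    using sums_mult[OF geometric_sums[of "1/4::real"], of "1/4"] by simp
  have sm: "summable (\<lambda>k. b x k * (1/4) ^ Suc k)" for x
    by (rule summable_comparison_test_ev[OF _ sums_summable[OF g]])
      (auto intro!: always_eventually simp: b_def split: split_indicator)
  have e_meas: "e \<in> borel_measurable borel"
    unfolding e_def b_def using oU by (intro borel_measurable_suminf) auto
  have e01: "e x \<in> {0..1}" for x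
  proof -
    have "e x \<le> 1/3" unfolding e_def sums_unique[OF g]
      by (intro suminf_le sm sums_summable[OF g]) (auto simp: b_def split: split_indicator)
    moreover have "0 \<le> e x" unfolding e_def
      by (intro suminf_nonneg sm) (auto simp: b_def)
    ultimately show ?thesis by auto
  qed
  have sep: "(2/3) * (1/4) ^ Suc k \<le> \<bar>e x - e y\<bar>" if k: "b x k \<noteq> b y k" for x y k
  proof -
    define j where "j = (LEAST j. b x j \<noteq> b y j)"
    have j: "b x j \<noteq> b y j" "j \<le> k" unfolding j_def using LeastI[of "\<lambda>j. b x j \<noteq> b y j", OF k] Least_le[of "\<lambda>j. b x j \<noteq> b y j", OF k] by auto
    have lt: "b x i = b y i" if "i < j" for i using not_less_Least that unfolding j_def by blast
    define c where "c i = (b x i - b y i) * (1/4) ^ Suc i" for i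
    have c1: "\<bar>c i\<bar> \<le> (1/4) ^ Suc i" for i
      by (auto simp: c_def b_def abs_mult split: split_indicator)
    have sc: "summable c"
      unfolding c_def[abs_def] left_diff_distrib by (rule summable_diff[OF sm sm])
    have "e x - e y = suminf c"
      unfolding e_def suminf_diff[OF sm sm] c_def[abs_def] left_diff_distrib ..
    also have "\<dots> = (\<Sum>i. c (i + Suc j)) + (\<Sum>i<Suc j. c i)"
      by (rule suminf_split_initial_segment[OF sc])
    also have "(\<Sum>i<Suc j. c i) = c j" using lt by (simp add: c_def)
    finally have 1: "e x - e y = (\<Sum>i. c (i + Suc j)) + c j" .
    have "\<bar>c j\<bar> = (1/4) ^ Suc j"
      using j(1) by (auto simp: c_def b_def split: split_indicator_asm)
    moreover have "\<bar>\<Sum>i. c (i + Suc j)\<bar> \<le> (1/4) ^ Suc j * (1/3)"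
    proof -
      have g': "(\<lambda>i. (1/4::real) ^ Suc j * (1/4) ^ Suc i) sums ((1/4) ^ Suc j * (1/3))"
        by (intro sums_mult g)
      have le: "\<bar>c (i + Suc j)\<bar> \<le> (1/4::real) ^ Suc j * (1/4) ^ Suc i" for i
        using c1[of "i + Suc j"] by (simp add: power_add mult_ac)
      have "norm (\<Sum>i. c (i + Suc j)) \<le> (\<Sum>i. (1/4::real) ^ Suc j * (1/4) ^ Suc i)"
        by (intro norm_suminf_le sums_summable[OF g']) (use le in simp)
      then show ?thesis using sums_unique[OF g'] by simp
    qed
    ultimately have "(2/3) * (1/4) ^ Suc j \<le> \<bar>e x - e y\<bar>" using 1 by linarith
    moreover have "(1/4::real) ^ Suc k \<le> (1/4) ^ Suc j"
      using j(2) by (intro power_decreasing) auto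
    ultimately show ?thesis by linarith
  qed
  \<comment> \<open>Continuity of the inverse: codes closer than the gap of digit k agree in that
    digit, so the points lie in \<open>U k\<close> together.\<close>
  have conv: "y \<longlonglongrightarrow> x" if y: "(\<lambda>n. e (y n)) \<longlonglongrightarrow> e x" for y :: "nat \<Rightarrow> 'k" and x
  proof (rule topological_tendstoI)
    fix S assume S: "open S" "x \<in> S"
    then obtain V where "V \<in> \<B>" "x \<in> V" "V \<subseteq> S" using topological_basisE[OF \<B>(2)] by metis
    then obtain k where k: "x \<in> U k" "U k \<subseteq> S" using U by auto
    have "\<forall>\<^sub>F n in sequentially. dist (e (y n)) (e x) < (2/3) * (1/4) ^ Suc k"
      using y by (rule tendstoD) simp
    then show "\<forall>\<^sub>F n in sequentially. y n \<in> S"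
    proof eventually_elim
      case (elim n)
      then have "b (y n) k = b x k" using sep[of "y n" k x] by (force simp: dist_real_def)
      with k show ?case by (auto simp: b_def split: split_indicator_asm)
    qed
  qed
  \<comment> \<open>\<open>sn n t\<close> is a chosen point whose code lies in the same cell of mesh
    1/(n+1) as t, if there is one. For t = e x the cell is occupied by x itself, so the codes of the
    chosen points converge to e x.\<close>
  define pick where "pick n i = (SOME y. \<lfloor>real (Suc n) * e y\<rfloor> = i)" for n i
  define sn where "sn n t = pick n \<lfloor>real (Suc n) * t\<rfloor>" for n t
  have sn_meas: "sn n \<in> borel_measurable borel" for n
    unfolding sn_def
    by (rule measurable_compose_countable[where f="\<lambda>i t. pick n i"]) auto
  have lim: "(\<lambda>n. sn n (e x)) \<longlonglongrightarrow> x" for x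
  proof (rule conv)
    have fl: "\<lfloor>real (Suc n) * e (sn n (e x))\<rfloor> = \<lfloor>real (Suc n) * e x\<rfloor>" for n
      unfolding sn_def pick_def by (rule someI) (rule refl)
    have "\<bar>e (sn n (e x)) - e x\<bar> \<le> inverse (real (Suc n))" for n
    proof -
      have "\<bar>real (Suc n) * e (sn n (e x)) - real (Suc n) * e x\<bar> \<le> 1" using fl[of n] by linarith
      then have "real (Suc n) * \<bar>e (sn n (e x)) - e x\<bar> \<le> 1"
        by (simp add: abs_mult flip: right_diff_distrib)
      then show ?thesis by (simp add: field_simps)
    qed
    then have "(\<lambda>n. e (sn n (e x)) - e x) \<longlonglongrightarrow> 0"
      by (intro Lim_null_comparison[OF always_eventually LIMSEQ_inverse_real_of_nat]) simp
    then show "(\<lambda>n. e (sn n (e x))) \<longlonglongrightarrow> e x" by (simp add: LIM_zero_iff)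
  qed
  \<comment> \<open>On this Borel set the approximations converge, since a compact space is
    complete; off it s takes a constant value.\<close>
  define C where "C = {t. Cauchy (\<lambda>n. sn n t)}"
  have C: "C \<in> sets borel"
    using sets_Collect_Cauchy[of sn borel] sn_meas by (simp add: C_def)
  define s where "s t = (if t \<in> C then lim (\<lambda>n. sn n t) else undefined)" for t
  have s_meas: "s \<in> borel_measurable borel"
  proof (rule borel_measurable_LIMSEQ_metric)
    show "(\<lambda>t. if t \<in> C then sn n t else undefined) \<in> borel_measurable borel" for n
      using sn_meas C by (intro measurable_If_set) auto
    show "(\<lambda>n. if t \<in> C then sn n t else undefined) \<longlonglongrightarrow> s t" for t
    proof (cases "t \<in> C")
      case True
      then have "convergent (\<lambda>n. sn n t)"
        using compact_imp_complete[OF assms] unfolding complete_def C_def convergent_def by blast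
      then show ?thesis using True by (simp add: s_def convergent_LIMSEQ_iff)
    qed (simp add: s_def)
  qed
  show thesis
  proof (rule that[OF e_meas s_meas _ e01])
    fix x
    have "e x \<in> C" using lim[of x] by (simp add: C_def LIMSEQ_imp_Cauchy)
    then show "s (e x) = x" using lim[of x] by (simp add: s_def limI)
  qed
qed

lemma ex_conditional_distribution:
  fixes p :: "('m::second_countable_topology \<times> 'k::{metric_space, second_countable_topology}) measure"
  assumes p: "finite_measure p" "sets p = sets borel" and K: "compact (UNIV :: 'k set)"
  obtains \<kappa> where "\<kappa> \<in> borel \<rightarrow>\<^sub>M prob_algebra (borel :: 'k measure)"
    "\<And>E. E \<in> sets borel \<Longrightarrow>
      emeasure p E = (\<integral>\<^sup>+x. emeasure (\<kappa> x) (Pair x -` E) \<partial>distr p borel fst)"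
proof -
  interpret p: finite_measure p by fact
  obtain e :: "'k \<Rightarrow> real" and s where es: "e \<in> borel_measurable borel" "s \<in> borel_measurable borel"
    "\<And>x. s (e x) = x" "\<And>x. e x \<in> {0..1}"
    by (rule borel_retract_of_real[OF K]) blast
  define Q where "Q = distr p borel fst"
  have setsQ[measurable_cong]: "sets Q = sets borel" by (simp add: Q_def)
  have sp: "space Q = UNIV" "space p = UNIV"
    using sets_eq_imp_space_eq[OF setsQ] sets_eq_imp_space_eq[OF p(2)] by auto
  have fst_b: "fst \<in> (borel :: ('m \<times> 'b::second_countable_topology) measure) \<rightarrow>\<^sub>M borel"
    by (intro borel_measurable_continuous_onI continuous_intros)
  have snd_b: "snd \<in> (borel :: ('m \<times> 'k) measure) \<rightarrow>\<^sub>M borel"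
    by (intro borel_measurable_continuous_onI continuous_intros)
  have fst_p: "fst \<in> p \<rightarrow>\<^sub>M borel" using fst_b by (simp add: measurable_cong_sets[OF p(2) refl])
  define H where "H z = (fst z, e (snd z))" for z :: "'m \<times> 'k"
  have H: "H \<in> p \<rightarrow>\<^sub>M borel"
    unfolding measurable_cong_sets[OF p(2) refl] H_def
    by (intro borel_measurable_Pair fst_b measurable_compose[OF snd_b es(1)])
  define p' where "p' = distr p borel H"
  have fp': "finite_measure p'" unfolding p'_def by (rule p.finite_measure_distr[OF H])
  have p'0: "emeasure p' (UNIV \<times> - {0..1}) = 0"
  proof -
    have "H -` (UNIV \<times> - {0..1}) = {}" using es(4) by (auto simp: H_def)
    then show ?thesis unfolding p'_def using H by (subst emeasure_distr) (auto intro!: borel_Times)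
  qed
  have sp': "sets p' = sets borel" by (simp add: p'_def)
  obtain \<kappa>' where \<kappa>': "\<kappa>' \<in> borel \<rightarrow>\<^sub>M prob_algebra (borel :: real measure)"
    "\<And>A B. A \<in> sets borel \<Longrightarrow> B \<in> sets borel \<Longrightarrow>
      emeasure p' (A \<times> B) = (\<integral>\<^sup>+x\<in>A. emeasure (\<kappa>' x) B \<partial>distr p' borel fst)"
    by (rule ex_conditional_distribution_real[OF fp' sp' p'0]) blast
  have Q': "distr p' borel fst = Q"
    unfolding p'_def Q_def by (subst distr_distr[OF fst_b H]) (simp add: comp_def H_def)
  define \<kappa> where "\<kappa> x = distr (\<kappa>' x) borel s" for x
  have \<kappa>: "\<kappa> \<in> borel \<rightarrow>\<^sub>M prob_algebra borel"
    unfolding \<kappa>_def by (rule measurable_compose[OF \<kappa>'(1) measurable_distr_prob_space[OF es(2)]])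
  have sets\<kappa>': "sets (\<kappa>' x) = sets borel" for x
    using measurable_space[OF \<kappa>'(1), of x] by (simp add: space_prob_algebra)
  have sets\<kappa>: "sets (\<kappa> x) = sets borel" for x by (simp add: \<kappa>_def)
  have rect: "emeasure p (A \<times> B) = (\<integral>\<^sup>+x\<in>A. emeasure (\<kappa> x) B \<partial>Q)"
    if A: "A \<in> sets borel" and B: "B \<in> sets borel" for A B
  proof -
    have sB: "s -` B \<in> sets borel" using measurable_sets[OF es(2) B] by simp
    have "H -` (A \<times> s -` B) = A \<times> B" using es(3) by (auto simp: H_def)
    then have "emeasure p (A \<times> B) = emeasure p' (A \<times> s -` B)"
      unfolding p'_def using A sB by (subst emeasure_distr[OF H]) (auto intro!: borel_Times simp: sp)
    also have "\<dots> = (\<integral>\<^sup>+x\<in>A. emeasure (\<kappa>' x) (s -` B) \<partial>Q)"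
      using \<kappa>'(2)[OF A sB] by (simp add: Q')
    also have "\<dots> = (\<integral>\<^sup>+x\<in>A. emeasure (\<kappa> x) B \<partial>Q)"
      unfolding \<kappa>_def using B es(2) sets_eq_imp_space_eq[OF sets\<kappa>']
      by (subst emeasure_distr) (auto simp: measurable_cong_sets[OF sets\<kappa>' refl])
    finally show ?thesis .
  qed
  \<comment> \<open>Putting \<kappa> x back on the fibre over x gives a kernel into the product. The
    formula for general E then says that p is the composition of Q with L, which needs checking on
    rectangles only.\<close>
  define L where "L x = distr (\<kappa> x) borel (Pair x)" for x :: 'm
  have Pair_b: "Pair x \<in> (borel :: 'k measure) \<rightarrow>\<^sub>M borel" for x :: 'm
    by (intro borel_measurable_continuous_onI continuous_intros)
  have "L \<in> borel \<rightarrow>\<^sub>M prob_algebra borel"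
    unfolding L_def by (rule measurable_distr_prob_space2[OF \<kappa>]) (simp add: borel_prod)
  then have L: "L \<in> Q \<rightarrow>\<^sub>M subprob_algebra borel"
    using measurable_prob_algebraD by (simp add: measurable_cong_sets[OF setsQ refl])
  have Le: "emeasure (L x) E = emeasure (\<kappa> x) (Pair x -` E)" if "E \<in> sets borel" for x E
    unfolding L_def using that sets_eq_imp_space_eq[OF sets\<kappa>] Pair_b
    by (subst emeasure_distr) (auto simp: measurable_cong_sets[OF sets\<kappa> refl])
  have bindE: "emeasure (Q \<bind> L) E = (\<integral>\<^sup>+x. emeasure (\<kappa> x) (Pair x -` E) \<partial>Q)" if "E \<in> sets borel" for E
    using that by (subst emeasure_bind[OF _ L that]) (auto simp: sp Le)
  have "p = Q \<bind> L"
  proof (rule measure_eqI_generator_eq[OF Int_stable_pair_measure_generator, where \<Omega>=UNIV and A="\<lambda>_. UNIV"])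
    show "{a \<times> b |a b. a \<in> sets borel \<and> b \<in> sets borel} \<subseteq> Pow (UNIV :: ('m \<times> 'k) set)" by simp
    show sp': "sets p = sigma_sets UNIV {a \<times> b |a b. a \<in> sets (borel :: 'm measure) \<and> b \<in> sets (borel :: 'k measure)}"
      unfolding p(2) borel_prod[symmetric] sets_pair_measure by simp
    show "sets (Q \<bind> L) = sigma_sets UNIV {a \<times> b |a b. a \<in> sets (borel :: 'm measure) \<and> b \<in> sets (borel :: 'k measure)}"
      unfolding sp'[symmetric] p(2) by (rule sets_bind[OF sets_kernel[OF L]]) (auto simp: sp)
    show "range (\<lambda>_::nat. UNIV) \<subseteq> {a \<times> b |a b. a \<in> sets (borel :: 'm measure) \<and> b \<in> sets (borel :: 'k measure)}"
      by (auto intro!: exI[of _ UNIV])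
    fix X assume "X \<in> {a \<times> b |a b. a \<in> sets (borel :: 'm measure) \<and> b \<in> sets (borel :: 'k measure)}"
    then obtain A B where X: "X = A \<times> B" "A \<in> sets borel" "B \<in> sets borel" by auto
    show "emeasure p X = emeasure (Q \<bind> L) X"
      unfolding X(1) using X by (subst bindE) (auto simp: rect intro!: borel_Times nn_integral_cong split: split_indicator)
  qed auto
  then show thesis
    using that[OF \<kappa>] bindE by (metis Q_def)
qed

lemma ex_disintegration:
  fixes p :: "('m::polish_space \<times> 'k::{metric_space, second_countable_topology}) measure"
  assumes p: "finite_measure p" "sets p = sets borel" and K: "compact (UNIV :: 'k set)"
  shows "\<exists>\<kappa>. is_disintegration p \<kappa>"
proof -
  obtain \<kappa> where \<kappa>: "\<kappa> \<in> borel \<rightarrow>\<^sub>M prob_algebra (borel :: 'k measure)"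
    "\<And>E. E \<in> sets borel \<Longrightarrow>
      emeasure p E = (\<integral>\<^sup>+x. emeasure (\<kappa> x) (Pair x -` E) \<partial>distr p borel fst)"
    by (rule ex_conditional_distribution[OF p K]) blast
  have sets\<kappa>: "sets (\<kappa> x) = sets borel" and prob\<kappa>: "prob_space (\<kappa> x)" for x
    using measurable_space[OF \<kappa>(1), of x] by (auto simp add: space_prob_algebra)
  define L where "L x = distr (\<kappa> x) borel (Pair x)" for x :: 'm
  have Pair_b: "Pair x \<in> (borel :: 'k measure) \<rightarrow>\<^sub>M borel" for x :: 'm
    by (intro borel_measurable_continuous_onI continuous_intros)
  have L: "L \<in> borel \<rightarrow>\<^sub>M prob_algebra borel"
    unfolding L_def by (rule measurable_distr_prob_space2[OF \<kappa>(1)]) (simp add: borel_prod)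
  have Le: "emeasure (L x) E = emeasure (\<kappa> x) (Pair x -` E)" if "E \<in> sets borel" for x E
    unfolding L_def using that sets_eq_imp_space_eq[OF sets\<kappa>] Pair_b
    by (subst emeasure_distr) (auto simp: measurable_cong_sets[OF sets\<kappa> refl])
  have "emeasure (L x) ({x} \<times> UNIV) = 1" for x
  proof -
    have "Pair x -` ({x} \<times> UNIV) = UNIV" by auto
    then show ?thesis
      using prob_space.emeasure_space_1[OF prob\<kappa>[of x]] sets_eq_imp_space_eq[OF sets\<kappa>[of x]]
      by (subst Le) (auto intro!: borel_Times)
  qed
  then show ?thesis
    unfolding is_disintegration_def using L \<kappa>(2) Le by (intro exI[of _ L]) auto
qed

section \<open>Signed measures given by their restrictions to the fibres\<close>

text \<open>A disintegration over the fixed base measure m with the masses absorbed into the signed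
  measures \<rho> x. Integrability is demanded explicitly because the Bochner integral of a
  non-integrable function is 0.\<close>

definition fibre_density :: "'m measure \<Rightarrow> (('m::topological_space \<times> 'k::topological_space) set \<Rightarrow> real) \<Rightarrow>
    ('m \<Rightarrow> 'k set \<Rightarrow> real) \<Rightarrow> bool" where
  "fibre_density m \<mu> \<rho> \<longleftrightarrow> (\<forall>E\<in>sets borel.
     integrable m (\<lambda>x. \<rho> x (Pair x -` E)) \<and> \<mu> E = (\<integral>x. \<rho> x (Pair x -` E) \<partial>m))"

text \<open>Finite intersections of a countable basis; the empty intersection supplies UNIV.
  Countability is what allows almost everywhere identities on the generator to hold
  simultaneously.\<close>

lemma countable_generator_of_borel:
  obtains \<E> :: "'k::second_countable_topology set set" where
    "countable \<E>" "Int_stable \<E>" "sets borel = sigma_sets UNIV \<E>" "UNIV \<in> \<E>"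
proof -
  obtain \<B> :: "'k set set" where \<B>: "countable \<B>" "topological_basis \<B>"
    using ex_countable_basis by blast
  define \<E> where "\<E> = Inter ` {F. finite F \<and> F \<subseteq> \<B>}"
  have bor: "sets (borel :: 'k measure) = sigma_sets UNIV \<B>"
    using borel_eq_countable_basis[OF \<B>] by (metis sets_measure_of_conv subset_UNIV Pow_UNIV)
  have oE: "A \<in> sets borel" if "A \<in> \<E>" for A
    using that \<B>(2) by (auto simp: \<E>_def topological_basis_open intro!: borel_open open_Inter)
  show thesis
  proof (rule that)
    show "countable \<E>" unfolding \<E>_def using \<B>(1) by (auto intro: countable_Collect_finite_subset)
    show "Int_stable \<E>"
      unfolding Int_stable_def \<E>_def
    proof safe
      fix F F' assume "F \<subseteq> \<B>" "finite F" "F' \<subseteq> \<B>" "finite F'"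
      then show "\<Inter> F \<inter> \<Inter> F' \<in> Inter ` {F. finite F \<and> F \<subseteq> \<B>}"
        by (intro image_eqI[where x="F \<union> F'"]) auto
    qed
    show "UNIV \<in> \<E>" unfolding \<E>_def by (rule image_eqI[where x="{}"]) auto
    show "sets borel = sigma_sets UNIV \<E>"
    proof (rule antisym)
      have "\<B> \<subseteq> \<E>" unfolding \<E>_def by (auto intro!: image_eqI[where x="{_}"])
      then show "sets borel \<subseteq> sigma_sets UNIV \<E>"
        unfolding bor by (rule sigma_sets_mono')
      show "sigma_sets UNIV \<E> \<subseteq> sets borel"
        using oE sets.sigma_sets_subset[of \<E> "borel :: 'k measure"] by auto
    qed
  qed
qed

text \<open>For fixed B, the function \<open>\<lambda>x. \<rho> x B\<close> is the density of the
  set function sending A to \<mu> (A \<times> B), hence determined almost everywhere. Countably many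
  B determine a signed measure, so one null set suffices.\<close>

lemma fibre_density_unique:
  fixes \<mu> :: "('m::second_countable_topology \<times> 'k::second_countable_topology) set \<Rightarrow> real"
  assumes m: "finite_measure m" "sets m = sets borel"
    and \<rho>: "AE x in m. \<rho> x \<in> signed_measures" "AE x in m. \<rho>' x \<in> signed_measures"
    and d: "fibre_density m \<mu> \<rho>" "fibre_density m \<mu> \<rho>'"
  shows "AE x in m. \<rho> x = \<rho>' x"
proof -
  interpret m: finite_measure m by fact
  obtain \<E> :: "'k set set" where \<E>: "countable \<E>" "Int_stable \<E>"
    "sets borel = sigma_sets UNIV \<E>" "UNIV \<in> \<E>"
    by (rule countable_generator_of_borel)
  have "AE x in m. \<rho> x B = \<rho>' x B" if B: "B \<in> \<E>" for B
  proof -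
    have Bm: "B \<in> sets borel" using B \<E>(3) by auto
    have int: "integrable m (\<lambda>x. \<sigma> x B)" "\<And>A. A \<in> sets m \<Longrightarrow> (\<integral>x\<in>A. \<sigma> x B \<partial>m) = \<mu> (A \<times> B)"
      if d: "fibre_density m \<mu> \<sigma>" and s: "AE x in m. \<sigma> x \<in> signed_measures" for \<sigma>
    proof -
      have r: "A \<times> B \<in> sets borel" if "A \<in> sets borel" for A :: "'m set"
        using that Bm by (rule borel_Times)
      have "Pair x -` (UNIV \<times> B) = B" for x :: 'm by auto
      then show i: "integrable m (\<lambda>x. \<sigma> x B)"
        using d r[of UNIV] unfolding fibre_density_def by force
      fix A assume A: "A \<in> sets m"
      then have rA: "A \<times> B \<in> sets borel" using m r by auto
      have dA: "integrable m (\<lambda>x. \<sigma> x (Pair x -` (A \<times> B)))" "\<mu> (A \<times> B) = (\<integral>x. \<sigma> x (Pair x -` (A \<times> B)) \<partial>m)"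
        using d rA unfolding fibre_density_def by auto
      have "(\<integral>x\<in>A. \<sigma> x B \<partial>m) = (\<integral>x. \<sigma> x (Pair x -` (A \<times> B)) \<partial>m)"
        unfolding set_lebesgue_integral_def
      proof (rule integral_cong_AE)
        \<comment> \<open>Over points outside A the slice is empty, and \<sigma> x vanishes there
          because it is a signed measure.\<close>
        show "AE x in m. indicat_real A x *\<^sub>R \<sigma> x B = \<sigma> x (Pair x -` (A \<times> B))"
          using s
        proof eventually_elim
          case (elim x)
          then show ?case using signed_measure_empty[OF elim]
            by (cases "x \<in> A") (simp_all add: vimage_def)
        qed
      qed (use A i dA in auto)
      with dA show "(\<integral>x\<in>A. \<sigma> x B \<partial>m) = \<mu> (A \<times> B)" by simp
    qed
    show ?thesis
      by (rule m.density_unique_banach)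
        (auto simp: int[OF d(1) \<rho>(1)] int[OF d(2) \<rho>(2)])
  qed
  then have "AE x in m. \<forall>B\<in>\<E>. \<rho> x B = \<rho>' x B"
    by (subst AE_ball_countable[OF \<E>(1)]) auto
  with \<rho> show ?thesis
    by eventually_elim (rule signed_measure_eqI_generator[OF _ _ \<E>(2,3,4)], auto)
qed

lemma fst_borel_measurable: "fst \<in> (borel :: ('m::topological_space \<times> 'k::topological_space) measure) \<rightarrow>\<^sub>M borel"
  and snd_borel_measurable: "snd \<in> (borel :: ('m \<times> 'k) measure) \<rightarrow>\<^sub>M borel"
  and Pair_borel_measurable: "Pair x \<in> (borel :: 'k measure) \<rightarrow>\<^sub>M borel" for x :: "'m::topological_space"
  by (intro borel_measurable_continuous_onI continuous_intros)+

text \<open>Vanishing of \<mu> on the cylinder over a null set would not suffice, because the two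
  Jordan parts could cancel. But \<mu> also vanishes on every Borel subset of the cylinder, in
  particular on the two pieces cut out by the Hahn set.\<close>

lemma AB_if_fibre_density:
  fixes \<mu> :: "('m::second_countable_topology \<times> 'k::second_countable_topology) set \<Rightarrow> real"
  assumes m: "sets m = sets borel" and \<mu>: "\<mu> \<in> signed_measures"
    and \<rho>: "AE x in m. \<rho> x \<in> signed_measures" and d: "fibre_density m \<mu> \<rho>"
  shows "\<mu> \<in> AB m"
proof -
  have null: "\<mu> E = 0" if N: "N \<in> sets borel" "emeasure m N = 0" and E: "E \<in> sets borel" "E \<subseteq> N \<times> UNIV" for N E
  proof -
    have "AE x in m. x \<notin> N" using N m by (intro AE_not_in) (auto simp: null_sets_def)
    with \<rho> have "AE x in m. \<rho> x (Pair x -` E) = 0"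
    proof eventually_elim
      case (elim x)
      then have "Pair x -` E = {}" using E by auto
      then show ?case using signed_measure_empty[OF elim(1)] by simp
    qed
    then have "(\<integral>x. \<rho> x (Pair x -` E) \<partial>m) = 0" by (rule integral_eq_zero_AE)
    with d E(1) show ?thesis by (simp add: fibre_density_def)
  qed
  define p where "p = pos_part \<mu>"
  define q where "q = neg_part \<mu>"
  from jordan_parts[OF \<mu>] obtain S where S: "S \<in> sets borel" "emeasure p (- S) = 0" "emeasure q S = 0"
    and p: "finite_measure p" "sets p = sets borel" and q: "finite_measure q" "sets q = sets borel"
    and pq: "\<And>A. A \<in> sets borel \<Longrightarrow> \<mu> A = measure p A - measure q A"
    by (auto simp: jordan_decomposition_def p_def q_def)
  note sp = sets_eq_imp_space_eq[OF p(2)] sets_eq_imp_space_eq[OF q(2)]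
  have fst_m: "fst \<in> p \<rightarrow>\<^sub>M borel" "fst \<in> q \<rightarrow>\<^sub>M borel"
    by (simp_all add: measurable_cong_sets[OF p(2) refl] measurable_cong_sets[OF q(2) refl] fst_borel_measurable)
  have z: "emeasure p E = 0 \<and> emeasure q E = 0" if N: "N \<in> sets borel" "emeasure m N = 0" and E: "E = N \<times> UNIV" for N E
  proof -
    have E: "E \<in> sets borel" "E \<subseteq> N \<times> UNIV" using E N by (auto intro!: borel_Times)
    have S': "- S \<in> sets borel" using S(1) by auto
    have "emeasure p (E \<inter> - S) \<le> emeasure p (- S)" "emeasure q (E \<inter> S) \<le> emeasure q S"
      using S(1) S' E p q by (auto intro!: emeasure_mono)
    then have 0: "emeasure p (E \<inter> - S) = 0" "emeasure q (E \<inter> S) = 0" using S by auto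
    have "\<mu> (E \<inter> S) = 0" "\<mu> (E \<inter> - S) = 0" using E S S' by (auto intro!: null[OF N])
    then have "measure p (E \<inter> S) = 0" "measure q (E \<inter> - S) = 0"
      using pq[of "E \<inter> S"] pq[of "E \<inter> - S"] 0 E S S' by (auto simp: measure_def)
    then have 1: "emeasure p (E \<inter> S) = 0" "emeasure q (E \<inter> - S) = 0"
      by (simp_all add: finite_measure.emeasure_eq_measure[OF p(1)] finite_measure.emeasure_eq_measure[OF q(1)])
    have "E = (E \<inter> S) \<union> (E \<inter> - S)" by auto
    then show ?thesis using 0 1 E S S' p q
      by (metis (no_types, lifting) emeasure_Un_null_set null_setsI sets.Int)
  qed
  have v: "fst -` N \<inter> space p = N \<times> UNIV" "fst -` N \<inter> space q = N \<times> UNIV" for N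
    using sp by auto
  have "absolutely_continuous m (distr p borel fst)" "absolutely_continuous m (distr q borel fst)"
    unfolding absolutely_continuous_def null_sets_def
    using z m fst_m by (auto simp: emeasure_distr v)
  then show ?thesis using \<mu> by (simp add: AB_def p_def q_def)
qed

section \<open>Conditional measures and restrictions to the fibres\<close>

lemma disintegrationD:
  fixes p :: "('m::polish_space \<times> 'k::{metric_space, second_countable_topology}) measure"
  assumes p: "finite_measure p" "sets p = sets borel" and K: "compact (UNIV :: 'k set)"
  shows "disintegration p \<in> borel \<rightarrow>\<^sub>M prob_algebra borel"
    "prob_space (disintegration p x)" "sets (disintegration p x) = sets borel"
    "AE x in distr p borel fst. emeasure (disintegration p x) ({x} \<times> UNIV) = 1"
    "\<And>A. A \<in> sets borel \<Longrightarrow> emeasure p A = (\<integral>\<^sup>+x. emeasure (disintegration p x) A \<partial>distr p borel fst)"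
proof -
  have "is_disintegration p (disintegration p)"
    unfolding disintegration_def using ex_disintegration[OF p K] by (rule someI_ex)
  then show 1: "disintegration p \<in> borel \<rightarrow>\<^sub>M prob_algebra borel"
    and "AE x in distr p borel fst. emeasure (disintegration p x) ({x} \<times> UNIV) = 1"
    "\<And>A. A \<in> sets borel \<Longrightarrow> emeasure p A = (\<integral>\<^sup>+x. emeasure (disintegration p x) A \<partial>distr p borel fst)"
    unfolding is_disintegration_def by auto
  show "prob_space (disintegration p x)" "sets (disintegration p x) = sets borel"
    using measurable_space[OF 1, of x] by (auto simp add: space_prob_algebra)
qed

definition fibre_conditional :: "('m::topological_space \<times> 'k::topological_space) measure \<Rightarrow> 'm \<Rightarrow> 'k measure" where
  "fibre_conditional p x = distr (disintegration p x) borel snd"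

text \<open>The last claim is the point: a measure concentrated on a single fibre can be recovered
  from its projection to K by taking slices.\<close>

lemma fibre_conditional:
  fixes p :: "('m::polish_space \<times> 'k::{metric_space, second_countable_topology}) measure"
  assumes p: "finite_measure p" "sets p = sets borel" and K: "compact (UNIV :: 'k set)"
  shows "fibre_conditional p \<in> borel \<rightarrow>\<^sub>M prob_algebra borel"
    "prob_space (fibre_conditional p x)" "sets (fibre_conditional p x) = sets borel"
    "emeasure (disintegration p x) ({x} \<times> UNIV) = 1 \<Longrightarrow> E \<in> sets borel \<Longrightarrow>
      emeasure (disintegration p x) E = emeasure (fibre_conditional p x) (Pair x -` E)"
proof -
  note D = disintegrationD[OF p K]
  show 1: "fibre_conditional p \<in> borel \<rightarrow>\<^sub>M prob_algebra borel"
    unfolding fibre_conditional_def[abs_def]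
    by (rule measurable_compose[OF D(1) measurable_distr_prob_space[OF snd_borel_measurable]])
  show "prob_space (fibre_conditional p x)" "sets (fibre_conditional p x) = sets borel"
    using measurable_space[OF 1, of x] by (auto simp add: space_prob_algebra)
  assume one: "emeasure (disintegration p x) ({x} \<times> UNIV) = 1" and E: "E \<in> sets borel"
  interpret P: prob_space "disintegration p x" by (rule D)
  note sd = D(3)[of x]
  have X: "{x} \<times> UNIV \<in> sets (disintegration p x)"
    unfolding sd by (intro borel_Times) auto
  have AE: "AE z in disintegration p x. z \<in> {x} \<times> UNIV"
    using one X by (subst P.AE_in_set_eq_1) (auto simp: measure_def)
  have PE: "Pair x -` E \<in> sets borel" using measurable_sets[OF Pair_borel_measurable E] by simp
  have snd_m: "snd \<in> disintegration p x \<rightarrow>\<^sub>M borel"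
    by (simp add: measurable_cong_sets[OF sd refl] snd_borel_measurable)
  have "emeasure (fibre_conditional p x) (Pair x -` E) = emeasure (disintegration p x) (snd -` (Pair x -` E))"
    unfolding fibre_conditional_def using PE snd_m sets_eq_imp_space_eq[OF sd] by (subst emeasure_distr) auto
  also have "\<dots> = emeasure (disintegration p x) E"
  proof (rule emeasure_eq_AE)
    show "AE z in disintegration p x. (z \<in> snd -` (Pair x -` E)) = (z \<in> E)"
      using AE by eventually_elim auto
    show "snd -` (Pair x -` E) \<in> sets (disintegration p x)"
      using measurable_sets[OF snd_m PE] sets_eq_imp_space_eq[OF sd] by simp
  qed (use E sd in auto)
  finally show "emeasure (disintegration p x) E = emeasure (fibre_conditional p x) (Pair x -` E)" ..
qed

lemma restriction_pos_eq:
  "restriction_pos m p x = (\<lambda>A. marginal_density m p x * measure (fibre_conditional p x) A)"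
  by (simp add: restriction_pos_def fibre_conditional_def fun_eq_iff)

text \<open>Concentration on the fibres holds almost everywhere for the marginal law, that is, at
  m-almost every point where the density is not 0. Where the density is 0 the restriction is the
  zero measure, whatever the conditional measure is.\<close>

lemma marginal_density:
  fixes p :: "('m::polish_space \<times> 'k::{metric_space, second_countable_topology}) measure"
  assumes m: "finite_measure m" "sets m = sets borel"
    and p: "finite_measure p" "sets p = sets borel" and K: "compact (UNIV :: 'k set)"
    and ac: "absolutely_continuous m (distr p borel fst)"
  shows "marginal_density m p \<in> borel_measurable borel" "0 \<le> marginal_density m p x"
    "integrable m (marginal_density m p)"
    "AE x in m. marginal_density m p x \<noteq> 0 \<longrightarrow> emeasure (disintegration p x) ({x} \<times> UNIV) = 1"
    "\<And>E. E \<in> sets borel \<Longrightarrow> emeasure p E =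
      (\<integral>\<^sup>+x. ennreal (marginal_density m p x * measure (fibre_conditional p x) (Pair x -` E)) \<partial>m)"
proof -
  interpret m: finite_measure m by fact
  interpret p: finite_measure p by fact
  let ?Q = "distr p borel fst"
  let ?g = "marginal_density m p"
  have fst_p: "fst \<in> p \<rightarrow>\<^sub>M borel"
    by (simp add: measurable_cong_sets[OF p(2) refl] fst_borel_measurable)
  interpret Q: finite_measure ?Q by (rule p.finite_measure_distr[OF fst_p])
  have sQ: "sets ?Q = sets m" using m by simp
  show gm: "?g \<in> borel_measurable borel"
    using borel_measurable_enn2real[OF borel_measurable_RN_deriv, of m ?Q]
    by (simp add: marginal_density_def[abs_def] measurable_cong_sets[OF m(2) refl])
  show g0: "0 \<le> ?g x" for x by (simp add: marginal_density_def)
  have "AE x in m. RN_deriv m ?Q x \<noteq> \<infinity>"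
    by (rule m.RN_deriv_finite[OF Q.sigma_finite_measure_axioms ac sQ])
  then have AE: "AE x in m. RN_deriv m ?Q x = ennreal (?g x)"
    by eventually_elim (simp add: marginal_density_def less_top)
  have "?Q = density m (RN_deriv m ?Q)" using m.density_RN_deriv[OF ac sQ] by simp
  also have "\<dots> = density m (\<lambda>x. ennreal (?g x))"
    using AE gm borel_measurable_RN_deriv[of m ?Q] by (intro density_cong) (auto simp: measurable_cong_sets[OF m(2) refl])
  finally have Q: "?Q = density m (\<lambda>x. ennreal (?g x))" .
  have gm': "(\<lambda>x. ennreal (?g x)) \<in> borel_measurable m"
    using gm by (simp add: measurable_cong_sets[OF m(2) refl])
  have "(\<integral>\<^sup>+x. ennreal (?g x) \<partial>m) = emeasure ?Q (space m)"
    by (subst Q) (use gm' in \<open>simp add: emeasure_density cong: nn_integral_cong\<close>)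
  also have "\<dots> < \<infinity>" using Q.emeasure_finite by (simp add: less_top[symmetric])
  finally show "integrable m ?g"
    using gm g0 by (intro integrableI_nonneg) (auto simp: measurable_cong_sets[OF m(2) refl])
  note D = disintegrationD[OF p K] and C = fibre_conditional[OF p K]
  have "AE x in density m (\<lambda>x. ennreal (?g x)). emeasure (disintegration p x) ({x} \<times> UNIV) = 1"
    using D(4) by (subst (asm) Q)
  then show good: "AE x in m. ?g x \<noteq> 0 \<longrightarrow> emeasure (disintegration p x) ({x} \<times> UNIV) = 1"
    using g0 unfolding AE_density[OF gm'] by (auto elim!: eventually_mono simp: order.not_eq_order_implies_strict)
  fix E :: "('m \<times> 'k) set" assume E: "E \<in> sets borel"
  have m2: "(\<lambda>x. emeasure (disintegration p x) E) \<in> borel_measurable m"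
    using measurable_compose[OF measurable_prob_algebraD[OF D(1)] measurable_emeasure_subprob_algebra[OF E]]
    by (simp add: measurable_cong_sets[OF m(2) refl])
  have "emeasure p E = (\<integral>\<^sup>+x. emeasure (disintegration p x) E \<partial>density m (\<lambda>x. ennreal (?g x)))"
    by (subst D(5)[OF E]) (subst Q, rule refl)
  also have "\<dots> = (\<integral>\<^sup>+x. ennreal (?g x) * emeasure (disintegration p x) E \<partial>m)"
    by (rule nn_integral_density[OF gm' m2])
  also have "\<dots> = (\<integral>\<^sup>+x. ennreal (?g x * measure (fibre_conditional p x) (Pair x -` E)) \<partial>m)"
  proof (rule nn_integral_cong_AE)
    show "AE x in m. ennreal (?g x) * emeasure (disintegration p x) E =
        ennreal (?g x * measure (fibre_conditional p x) (Pair x -` E))"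
      using good
    proof eventually_elim
      case (elim x)
      interpret P: prob_space "fibre_conditional p x" by (rule C)
      show ?case using elim g0[of x] C(4)[of x E] E
        by (cases "?g x = 0") (simp_all add: ennreal_mult P.emeasure_eq_measure)
    qed
  qed
  finally show "emeasure p E = (\<integral>\<^sup>+x. ennreal (?g x * measure (fibre_conditional p x) (Pair x -` E)) \<partial>m)" .
qed

lemma slice_measurable:
  fixes \<kappa> :: "'m::second_countable_topology \<Rightarrow> 'k::second_countable_topology measure"
  assumes \<kappa>: "\<kappa> \<in> borel \<rightarrow>\<^sub>M prob_algebra borel" and E: "E \<in> sets borel"
  shows "(\<lambda>x. measure (\<kappa> x) (Pair x -` E)) \<in> borel_measurable borel"
proof (rule measure_measurable_prob_algebra2[OF _ \<kappa>])
  have "Sigma (space borel) (\<lambda>x. Pair x -` E) = E" by auto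
  then show "Sigma (space borel) (\<lambda>x. Pair x -` E) \<in> sets (borel \<Otimes>\<^sub>M borel)"
    unfolding borel_prod using E by simp
qed

lemma restriction_pos:
  fixes p :: "('m::polish_space \<times> 'k::{metric_space, second_countable_topology}) measure"
  assumes m: "finite_measure m" "sets m = sets borel"
    and p: "finite_measure p" "sets p = sets borel" and K: "compact (UNIV :: 'k set)"
    and ac: "absolutely_continuous m (distr p borel fst)" and E: "E \<in> sets borel"
  shows "(\<lambda>x. restriction_pos m p x (Pair x -` E)) \<in> borel_measurable borel"
    "integrable m (\<lambda>x. restriction_pos m p x (Pair x -` E))"
    "measure p E = (\<integral>x. restriction_pos m p x (Pair x -` E) \<partial>m)"
proof -
  note M = marginal_density[OF m p K ac] and C = fibre_conditional[OF p K]
  show mm: "(\<lambda>x. restriction_pos m p x (Pair x -` E)) \<in> borel_measurable borel"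
    unfolding restriction_pos_eq using M(1) slice_measurable[OF C(1) E] by measurable
  have mm': "(\<lambda>x. restriction_pos m p x (Pair x -` E)) \<in> borel_measurable m"
    using mm by (simp add: measurable_cong_sets[OF m(2) refl])
  have nn: "0 \<le> restriction_pos m p x (Pair x -` E)" for x
    by (simp add: restriction_pos_eq M(2))
  have "emeasure p E = (\<integral>\<^sup>+x. ennreal (restriction_pos m p x (Pair x -` E)) \<partial>m)"
    unfolding restriction_pos_eq by (rule M(5)[OF E])
  then have e: "(\<integral>\<^sup>+x. ennreal (restriction_pos m p x (Pair x -` E)) \<partial>m) = emeasure p E" ..
  show "integrable m (\<lambda>x. restriction_pos m p x (Pair x -` E))"
    using mm' nn by (intro integrableI_nonneg)
      (auto simp: e finite_measure.emeasure_finite[OF p(1)] less_top[symmetric])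
  show "measure p E = (\<integral>x. restriction_pos m p x (Pair x -` E) \<partial>m)"
    using mm' nn by (subst integral_eq_nn_integral) (auto simp: e measure_def)
qed

lemma AB_parts:
  assumes "\<mu> \<in> AB m"
  shows "finite_measure (pos_part \<mu>)" "sets (pos_part \<mu>) = sets borel"
    "absolutely_continuous m (distr (pos_part \<mu>) borel fst)"
    "finite_measure (neg_part \<mu>)" "sets (neg_part \<mu>) = sets borel"
    "absolutely_continuous m (distr (neg_part \<mu>) borel fst)"
    "\<mu> \<in> signed_measures"
    "A \<in> sets borel \<Longrightarrow> \<mu> A = measure (pos_part \<mu>) A - measure (neg_part \<mu>) A"
  using assms jordan_parts[of \<mu>] by (auto simp: AB_def jordan_decomposition_def)

lemma restriction_signed_measure:
  fixes \<mu> :: "('m::polish_space \<times> 'k::{metric_space, second_countable_topology}) set \<Rightarrow> real"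
  assumes K: "compact (UNIV :: 'k set)" and \<mu>: "\<mu> \<in> AB m"
  shows "restriction m \<mu> x \<in> signed_measures"
proof -
  note P = AB_parts[OF \<mu>]
  show ?thesis
    unfolding restriction_def restriction_pos_eq
    using fibre_conditional(2,3)[OF P(1,2) K] fibre_conditional(2,3)[OF P(4,5) K]
    by (intro measure_diff_signed_measure) (auto simp: prob_space_def)
qed

lemma fibre_density_restriction:
  fixes \<mu> :: "('m::polish_space \<times> 'k::{metric_space, second_countable_topology}) set \<Rightarrow> real"
  assumes m: "finite_measure m" "sets m = sets borel" and K: "compact (UNIV :: 'k set)" and \<mu>: "\<mu> \<in> AB m"
  shows "fibre_density m \<mu> (restriction m \<mu>)"
proof -
  note P = AB_parts[OF \<mu>]
  show ?thesis unfolding fibre_density_def restriction_def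
    using restriction_pos[OF m P(1,2) K P(3)] restriction_pos[OF m P(4,5) K P(6)] P(8) by auto
qed

text \<open>True at every x because the chosen disintegration consists of probability measures
  everywhere.\<close>

lemma phi1_eq_restriction_UNIV:
  fixes \<mu> :: "('m::polish_space \<times> 'k::{metric_space, second_countable_topology}) set \<Rightarrow> real"
  assumes K: "compact (UNIV :: 'k set)" and \<mu>: "\<mu> \<in> AB m"
  shows "phi1 m \<mu> x = restriction m \<mu> x UNIV"
proof -
  note P = AB_parts[OF \<mu>]
  have "measure (fibre_conditional p x) UNIV = 1" if "finite_measure p" "sets p = sets borel"
    for p :: "('m \<times> 'k) measure"
    using prob_space.prob_space[OF fibre_conditional(2)[OF that K, of x]]
      sets_eq_imp_space_eq[OF fibre_conditional(3)[OF that K, of x]] by simp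
  then show ?thesis
    unfolding phi1_def restriction_def restriction_pos_eq using P by simp
qed

section \<open>The transfer operator as a push-forward\<close>

locale skew_product_system =
  fixes f :: "'m::polish_space \<Rightarrow> 'm"
    and G :: "'m \<times> 'k::{metric_space, second_countable_topology} \<Rightarrow> 'k"
    and \<phi> h :: "'m \<Rightarrow> real" and m \<nu> :: "'m measure" and lam :: real
    and d :: nat and P :: "nat \<Rightarrow> 'm set"
  assumes compact_fibre: "compact (UNIV :: 'k set)"
    and f_measurable: "f \<in> borel_measurable borel" and G_measurable: "G \<in> borel_measurable borel"
    and P1_1: "P1_1 f \<phi> m h \<nu> lam"
    and P2: "P2 f \<nu> d P"
begin

lemma \<phi>_measurable[measurable]: "\<phi> \<in> borel_measurable borel"
  and h_measurable[measurable]: "h \<in> borel_measurable borel"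
  and lam_pos: "0 < lam"
  and m_eq: "m = density \<nu> (\<lambda>x. ennreal (h x))"
  and transfer_h: "AE x in \<nu>. transfer_op f \<phi> h x = lam * h x"
  and sets_\<nu>: "sets \<nu> = sets borel"
  and conformal_image: "\<And>A. A \<in> sets borel \<Longrightarrow> inj_on f A \<Longrightarrow> f ` A \<in> sets borel"
  and conformal: "\<And>A. A \<in> sets borel \<Longrightarrow> inj_on f A \<Longrightarrow>
      emeasure \<nu> (f ` A) = (\<integral>\<^sup>+x\<in>A. ennreal (lam * exp (- \<phi> x)) \<partial>\<nu>)"
  using P1_1 by (auto simp: P1_1_def conformal_measure_def)

lemma h_lower: "\<exists>a>0. \<forall>x. a \<le> h x"
  using P1_1 by (auto simp: P1_1_def)

lemma h_pos: "0 < h x"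
  using h_lower by (meson less_le_trans)

lemma sets_m: "sets m = sets borel"
  by (simp add: m_eq sets_\<nu>)

lemma space_\<nu>: "space \<nu> = UNIV" and space_m: "space m = UNIV"
  using sets_eq_imp_space_eq[OF sets_\<nu>] sets_eq_imp_space_eq[OF sets_m] by simp_all

lemma measurable_\<nu>: "measurable \<nu> N = measurable borel N"
  by (rule measurable_cong_sets[OF sets_\<nu> refl])

lemma measurable_m: "measurable m N = measurable borel N"
  by (rule measurable_cong_sets[OF sets_m refl])

lemma prob_space_m: "prob_space m"
  using P1_1 unfolding P1_1_def equilibrium_state_def invariant_prob_def by blast

lemma finite_measure_m: "finite_measure m"
  using prob_space_m by (simp add: prob_space_def)

lemma AE_m_iff: "(AE x in m. Q x) \<longleftrightarrow> (AE x in \<nu>. Q x)"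
  unfolding m_eq by (subst AE_density) (simp_all add: measurable_\<nu> h_pos)

lemma finite_measure_\<nu>: "finite_measure \<nu>"
proof -
  obtain a where a: "0 < a" "\<And>x. a \<le> h x" using h_lower by blast
  have "ennreal a * emeasure \<nu> UNIV = (\<integral>\<^sup>+x. ennreal a \<partial>\<nu>)"
    by (simp add: space_\<nu>)
  also have "\<dots> \<le> (\<integral>\<^sup>+x. ennreal (h x) \<partial>\<nu>)"
    by (intro nn_integral_mono ennreal_leI a)
  also have "\<dots> = emeasure m (space m)"
    unfolding m_eq by (simp add: emeasure_density measurable_\<nu> space_\<nu>[symmetric] cong: nn_integral_cong)
  also have "\<dots> < top" using prob_space.emeasure_space_1[OF prob_space_m] by simp
  finally have "emeasure \<nu> UNIV \<noteq> top" using a(1) by (auto simp: ennreal_mult_eq_top_iff)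
  then show ?thesis by (intro finite_measureI) (simp add: space_\<nu>)
qed

lemma integrable_m_iff: "v \<in> borel_measurable borel \<Longrightarrow> integrable m v \<longleftrightarrow> integrable \<nu> (\<lambda>x. h x * v x)"
  and integral_m: "v \<in> borel_measurable borel \<Longrightarrow> (\<integral>x. v x \<partial>m) = (\<integral>x. h x * v x \<partial>\<nu>)"
  for v :: "'m \<Rightarrow> real"
  unfolding m_eq using h_pos
  by (simp_all add: integrable_real_density integral_real_density measurable_\<nu> less_imp_le)

section \<open>Inverse branches and change of variables\<close>

definition branch :: "nat \<Rightarrow> 'm \<Rightarrow> 'm" where
  "branch i = inv_into (P i) f"

lemma P_borel: "i < d \<Longrightarrow> P i \<in> sets borel"
  and P_bij: "i < d \<Longrightarrow> bij_betw f (P i) UNIV"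
  and P_disjoint: "disjoint_family_on P {..<d}"
  and P_full: "emeasure \<nu> (\<Union>i<d. P i) = emeasure \<nu> UNIV"
  using P2 by (auto simp: P2_def)

lemma f_branch: "i < d \<Longrightarrow> f (branch i x) = x"
  unfolding branch_def using P_bij by (metis UNIV_I bij_betw_imp_surj_on f_inv_into_f)

lemma branch_in: "i < d \<Longrightarrow> branch i x \<in> P i"
  unfolding branch_def using P_bij by (metis UNIV_I bij_betw_imp_surj_on inv_into_into)

lemma branch_f: "i < d \<Longrightarrow> y \<in> P i \<Longrightarrow> branch i (f y) = y"
  unfolding branch_def using P_bij by (metis bij_betw_imp_inj_on inv_into_f_f)

lemma inj_branch: "inj_on (\<lambda>i. branch i x) {..<d}"
  using branch_in P_disjoint by (auto simp: inj_on_def disjoint_family_on_def) (metis disjoint_iff lessThan_iff)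

lemma branch_vimage: "i < d \<Longrightarrow> branch i -` A = f ` (A \<inter> P i)"
  using f_branch branch_in branch_f by (auto simp: image_iff) (metis IntI)

lemma P_inj: "i < d \<Longrightarrow> inj_on f (A \<inter> P i)"
  using P_bij by (metis bij_betw_imp_inj_on inf_le2 inj_on_subset)

text \<open>Preimages under an inverse branch are images under f of Borel subsets of
  \<open>P i\<close>, which are Borel by the definition of a conformal measure.\<close>

lemma branch_measurable: "i < d \<Longrightarrow> branch i \<in> borel \<rightarrow>\<^sub>M borel"
  by (rule measurableI) (auto simp: branch_vimage P_borel P_inj intro!: conformal_image)

text \<open>Conformality read backwards: the Jacobian of f, cut off to \<open>P i\<close>, becomes
  the density of the image of \<nu> under the inverse branch.\<close>

lemma distr_branch:
  assumes i: "i < d"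
  shows "distr \<nu> borel (branch i) = density \<nu> (\<lambda>x. ennreal (lam * exp (- \<phi> x) * indicator (P i) x))"
proof (rule measure_eqI)
  fix A assume "A \<in> sets (distr \<nu> borel (branch i))"
  then have A: "A \<in> sets borel" by simp
  have "emeasure (distr \<nu> borel (branch i)) A = emeasure \<nu> (f ` (A \<inter> P i))"
    using A i by (subst emeasure_distr) (auto simp: measurable_\<nu> branch_measurable space_\<nu> branch_vimage)
  also have "\<dots> = (\<integral>\<^sup>+x\<in>A \<inter> P i. ennreal (lam * exp (- \<phi> x)) \<partial>\<nu>)"
    using A i by (intro conformal P_inj) (auto simp: P_borel)
  also have "\<dots> = emeasure (density \<nu> (\<lambda>x. ennreal (lam * exp (- \<phi> x) * indicator (P i) x))) A"
    using A i P_borel[OF i]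
    by (subst emeasure_density) (auto simp: sets_\<nu> measurable_\<nu> intro!: nn_integral_cong split: split_indicator)
  finally show "emeasure (distr \<nu> borel (branch i)) A =
      emeasure (density \<nu> (\<lambda>x. ennreal (lam * exp (- \<phi> x) * indicator (P i) x))) A" .
qed (simp add: sets_\<nu>)

text \<open>The image of \<nu> under a branch has a density with respect to \<nu>, so points sent by
  a branch into a null set form a null set. This carries almost everywhere bounds from the preimages
  to the point itself.\<close>

lemma AE_branch:
  assumes "AE x in \<nu>. Q x"
  shows "AE x in \<nu>. \<forall>i<d. Q (branch i x)"
proof -
  have "AE x in \<nu>. Q (branch i x)" if i: "i < d" for i
  proof (rule AE_distrD[where M'=borel and f="branch i" and P=Q])
    show "branch i \<in> \<nu> \<rightarrow>\<^sub>M borel" using i by (simp add: measurable_\<nu> branch_measurable)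
    have [measurable]: "P i \<in> sets borel" using i by (rule P_borel)
    show "AE x in distr \<nu> borel (branch i). Q x"
      unfolding distr_branch[OF i] using assms
      by (subst AE_density) (auto simp: measurable_\<nu> elim!: eventually_mono)
  qed
  then have "AE x in \<nu>. \<forall>i\<in>{..<d}. Q (branch i x)"
    by (intro AE_finite_allI) auto
  then show ?thesis by (simp add: Ball_def)
qed

lemma AE_in_P: "AE x in \<nu>. x \<in> (\<Union>i<d. P i)"
proof -
  interpret finite_measure \<nu> by (rule finite_measure_\<nu>)
  have U: "(\<Union>i<d. P i) \<in> sets \<nu>" using P_borel by (auto simp: sets_\<nu>)
  have "emeasure \<nu> (space \<nu> - (\<Union>i<d. P i)) = emeasure \<nu> (space \<nu>) - emeasure \<nu> (\<Union>i<d. P i)"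
    using U by (intro emeasure_compl) (auto simp: emeasure_finite)
  then have "emeasure \<nu> (space \<nu> - (\<Union>i<d. P i)) = 0" by (simp add: P_full space_\<nu>)
  then show ?thesis
    by (intro AE_I[where N="space \<nu> - (\<Union>i<d. P i)"]) (use U in auto)
qed

section \<open>Averaging over the branches\<close>

text \<open>Transition probabilities from x to its preimages, the g-function of the normalised
  operator. That they sum to 1 almost everywhere is part of \<open>AE_preimages\<close>.\<close>

definition weight :: "nat \<Rightarrow> 'm \<Rightarrow> real" where
  "weight i x = h (branch i x) * exp (\<phi> (branch i x)) / (lam * h x)"

lemma weight_nonneg: "0 \<le> weight i x"
  using h_pos lam_pos by (simp add: weight_def less_imp_le)

lemma weight_measurable: "i < d \<Longrightarrow> weight i \<in> borel_measurable borel"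
  unfolding weight_def[abs_def] using branch_measurable[measurable] by measurable

text \<open>Stationarity of m under the averaging. On each branch the Jacobian lam * exp (- \<phi>)
  cancels the factor exp \<phi> / lam of the weight and leaves the \<nu>-integral of h v over
  \<open>P i\<close>; the sets \<open>P i\<close> are disjoint and cover almost everything.\<close>

lemma
  fixes v :: "'m \<Rightarrow> real"
  assumes v[measurable]: "v \<in> borel_measurable borel" and i: "integrable m v"
  shows integrable_branches: "integrable m (\<lambda>x. \<Sum>i<d. weight i x * v (branch i x))"
    and integral_branches: "(\<integral>x. (\<Sum>i<d. weight i x * v (branch i x)) \<partial>m) = (\<integral>x. v x \<partial>m)"
proof -
  have ih: "integrable \<nu> (\<lambda>x. h x * v x)" using i integrable_m_iff[OF v] by simp
  have int: "integrable m (\<lambda>x. weight i x * v (branch i x))"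
    "(\<integral>x. weight i x * v (branch i x) \<partial>m) = (\<integral>x. indicator (P i) x * (h x * v x) \<partial>\<nu>)" if i: "i < d" for i
  proof -
    have [measurable]: "P i \<in> sets borel" "branch i \<in> borel \<rightarrow>\<^sub>M borel" "weight i \<in> borel_measurable borel"
      using i by (auto intro: P_borel branch_measurable weight_measurable)
    \<comment> \<open>The integrand times h x, written as a function of the preimage alone, so that
      \<open>distr_branch\<close> applies.\<close>
    define u where "u y = h y * exp (\<phi> y) * v y / lam" for y
    have um[measurable]: "u \<in> borel_measurable borel" unfolding u_def by measurable
    have eq: "h x * (weight i x * v (branch i x)) = u (branch i x)" for x
      using h_pos[of x] by (simp add: weight_def u_def)
    have eq2: "lam * exp (- \<phi> x) * indicator (P i) x * u x = indicator (P i) x * (h x * v x)" for x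
      using lam_pos by (simp add: u_def exp_minus)
    have iP: "integrable \<nu> (\<lambda>x. indicator (P i) x * (h x * v x))"
      using integrable_mult_indicator[OF _ ih, of "P i"] by (simp add: sets_\<nu>)
    have nn: "0 \<le> lam * exp (- \<phi> x) * indicator (P i) x" for x using lam_pos by simp
    have "integrable (distr \<nu> borel (branch i)) u"
      unfolding distr_branch[OF i]
      by (subst integrable_real_density) (simp_all add: measurable_\<nu> nn eq2 iP)
    then have "integrable \<nu> (\<lambda>x. u (branch i x))"
      by (subst (asm) integrable_distr_eq) (simp_all add: measurable_\<nu>)
    then show "integrable m (\<lambda>x. weight i x * v (branch i x))"
      by (subst integrable_m_iff) (simp_all add: eq)
    have "(\<integral>x. weight i x * v (branch i x) \<partial>m) = (\<integral>x. u (branch i x) \<partial>\<nu>)"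
      by (subst integral_m) (simp_all add: eq)
    also have "\<dots> = (\<integral>x. u x \<partial>distr \<nu> borel (branch i))"
      by (subst integral_distr) (simp_all add: measurable_\<nu>)
    also have "\<dots> = (\<integral>x. indicator (P i) x * (h x * v x) \<partial>\<nu>)"
      unfolding distr_branch[OF i]
      by (subst integral_real_density) (simp_all add: measurable_\<nu> nn eq2)
    finally show "(\<integral>x. weight i x * v (branch i x) \<partial>m) = (\<integral>x. indicator (P i) x * (h x * v x) \<partial>\<nu>)" .
  qed
  show "integrable m (\<lambda>x. \<Sum>i<d. weight i x * v (branch i x))"
    by (intro Bochner_Integration.integrable_sum int) simp
  have iP: "integrable \<nu> (\<lambda>x. indicator (P i) x * (h x * v x))" if "i < d" for i
    using integrable_mult_indicator[OF _ ih, of "P i"] P_borel[OF that] by (simp add: sets_\<nu>)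
  have "(\<integral>x. (\<Sum>i<d. weight i x * v (branch i x)) \<partial>m) = (\<Sum>i<d. \<integral>x. indicator (P i) x * (h x * v x) \<partial>\<nu>)"
    by (subst Bochner_Integration.integral_sum) (auto intro!: int sum.cong)
  also have "\<dots> = (\<integral>x. (\<Sum>i<d. indicator (P i) x * (h x * v x)) \<partial>\<nu>)"
    by (subst Bochner_Integration.integral_sum) (auto intro!: iP)
  also have "\<dots> = (\<integral>x. h x * v x \<partial>\<nu>)"
  proof (rule integral_cong_AE)
    show "AE x in \<nu>. (\<Sum>i<d. indicator (P i) x * (h x * v x)) = h x * v x"
      using AE_in_P
    proof eventually_elim
      case (elim x)
      then obtain i where i: "i < d" "x \<in> P i" by auto
      have uniq: "j = i" if j: "j < d" "x \<in> P j" for j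
      proof (rule ccontr)
        assume "j \<noteq> i"
        then have "P j \<inter> P i = {}" using P_disjoint i(1) j(1) unfolding disjoint_family_on_def by auto
        with i j show False by auto
      qed
      have "(\<Sum>j<d. indicator (P j) x * (h x * v x)) = (\<Sum>j<d. if j = i then h x * v x else 0)"
      proof (rule sum.cong)
        fix j assume j: "j \<in> {..<d}"
        show "indicator (P j) x * (h x * v x) = (if j = i then h x * v x else 0)"
        proof (cases "x \<in> P j")
          case True
          with j have "j = i" by (intro uniq) auto
          with True show ?thesis by simp
        next
          case False
          then have "j \<noteq> i" using i by auto
          with False show ?thesis by simp
        qed
      qed simp
      then show ?case using i by (simp only: sum.delta[OF finite_lessThan] lessThan_iff if_True)
    qed
  qed (use P_borel in \<open>auto simp: measurable_\<nu>\<close>)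
  also have "\<dots> = (\<integral>x. v x \<partial>m)" by (simp add: integral_m)
  finally show "(\<integral>x. (\<Sum>i<d. weight i x * v (branch i x)) \<partial>m) = (\<integral>x. v x \<partial>m)" .
qed

text \<open>
  The branches account for all preimages of almost every point: the branch part of
  \<open>transfer_op f \<phi> h\<close> is at most \<open>lam * h\<close> and has the same integral, while every further preimage
  would contribute a positive term.
\<close>

lemma AE_preimages:
  "AE x in \<nu>. (\<Sum>i<d. weight i x) = 1 \<and> f -` {x} = (\<lambda>i. branch i x) ` {..<d}"
proof -
  interpret m: prob_space m by (rule prob_space_m)
  have le: "(\<Sum>y\<in>F. exp (\<phi> y) * h y) \<le> lam * h x"
    if x: "transfer_op f \<phi> h x = lam * h x" and F: "finite F" "F \<subseteq> f -` {x}" for x F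
  proof -
    \<comment> \<open>A divergent sum would get the default value 0, which the eigenvalue equation
      excludes because lam * h x is positive.\<close>
    have s: "(\<lambda>y. exp (\<phi> y) * h y) summable_on f -` {x}"
    proof (rule ccontr)
      assume "\<not> ?thesis"
      then have "transfer_op f \<phi> h x = 0" unfolding transfer_op_def by (simp add: infsum_not_exists)
      with x h_pos[of x] lam_pos show False by simp
    qed
    have "(\<Sum>y\<in>F. exp (\<phi> y) * h y) \<le> (\<Sum>\<^sub>\<infinity>y\<in>f -` {x}. exp (\<phi> y) * h y)"
      using h_pos by (intro finite_sum_le_infsum[OF s F]) (simp add: less_imp_le)
    then show ?thesis using x by (simp add: transfer_op_def)
  qed
  have sum_eq: "(\<Sum>y\<in>(\<lambda>i. branch i x) ` {..<d}. exp (\<phi> y) * h y) = lam * h x * (\<Sum>i<d. weight i x)" for x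
  proof -
    have "(\<Sum>y\<in>(\<lambda>i. branch i x) ` {..<d}. exp (\<phi> y) * h y) = (\<Sum>i<d. exp (\<phi> (branch i x)) * h (branch i x))"
      by (subst sum.reindex[OF inj_branch]) simp
    also have "\<dots> = lam * h x * (\<Sum>i<d. weight i x)"
      using lam_pos h_pos[of x] by (simp add: weight_def sum_distrib_left mult.commute)
    finally show ?thesis .
  qed
  have sub: "(\<lambda>i. branch i x) ` {..<d} \<subseteq> f -` {x}" for x by (auto simp: f_branch)
  have le1: "AE x in m. 0 \<le> 1 - (\<Sum>i<d. weight i x)"
    unfolding AE_m_iff using transfer_h
  proof eventually_elim
    case (elim x)
    have "lam * h x * (\<Sum>i<d. weight i x) \<le> lam * h x"
      using le[OF elim _ sub] by (simp add: sum_eq)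
    then have "(\<Sum>i<d. weight i x) \<le> 1"
      using h_pos[of x] lam_pos mult_le_cancel_left_pos[of "lam * h x" "\<Sum>i<d. weight i x" 1] by simp
    then show ?case by simp
  qed
  have int: "integrable m (\<lambda>x. \<Sum>i<d. weight i x)" "(\<integral>x. (\<Sum>i<d. weight i x) \<partial>m) = 1"
  proof -
    have 1: "(\<lambda>_. 1::real) \<in> borel_measurable borel" "integrable m (\<lambda>_. 1::real)" by simp_all
    have "(\<integral>x. (1::real) \<partial>m) = 1" by (simp add: m.prob_space)
    then show "integrable m (\<lambda>x. \<Sum>i<d. weight i x)" "(\<integral>x. (\<Sum>i<d. weight i x) \<partial>m) = 1"
      using integrable_branches[OF 1] integral_branches[OF 1] by simp_all
  qed
  have "(\<integral>x. 1 - (\<Sum>i<d. weight i x) \<partial>m) = 0"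
    using int by (simp add: m.prob_space)
  then have "AE x in m. 1 - (\<Sum>i<d. weight i x) = 0"
    using int le1 by (subst (asm) integral_nonneg_eq_0_iff_AE) auto
  then have "AE x in \<nu>. (\<Sum>i<d. weight i x) = 1" by (simp add: AE_m_iff)
  with transfer_h show ?thesis
  proof eventually_elim
    case (elim x)
    have "y \<in> (\<lambda>i. branch i x) ` {..<d}" if y: "f y = x" for y
    proof (rule ccontr)
      assume "y \<notin> (\<lambda>i. branch i x) ` {..<d}"
      then have "exp (\<phi> y) * h y + lam * h x * (\<Sum>i<d. weight i x) \<le> lam * h x"
        using le[OF elim(1), of "insert y ((\<lambda>i. branch i x) ` {..<d})"] sub y
        by (simp add: sum_eq)
      moreover have "0 < exp (\<phi> y) * h y" using h_pos by simp
      ultimately show False using elim(2) by simp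
    qed
    then show ?case by (intro conjI elim(2) equalityI sub) auto
  qed
qed

text \<open>The null set comes from \<open>AE_preimages\<close> alone, so the identity holds for all
  v simultaneously.\<close>

lemma AE_transfer_op:
  "AE x in \<nu>. \<forall>v. transfer_op f \<phi> (\<lambda>y. v y * h y) x = lam * h x * (\<Sum>i<d. weight i x * v (branch i x))"
  using AE_preimages
proof eventually_elim
  case (elim x)
  show ?case
  proof
    fix v :: "'m \<Rightarrow> real"
    have "transfer_op f \<phi> (\<lambda>y. v y * h y) x = (\<Sum>i<d. exp (\<phi> (branch i x)) * (v (branch i x) * h (branch i x)))"
      unfolding transfer_op_def using elim by (simp add: sum.reindex[OF inj_branch])
    also have "\<dots> = (\<Sum>i<d. lam * h x * (weight i x * v (branch i x)))"
      using lam_pos h_pos[of x] by (intro sum.cong) (auto simp: weight_def)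
    finally show "transfer_op f \<phi> (\<lambda>y. v y * h y) x = lam * h x * (\<Sum>i<d. weight i x * v (branch i x))"
      by (simp add: sum_distrib_left)
  qed
qed

section \<open>The skew product acting on signed measures\<close>

abbreviation F :: "'m \<times> 'k \<Rightarrow> 'm \<times> 'k" where "F \<equiv> skew_product f G"

lemma F_measurable: "F \<in> borel \<rightarrow>\<^sub>M borel"
  unfolding skew_product_def[abs_def]
  by (intro borel_measurable_Pair G_measurable measurable_compose[OF fst_borel_measurable f_measurable])

lemma Pair_vimage_F: "Pair y -` (F -` E) = fibre_map G y -` (Pair (f y) -` E)"
  by (auto simp: skew_product_def)

lemma fibre_map_measurable: "fibre_map G y \<in> borel \<rightarrow>\<^sub>M borel"
  by (rule measurable_compose[OF Pair_borel_measurable G_measurable])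

lemma transfer_pos_eq:
  assumes p: "finite_measure p" "sets p = sets (borel :: ('m \<times> 'k) measure)"
    and ac: "absolutely_continuous m (distr p borel fst)" and E: "E \<in> sets borel"
  shows "transfer_pos f G \<phi> h d P m p E = lam * measure p (F -` E)"
proof -
  let ?g = "marginal_density m p"
  have E': "F -` E \<in> sets borel" using measurable_sets[OF F_measurable E] by simp
  define r where "r y = restriction_pos m p y (Pair y -` (F -` E))" for y
  note R = restriction_pos[OF finite_measure_m sets_m p compact_fibre ac E', folded r_def]
  note M = marginal_density[OF finite_measure_m sets_m p compact_fibre ac]
  have r0: "0 \<le> r y" for y unfolding r_def restriction_pos_eq by (simp add: M(2))
  have good: "AE y in \<nu>. ?g y * measure (distr (disintegration p y) borel F) E = r y"
    using M(4)[unfolded AE_m_iff]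
  proof eventually_elim
    case (elim y)
    note D = disintegrationD(2,3)[OF p compact_fibre, of y]
    have "measure (distr (disintegration p y) borel F) E = measure (disintegration p y) (F -` E)"
      using E sets_eq_imp_space_eq[OF D(2)]
      by (subst measure_distr) (auto simp: measurable_cong_sets[OF D(2) refl] F_measurable)
    moreover have "measure (disintegration p y) (F -` E) = measure (fibre_conditional p y) (Pair y -` (F -` E))"
      if "?g y \<noteq> 0"
      using elim that fibre_conditional(4)[OF p compact_fibre _ E', of y] by (simp add: measure_def)
    ultimately show ?case by (cases "?g y = 0") (auto simp: r_def restriction_pos_eq)
  qed
  have AE: "AE x in \<nu>. transfer_conditional f G \<phi> h d P m p x E * transfer_op_h f \<phi> h ?g x
      = lam * (\<Sum>i<d. weight i x * r (branch i x))"
    using AE_branch[OF good] AE_transfer_op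
  proof eventually_elim
    case (elim x)
    define L where "L = transfer_op_h f \<phi> h ?g x"
    have L: "L = lam * (\<Sum>i<d. weight i x * ?g (branch i x))"
      unfolding L_def transfer_op_h_def using elim(2) h_pos[of x] by simp
    have "(\<Sum>i<d. let y = inv_into (P i) f x in ?g y * h y * exp (\<phi> y) *
        measure (distr (disintegration p y) borel F) E)
      = (\<Sum>i<d. h x * (lam * (weight i x * r (branch i x))))"
      using elim(1) h_pos[of x] lam_pos
      by (intro sum.cong) (auto simp: weight_def Let_def branch_def)
    then have c: "transfer_conditional f G \<phi> h d P m p x E * L =
        1 / (h x * L) * (\<Sum>i<d. h x * (lam * (weight i x * r (branch i x)))) * L"
      unfolding transfer_conditional_def L_def by simp
    show ?case
    proof (cases "L = 0")
      \<comment> \<open>Here the conditional measure is 0 by division by zero. The other side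
        vanishes too: non-negative terms with sum 0 force every weighted density, hence every
        weighted restriction, to be 0.\<close>
      case True
      then have "(\<Sum>i<d. weight i x * ?g (branch i x)) = 0" using L lam_pos by simp
      then have "\<forall>i\<in>{..<d}. weight i x * ?g (branch i x) = 0"
        by (subst (asm) sum_nonneg_eq_0_iff) (auto simp: weight_nonneg M(2))
      then have "(\<Sum>i<d. weight i x * r (branch i x)) = 0"
        by (intro sum.neutral) (auto simp: r_def restriction_pos_eq)
      then show ?thesis using True by (simp add: L_def)
    next
      case False
      then show ?thesis using c h_pos[of x] by (simp add: L_def sum_distrib_left[symmetric])
    qed
  qed
  have int: "integrable m (\<lambda>x. \<Sum>i<d. weight i x * r (branch i x))"
    "(\<integral>x. (\<Sum>i<d. weight i x * r (branch i x)) \<partial>m) = (\<integral>y. r y \<partial>m)"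
    using integrable_branches[OF R(1,2)] integral_branches[OF R(1,2)] by auto
  have "transfer_pos f G \<phi> h d P m p E = enn2real (\<integral>\<^sup>+x. ennreal (lam * (\<Sum>i<d. weight i x * r (branch i x))) \<partial>m)"
    unfolding transfer_pos_def using AE
    by (intro arg_cong[where f=enn2real] nn_integral_cong_AE) (auto simp: AE_m_iff elim!: eventually_mono)
  also have "\<dots> = (\<integral>x. lam * (\<Sum>i<d. weight i x * r (branch i x)) \<partial>m)"
    using int lam_pos borel_measurable_integrable[OF int(1)]
    by (subst integral_eq_nn_integral) (auto intro!: AE_I2 mult_nonneg_nonneg sum_nonneg weight_nonneg r0 intro: less_imp_le)
  also have "\<dots> = lam * measure p (F -` E)" by (simp add: int R(3))
  finally show ?thesis .
qed

lemma transfer_pos_nonborel: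
  assumes "E \<notin> sets borel"
  shows "transfer_pos f G \<phi> h d P m p E = 0"
  unfolding transfer_pos_def transfer_conditional_def using assms by (simp add: measure_notin_sets Let_def)

abbreviation T :: "(('m \<times> 'k) set \<Rightarrow> real) \<Rightarrow> ('m \<times> 'k) set \<Rightarrow> real" where
  "T \<equiv> normalized_transfer_F f G \<phi> h lam d P m"

text \<open>An equality of set functions, with both sides 0 on non-Borel sets, so that it can be
  substituted wherever T is applied.\<close>

lemma normalized_transfer_F_eq_push_signed:
  assumes \<mu>: "\<mu> \<in> AB m"
  shows "T \<mu> = push_signed F \<mu>"
proof
  fix E
  note A = AB_parts[OF \<mu>]
  show "T \<mu> E = push_signed F \<mu> E"
  proof (cases "E \<in> sets borel")
    case True
    then have "F -` E \<in> sets borel" using measurable_sets[OF F_measurable True] by simp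
    moreover have "inverse lam * lam = 1" using lam_pos by simp
    ultimately show ?thesis using True
      by (simp add: normalized_transfer_F_def transfer_F_def push_signed_def A(8) right_diff_distrib mult.assoc[symmetric]
          transfer_pos_eq[OF A(1,2,3)] transfer_pos_eq[OF A(4,5,6)])
  qed (simp add: normalized_transfer_F_def transfer_F_def push_signed_def transfer_pos_nonborel)
qed

definition branch_average :: "('m \<Rightarrow> 'k set \<Rightarrow> real) \<Rightarrow> 'm \<Rightarrow> 'k set \<Rightarrow> real" where
  "branch_average \<rho> x = (\<lambda>B. \<Sum>i<d. weight i x * push_signed (fibre_map G (branch i x)) (\<rho> (branch i x)) B)"

lemma
  assumes \<mu>: "\<mu> \<in> AB m"
  shows T_in_AB: "T \<mu> \<in> AB m"
    and restriction_T: "AE x in m. restriction m (T \<mu>) x = branch_average (restriction m \<mu>) x"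
proof -
  let ?\<rho> = "restriction m \<mu>"
  have s: "?\<rho> x \<in> signed_measures" for x by (rule restriction_signed_measure[OF compact_fibre \<mu>])
  have bs: "branch_average ?\<rho> x \<in> signed_measures" for x
    unfolding branch_average_def
    by (intro signed_measure_sum push_signed_in_signed_measures fibre_map_measurable s) simp
  have d: "fibre_density m \<mu> ?\<rho>"
    by (rule fibre_density_restriction[OF finite_measure_m sets_m compact_fibre \<mu>])
  note A = AB_parts[OF \<mu>]
  have d': "fibre_density m (T \<mu>) (branch_average ?\<rho>)"
    unfolding fibre_density_def
  proof (intro ballI)
    fix E :: "('m \<times> 'k) set" assume E: "E \<in> sets borel"
    have E': "F -` E \<in> sets borel" using measurable_sets[OF F_measurable E] by simp
    define v where "v y = ?\<rho> y (Pair y -` (F -` E))" for y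
    have v: "integrable m v" "\<mu> (F -` E) = (\<integral>y. v y \<partial>m)"
      using d E' unfolding fibre_density_def v_def by auto
    have vm: "v \<in> borel_measurable borel"
      using borel_measurable_integrable[OF v(1)] by (simp add: measurable_m)
    have "Pair x -` E \<in> sets borel" for x using measurable_sets[OF Pair_borel_measurable E] by simp
    then have eq: "branch_average ?\<rho> x (Pair x -` E) = (\<Sum>i<d. weight i x * v (branch i x))" for x
      unfolding branch_average_def v_def
      by (intro sum.cong refl) (simp add: push_signed_def Pair_vimage_F f_branch)
    show "integrable m (\<lambda>x. branch_average ?\<rho> x (Pair x -` E)) \<and>
        T \<mu> E = (\<integral>x. branch_average ?\<rho> x (Pair x -` E) \<partial>m)"
      unfolding eq using integrable_branches[OF vm v(1)] integral_branches[OF vm v(1)] v(2) E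
      by (simp add: normalized_transfer_F_eq_push_signed[OF \<mu>] push_signed_def)
  qed
  have Ts: "T \<mu> \<in> signed_measures"
    unfolding normalized_transfer_F_eq_push_signed[OF \<mu>]
    by (rule push_signed_in_signed_measures[OF F_measurable A(7)])
  show T: "T \<mu> \<in> AB m"
    by (rule AB_if_fibre_density[OF sets_m Ts _ d']) (simp add: bs)
  show "AE x in m. restriction m (T \<mu>) x = branch_average ?\<rho> x"
    by (rule fibre_density_unique[OF finite_measure_m sets_m _ _ _ d'])
      (simp_all add: bs restriction_signed_measure[OF compact_fibre T]
        fibre_density_restriction[OF finite_measure_m sets_m compact_fibre T])
qed

text \<open>Push-forward preserves total mass, so evaluating \<open>restriction_T\<close> at UNIV
  averages the densities with the same weights.\<close>

lemma phi1_T: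
  assumes \<mu>: "\<mu> \<in> AB m"
  shows "AE x in \<nu>. inverse lam * transfer_op f \<phi> (\<lambda>y. h y * phi1 m \<mu> y) x = h x * phi1 m (T \<mu>) x"
  using restriction_T[OF \<mu>, unfolded AE_m_iff] AE_transfer_op
proof eventually_elim
  case (elim x)
  have "phi1 m (T \<mu>) x = (\<Sum>i<d. weight i x * phi1 m \<mu> (branch i x))"
    unfolding phi1_eq_restriction_UNIV[OF compact_fibre T_in_AB[OF \<mu>]] elim(1) branch_average_def
    by (simp add: push_signed_def phi1_eq_restriction_UNIV[OF compact_fibre \<mu>])
  then show ?case
    using elim(2)[rule_format, of "phi1 m \<mu>"] lam_pos by (simp add: mult.commute)
qed

end

section \<open>Norm estimates\<close>

text \<open>A Limsup directly bounds u only by levels strictly above it. A sequence of such levels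
  converging down to it gives the bound itself; the value minus infinity needs its own
  sequence.\<close>

lemma AE_le_ess_sup: "AE x in M. u x \<le> ess_sup M u"
proof -
  define s where "s = ess_sup M u"
  have *: "AE x in M. u x < c" if "s < c" for c
    using Limsup_lessD[of "ae_filter M" u c] that by (simp add: s_def ess_sup_def)
  have "AE x in M. u x \<le> s"
  proof (cases "s = \<infinity>")
    case False
    have "\<exists>c :: nat \<Rightarrow> ereal. (\<forall>n. s < c n) \<and> c \<longlonglongrightarrow> s"
    proof (cases "s = - \<infinity>")
      case True
      have "(\<lambda>n. ereal (- real n)) \<longlonglongrightarrow> - \<infinity>"
        using tendsto_uminus_ereal[OF id_nat_ereal_tendsto_PInf] by simp
      then show ?thesis using True by (intro exI[of _ "\<lambda>n. ereal (- real n)"]) auto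
    next
      case s: False
      then obtain t where t: "s = ereal t" using False by (cases s) auto
      have "(\<lambda>n. ereal (t + inverse (real (Suc n)))) \<longlonglongrightarrow> ereal t"
        using LIMSEQ_inverse_real_of_nat_add[of t] by simp
      then show ?thesis by (intro exI[of _ "\<lambda>n. ereal (t + inverse (real (Suc n)))"]) (auto simp: t)
    qed
    then obtain c where c: "\<And>n. s < c n" "c \<longlonglongrightarrow> s" by auto
    have "AE x in M. \<forall>n. u x < c n" using * c(1) by (simp add: AE_all_countable)
    then show ?thesis
      by eventually_elim (rule LIMSEQ_le_const[OF c(2)], auto intro: less_imp_le)
  qed simp
  then show ?thesis by (simp add: s_def)
qed

lemma ess_sup_le: "AE x in M. u x \<le> c \<Longrightarrow> ess_sup M u \<le> c"
  unfolding ess_sup_def by (rule Limsup_bounded) 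

lemma norm_on_signed_sum:
  assumes N: "is_norm_on_signed N" and I: "finite I" and \<eta>: "\<And>i. i \<in> I \<Longrightarrow> \<eta> i \<in> signed_measures"
  shows "N (\<lambda>A. \<Sum>i\<in>I. c i * \<eta> i A) \<le> (\<Sum>i\<in>I. \<bar>c i\<bar> * N (\<eta> i))"
  using I \<eta>
proof (induction I)
  case empty
  have "(\<lambda>A. 0) \<in> signed_measures" by (simp add: signed_measures_def)
  moreover have "\<forall>\<mu>\<in>signed_measures. N \<mu> = 0 \<longleftrightarrow> \<mu> = (\<lambda>A. 0)"
    using N unfolding is_norm_on_signed_def by blast
  ultimately have "N (\<lambda>A. 0) = 0" by blast
  then show ?case by simp
next
  case (insert i I)
  have 1: "(\<lambda>A. c i * \<eta> i A) \<in> signed_measures"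
    using signed_measure_sum[of "{i}" \<eta> c] insert by simp
  have 2: "(\<lambda>A. \<Sum>i\<in>I. c i * \<eta> i A) \<in> signed_measures"
    using signed_measure_sum[of I \<eta> c] insert by simp
  have "N (\<lambda>A. c i * \<eta> i A + (\<Sum>i\<in>I. c i * \<eta> i A)) \<le> N (\<lambda>A. c i * \<eta> i A) + N (\<lambda>A. \<Sum>i\<in>I. c i * \<eta> i A)"
    using N 1 2 by (simp add: is_norm_on_signed_def)
  also have "N (\<lambda>A. c i * \<eta> i A) = \<bar>c i\<bar> * N (\<eta> i)"
    using N insert.prems by (simp add: is_norm_on_signed_def)
  finally show ?case using insert by simp
qed

lemma normed_function_spaceD:
  assumes "normed_function_space \<nu> B nrm"
  shows "g \<in> B \<Longrightarrow> k \<in> B \<Longrightarrow> (\<lambda>x. g x + k x) \<in> B"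
    "g \<in> B \<Longrightarrow> k \<in> B \<Longrightarrow> nrm (\<lambda>x. g x + k x) \<le> nrm g + nrm k"
    "g \<in> B \<Longrightarrow> (\<lambda>x. c * g x) \<in> B"
    "g \<in> B \<Longrightarrow> 0 \<le> nrm g"
    "g \<in> B \<Longrightarrow> AE x in \<nu>. g x = 0 \<Longrightarrow> nrm g = 0"
    "g \<in> B \<Longrightarrow> AE x in \<nu>. k x = g x \<Longrightarrow> k \<in> B"
  using assms unfolding normed_function_space_def by (elim conjE, meson)+

text \<open>The difference of two almost everywhere equal elements has norm 0, and the triangle
  inequality is applied in both directions.\<close>

lemma normed_function_space_AE_cong:
  assumes B: "normed_function_space \<nu> B nrm" and g: "g \<in> B" and AE: "AE x in \<nu>. k x = g x"
  shows "k \<in> B" and "nrm k = nrm g"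
proof -
  note D = normed_function_spaceD[OF B]
  show k: "k \<in> B" by (rule D(6)[OF g AE])
  have le: "nrm u \<le> nrm v" if uv: "u \<in> B" "v \<in> B" "AE x in \<nu>. u x = v x" for u v
  proof -
    have w: "(\<lambda>x. u x + -1 * v x) \<in> B"
      by (rule D(1)[OF uv(1) D(3)[OF uv(2)]])
    have "nrm (\<lambda>x. v x + (u x + -1 * v x)) \<le> nrm v + nrm (\<lambda>x. u x + -1 * v x)"
      by (rule D(2)[OF uv(2) w])
    moreover have "nrm (\<lambda>x. u x + -1 * v x) = 0"
    proof -
      have "AE x in \<nu>. u x + -1 * v x = 0" using uv(3) by eventually_elim simp
      then show ?thesis by (rule D(5)[OF w])
    qed
    ultimately show ?thesis by simp
  qed
  have "AE x in \<nu>. g x = k x" using AE by eventually_elim simp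
  then show "nrm k = nrm g" using le[OF k g AE] le[OF g k] by simp
qed

section \<open>Contraction on the fibres and decay of the densities\<close>

context skew_product_system
begin

text \<open>One step of a Lasota-Yorke inequality. The weights sum to 1, so averaging over the
  branches costs no constant. Real bounds X and Y in place of essential suprema keep the iteration
  inside the reals.\<close>

lemma norm_restriction_T_le:
  assumes N: "is_norm_on_signed N" and \<alpha>: "0 \<le> \<alpha>"
    and G1: "AE \<gamma> in \<nu>. \<forall>\<mu>\<in>signed_measures. N (push_signed (fibre_map G \<gamma>) \<mu>) \<le> \<alpha> * N \<mu> + \<bar>\<mu> UNIV\<bar>"
    and \<mu>: "\<mu> \<in> AB m"
    and X: "AE x in \<nu>. N (restriction m \<mu> x) \<le> X" and Y: "AE x in \<nu>. \<bar>phi1 m \<mu> x\<bar> \<le> Y"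
  shows "AE x in \<nu>. N (restriction m (T \<mu>) x) \<le> \<alpha> * X + Y"
proof -
  have s: "restriction m \<mu> x \<in> signed_measures" for x
    by (rule restriction_signed_measure[OF compact_fibre \<mu>])
  have "AE y in \<nu>. N (push_signed (fibre_map G y) (restriction m \<mu> y)) \<le> \<alpha> * X + Y"
    using G1 X Y
  proof eventually_elim
    case (elim y)
    have "N (push_signed (fibre_map G y) (restriction m \<mu> y)) \<le> \<alpha> * N (restriction m \<mu> y) + \<bar>phi1 m \<mu> y\<bar>"
      using elim(1) s phi1_eq_restriction_UNIV[OF compact_fibre \<mu>] by auto
    also have "\<dots> \<le> \<alpha> * X + Y" using elim \<alpha> by (intro add_mono mult_left_mono)
    finally show ?case .
  qed
  note AE_branch[OF this]
  with restriction_T[OF \<mu>, unfolded AE_m_iff] AE_preimages show ?thesis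
  proof eventually_elim
    case (elim x)
    have "N (restriction m (T \<mu>) x) \<le>
        (\<Sum>i<d. \<bar>weight i x\<bar> * N (push_signed (fibre_map G (branch i x)) (restriction m \<mu> (branch i x))))"
      unfolding elim(1) branch_average_def
      by (intro norm_on_signed_sum[OF N] push_signed_in_signed_measures fibre_map_measurable s) simp
    also have "\<dots> \<le> (\<Sum>i<d. weight i x * (\<alpha> * X + Y))"
      using elim(3) by (intro sum_mono) (auto simp: weight_nonneg intro!: mult_left_mono)
    also have "\<dots> = \<alpha> * X + Y" using elim(2) by (simp flip: sum_distrib_right)
    finally show ?case .
  qed
qed

text \<open>
  (G2) only speaks about marginal densities, but every element of \<open>B\<^sub>w\<close> is one: a bounded \<open>g\<close> is the
  marginal density of \<open>g m \<otimes> \<delta>\<close>, whose restrictions have norm \<open>\<bar>g\<bar>\<close> by (G3).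
\<close>

lemma abs_le_norm_w:
  fixes norm_o :: "('k set \<Rightarrow> real) \<Rightarrow> real"
  assumes N: "is_norm_on_signed norm_o" and G2: "G2_inf m \<nu> norm_o Bw norm_w" and G3: "G3 norm_o"
    and Bw: "normed_function_space \<nu> Bw norm_w" and g: "g \<in> Bw"
  shows "AE x in \<nu>. \<bar>g x\<bar> \<le> norm_w g"
proof -
  have gc: "g \<in> borel_measurable (completion \<nu>)" and fin: "sup_norm_ae \<nu> g < \<infinity>"
    using G2 g by (auto simp: G2_inf_def)
  \<comment> \<open>Elements of Bw are measurable for the completion only; a Borel version is needed
    to define a measure from g.\<close>
  obtain g' where g'[measurable]: "g' \<in> borel_measurable borel" and gg': "AE x in \<nu>. g x = g' x"
    using completion_ex_borel_measurable_real[OF gc] unfolding measurable_\<nu> by blast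
  obtain c where c: "AE x in \<nu>. \<bar>g x\<bar> \<le> c"
  proof -
    obtain c where "sup_norm_ae \<nu> g \<le> ereal c" using fin by (cases "sup_norm_ae \<nu> g") auto
    then have "AE x in \<nu>. \<bar>g x\<bar> \<le> c"
      using AE_le_ess_sup[of "\<lambda>x. ereal \<bar>g x\<bar>" \<nu>] by (auto elim!: eventually_mono dest: order.trans)
    then show ?thesis by (rule that)
  qed
  have c': "AE x in \<nu>. \<bar>g' x\<bar> \<le> c" using c gg' by eventually_elim simp
  interpret m: prob_space m by (rule prob_space_m)
  have ig: "integrable m g'"
    using c' by (intro m.integrable_const_bound[of _ c]) (auto simp: AE_m_iff measurable_m)
  \<comment> \<open>Any point of K serves to carry the Dirac mass.\<close>
  define k :: 'k where "k = undefined"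
  define \<delta> where "\<delta> = (return borel k :: 'k measure)"
  interpret \<delta>: prob_space \<delta> unfolding \<delta>_def by (rule prob_space_return) simp
  have \<delta>: "measure \<delta> B = indicator B k" if "B \<in> sets borel" for B
    using that by (simp add: \<delta>_def measure_return)
  have sets_\<delta>: "sets \<delta> = sets borel" by (simp add: \<delta>_def)
  define \<rho> where "\<rho> x = (\<lambda>B. g' x * measure \<delta> B)" for x
  define \<mu> where "\<mu> E = (if E \<in> sets borel then \<integral>x. g' x * indicator E (x, k) \<partial>m else 0)" for E
  have \<rho>s: "\<rho> x \<in> signed_measures" for x
    using measure_diff_signed_measure[OF \<delta>.finite_measure_axioms sets_\<delta> \<delta>.finite_measure_axioms sets_\<delta>, of "g' x" 0]
    by (simp add: \<rho>_def)
  have pk: "(\<lambda>x. (x, k)) \<in> (borel :: 'm measure) \<rightarrow>\<^sub>M borel"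
    by (intro borel_measurable_continuous_onI continuous_intros)
  have int: "integrable m (\<lambda>x. g' x * indicator E (x, k))" if E: "E \<in> sets borel" for E
    using measurable_sets[OF pk E] integrable_mult_indicator[OF _ ig, of "(\<lambda>x. (x, k)) -` E"]
    by (simp add: sets_m indicator_vimage mult.commute)
  have \<rho>E: "\<rho> x (Pair x -` E) = g' x * indicator E (x, k)" if "E \<in> sets borel" for E x
    using measurable_sets[OF Pair_borel_measurable that, of x] by (simp add: \<rho>_def \<delta> indicator_def)
  have d: "fibre_density m \<mu> \<rho>" by (simp add: fibre_density_def \<rho>E \<mu>_def int)
  have "\<mu> \<in> signed_measures"
    unfolding signed_measures_def
  proof safe
    fix E :: "nat \<Rightarrow> ('m \<times> 'k) set" assume E: "range E \<subseteq> sets borel" "disjoint_family E"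
    then have Ei: "E i \<in> sets borel" for i by auto
    have ind: "(\<lambda>i. indicat_real (E i) z) sums indicator (\<Union>i. E i) z" for z
      using E(2) by (intro indicator_sums) (auto simp: disjoint_family_on_def)
    have "(\<lambda>i. \<integral>x. g' x * indicator (E i) (x, k) \<partial>m) sums (\<integral>x. (\<Sum>i. g' x * indicator (E i) (x, k)) \<partial>m)"
    proof (rule sums_integral)
      have ab: "(\<lambda>i. norm (g' x * indicator (E i) (x, k))) sums (\<bar>g' x\<bar> * indicator (\<Union>i. E i) (x, k))" for x
        using sums_mult[OF ind, of "\<bar>g' x\<bar>" "(x, k)"] by (simp add: abs_mult)
      show "AE x in m. summable (\<lambda>i. norm (g' x * indicator (E i) (x, k)))"
        using ab by (auto simp: sums_iff)
      \<comment> \<open>Disjointness of the sets \<open>E i\<close> keeps all partial sums below the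
        integral of the absolute value of g'.\<close>
      show "summable (\<lambda>i. \<integral>x. norm (g' x * indicator (E i) (x, k)) \<partial>m)"
      proof (rule summableI_nonneg_bounded)
        fix n
        have "(\<Sum>i<n. \<integral>x. norm (g' x * indicator (E i) (x, k)) \<partial>m) = (\<integral>x. (\<Sum>i<n. norm (g' x * indicator (E i) (x, k))) \<partial>m)"
          using int[OF Ei] by (subst Bochner_Integration.integral_sum) auto
        also have "\<dots> \<le> (\<integral>x. \<bar>g' x\<bar> \<partial>m)"
        proof (rule integral_mono)
          show "(\<Sum>i<n. norm (g' x * indicator (E i) (x, k))) \<le> \<bar>g' x\<bar>" for x
          proof -
            have "(\<Sum>i<n. norm (g' x * indicator (E i) (x, k))) \<le> \<bar>g' x\<bar> * indicator (\<Union>i. E i) (x, k)"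
              using sum_le_suminf[of "\<lambda>i. norm (g' x * indicator (E i) (x, k))" "{..<n}"] ab[of x]
              by (auto simp: sums_iff)
            also have "\<dots> \<le> \<bar>g' x\<bar>" by (auto split: split_indicator)
            finally show ?thesis .
          qed
        qed (use int[OF Ei] ig in auto)
        finally show "(\<Sum>i<n. \<integral>x. norm (g' x * indicator (E i) (x, k)) \<partial>m) \<le> (\<integral>x. \<bar>g' x\<bar> \<partial>m)" .
      qed simp
    qed (rule int[OF Ei])
    moreover have "(\<Sum>i. g' x * indicator (E i) (x, k)) = g' x * indicator (\<Union>i. E i) (x, k)" for x
      using sums_mult[OF ind, of "g' x" "(x, k)"] by (simp add: sums_iff)
    ultimately show "(\<lambda>i. \<mu> (E i)) sums \<mu> (\<Union>i. E i)"
      using Ei by (auto simp: \<mu>_def)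
  qed (simp add: \<mu>_def)
  then have AB: "\<mu> \<in> AB m" by (rule AB_if_fibre_density[OF sets_m _ _ d]) (simp add: \<rho>s)
  have res: "AE x in \<nu>. restriction m \<mu> x = \<rho> x"
    unfolding AE_m_iff[symmetric]
    by (rule fibre_density_unique[OF finite_measure_m sets_m _ _ _ d])
      (simp_all add: \<rho>s restriction_signed_measure[OF compact_fibre AB]
        fibre_density_restriction[OF finite_measure_m sets_m compact_fibre AB])
  have "measure \<delta> \<in> signed_measures"
    using measure_diff_signed_measure[OF \<delta>.finite_measure_axioms sets_\<delta> \<delta>.finite_measure_axioms sets_\<delta>, of 1 0]
    by simp
  then have norm_\<rho>: "norm_o (\<rho> x) = \<bar>g' x\<bar>" for x
    using N G3 \<delta>.prob_space_axioms sets_\<delta> by (simp add: is_norm_on_signed_def G3_def \<rho>_def)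
  have "norm_inf m norm_o \<mu> \<le> ereal c"
    unfolding norm_inf_def
    by (rule ess_sup_le, unfold AE_m_iff) (use res c' in \<open>eventually_elim, simp add: norm_\<rho>\<close>)
  then have "\<mu> \<in> L_inf m norm_o" using AB by (auto simp: L_inf_def)
  then have sup: "sup_norm_ae \<nu> (phi1 m \<mu>) \<le> ereal (norm_w (phi1 m \<mu>))"
    using G2 by (auto simp: G2_inf_def)
  have pg: "AE x in \<nu>. phi1 m \<mu> x = g x"
    using res gg'
  proof eventually_elim
    case (elim x)
    then show ?case
      by (simp add: phi1_eq_restriction_UNIV[OF compact_fibre AB] \<rho>_def \<delta>)
  qed
  have "norm_w (phi1 m \<mu>) = norm_w g" by (rule normed_function_space_AE_cong(2)[OF Bw g pg])
  then have "AE x in \<nu>. ereal \<bar>phi1 m \<mu> x\<bar> \<le> ereal (norm_w g)"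
    using AE_le_ess_sup[of "\<lambda>x. ereal \<bar>phi1 m \<mu> x\<bar>" \<nu>] sup by (auto elim!: eventually_mono dest: order.trans)
  with pg show ?thesis by eventually_elim simp
qed

text \<open>On the kernel of Pf the normalised operator acts as Nf, and Pf Nf = 0 keeps the iterates
  in that kernel. The densities match the Nf-iterates only almost everywhere, so each step also uses
  that Pf and Nf respect this equality.\<close>

lemma density_of_iterates:
  assumes P1_2: "P1_2 f \<phi> h \<nu> lam Bs norm_s Bw norm_w Pf Nf" and \<mu>: "\<mu> \<in> AB m"
    and \<phi>1: "phi1 m \<mu> \<in> Bs" and ker: "AE x in \<nu>. projection_h h Pf (phi1 m \<mu>) x = 0"
  defines "g \<equiv> (\<lambda>x. h x * phi1 m \<mu> x)"
  shows "(T ^^ n) \<mu> \<in> AB m \<and> (Nf ^^ n) g \<in> Bs \<and> (AE x in \<nu>. Pf ((Nf ^^ n) g) x = 0) \<and>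
    (AE x in \<nu>. h x * phi1 m ((T ^^ n) \<mu>) x = (Nf ^^ n) g x)"
proof -
  have Bs: "normed_function_space \<nu> Bs norm_s" and g: "g \<in> Bs"
    and tB: "\<And>u. u \<in> Bs \<Longrightarrow> transfer_op f \<phi> u \<in> Bs"
    and Pf: "linear_operator_on \<nu> Bs Pf" and Nf: "linear_operator_on \<nu> Bs Nf"
    and dec: "\<And>u. u \<in> Bs \<Longrightarrow> AE x in \<nu>. inverse lam * transfer_op f \<phi> u x = Pf u x + Nf u x"
    and PN: "\<And>u. u \<in> Bs \<Longrightarrow> AE x in \<nu>. Pf (Nf u) x = 0"
    using P1_2 \<phi>1 by (auto simp: P1_2_def closed_under_mult_def g_def)
  show ?thesis
  proof (induction n)
    case 0
    have "AE x in \<nu>. Pf g x = 0"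
      using ker by eventually_elim (use h_pos in \<open>simp add: projection_h_def g_def less_imp_neq[symmetric]\<close>)
    then show ?case using \<mu> g by (simp add: g_def)
  next
    case (Suc n)
    let ?\<mu> = "(T ^^ n) \<mu>" and ?g = "(Nf ^^ n) g"
    define u where "u = (\<lambda>x. h x * phi1 m ?\<mu> x)"
    from Suc have A: "?\<mu> \<in> AB m" and B: "?g \<in> Bs" and P0: "AE x in \<nu>. Pf ?g x = 0"
      and ug: "AE x in \<nu>. u x = ?g x" by (auto simp: u_def)
    have u: "u \<in> Bs" by (rule normed_function_space_AE_cong(1)[OF Bs B ug])
    have cP: "AE x in \<nu>. Pf u x = Pf ?g x" and cN: "AE x in \<nu>. Nf u x = Nf ?g x"
      using Pf Nf u B ug unfolding linear_operator_on_def by blast+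
    have "AE x in \<nu>. h x * phi1 m (T ?\<mu>) x = Nf ?g x"
      using phi1_T[OF A] dec[OF u] cP cN P0 by eventually_elim (simp add: u_def)
    moreover have "Nf ?g \<in> Bs" using Nf B unfolding linear_operator_on_def by blast
    ultimately show ?case using T_in_AB[OF A] PN[OF B] by simp
  qed
qed

text \<open>Decay is available in the strong norm only. It reaches the densities because the strong
  norm dominates the weak one, which dominates the essential supremum.\<close>

lemma density_decay:
  assumes P1_2: "P1_2 f \<phi> h \<nu> lam Bs norm_s Bw norm_w Pf Nf"
    and N: "is_norm_on_signed norm_o" and G2: "G2_inf m \<nu> norm_o Bw norm_w" and G3: "G3 norm_o"
  obtains C r where "0 \<le> C" "0 \<le> r" "r < 1"
    "\<And>\<mu> n. \<mu> \<in> V_inf m \<nu> norm_o Bs h Pf \<Longrightarrow>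
      AE x in \<nu>. \<bar>phi1 m ((T ^^ n) \<mu>) x\<bar> \<le> C * r ^ n * norm_s (phi1 m \<mu>)"
proof -
  obtain a where a: "0 < a" "\<And>x. a \<le> h x" using h_lower by blast
  have Bs: "normed_function_space \<nu> Bs norm_s" and Bw: "normed_function_space \<nu> Bw norm_w"
    and sw: "\<And>u. u \<in> Bs \<Longrightarrow> u \<in> Bw \<and> norm_w u \<le> norm_s u"
    and hB: "\<And>u. u \<in> Bs \<Longrightarrow> (\<lambda>x. h x * u x) \<in> Bs"
    using P1_2 by (auto simp: P1_2_def closed_under_mult_def)
  have "\<exists>C. \<forall>u\<in>Bs. norm_s (\<lambda>x. h x * u x) \<le> C * norm_s u"
    and "\<exists>C0>0. \<exists>r. 0 \<le> r \<and> r < 1 \<and>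
      (\<forall>u\<in>Bs. \<forall>n\<ge>1. norm_s ((Nf ^^ n) u) \<le> C0 * r ^ n * norm_s u)"
    using P1_2[unfolded P1_2_def] by - (elim conjE, assumption)+
  note ex = this
  obtain Ch where Ch: "\<And>u. u \<in> Bs \<Longrightarrow> norm_s (\<lambda>x. h x * u x) \<le> Ch * norm_s u"
    using ex(1) by blast
  obtain C0 r where C0: "0 < C0" "0 \<le> r" "r < 1"
    "\<And>u n. u \<in> Bs \<Longrightarrow> 1 \<le> n \<Longrightarrow> norm_s ((Nf ^^ n) u) \<le> C0 * r ^ n * norm_s u"
    using ex(2) by blast
  have nn: "0 \<le> norm_s u" if "u \<in> Bs" for u
    using Bs that by (simp add: normed_function_space_def)
  \<comment> \<open>Ch pays for multiplying the density by h, and a for dividing by h again. The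
    summand 1 covers n = 0, where the recursion starts but the bound on powers of Nf does not yet
    apply.\<close>
  define C where "C = (1 + C0) * \<bar>Ch\<bar> / a"
  show thesis
  proof (rule that[of C r])
    show "0 \<le> C" using a C0 by (simp add: C_def)
    fix \<mu> :: "('m \<times> 'k) set \<Rightarrow> real" and n
    assume "\<mu> \<in> V_inf m \<nu> norm_o Bs h Pf"
    then have \<mu>: "\<mu> \<in> AB m" "phi1 m \<mu> \<in> Bs" "AE x in \<nu>. projection_h h Pf (phi1 m \<mu>) x = 0"
      by (auto simp: V_inf_def S_inf_def L_inf_def)
    define g where "g = (\<lambda>x. h x * phi1 m \<mu> x)"
    let ?s = "norm_s (phi1 m \<mu>)"
    have I: "(Nf ^^ n) g \<in> Bs" "AE x in \<nu>. h x * phi1 m ((T ^^ n) \<mu>) x = (Nf ^^ n) g x"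
      using density_of_iterates[OF P1_2 \<mu>, of n] by (simp_all add: g_def)
    have g: "g \<in> Bs" unfolding g_def by (rule hB[OF \<mu>(2)])
    have "norm_s g \<le> Ch * ?s" unfolding g_def by (rule Ch[OF \<mu>(2)])
    also have "\<dots> \<le> \<bar>Ch\<bar> * ?s" using nn[OF \<mu>(2)] by (intro mult_right_mono) auto
    finally have ng: "norm_s g \<le> \<bar>Ch\<bar> * ?s" .
    have "norm_s ((Nf ^^ n) g) \<le> (1 + C0) * r ^ n * norm_s g"
    proof (cases "n = 0")
      case True
      then show ?thesis using C0(1) nn[OF g] by (simp add: distrib_right)
    next
      case False
      then have "norm_s ((Nf ^^ n) g) \<le> C0 * r ^ n * norm_s g" using C0(4)[OF g] by simp
      also have "\<dots> \<le> (1 + C0) * r ^ n * norm_s g"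
        using C0 nn[OF g] by (intro mult_right_mono) auto
      finally show ?thesis .
    qed
    also have "\<dots> \<le> (1 + C0) * r ^ n * (\<bar>Ch\<bar> * ?s)"
      using C0 ng by (intro mult_left_mono) auto
    finally have bound: "norm_w ((Nf ^^ n) g) \<le> (1 + C0) * r ^ n * (\<bar>Ch\<bar> * ?s)"
      using sw[OF I(1)] by simp
    show "AE x in \<nu>. \<bar>phi1 m ((T ^^ n) \<mu>) x\<bar> \<le> C * r ^ n * ?s"
      using I(2) abs_le_norm_w[OF N G2 G3 Bw conjunct1[OF sw[OF I(1)]]]
    proof eventually_elim
      case (elim x)
      have "a * \<bar>phi1 m ((T ^^ n) \<mu>) x\<bar> \<le> h x * \<bar>phi1 m ((T ^^ n) \<mu>) x\<bar>"
        by (intro mult_right_mono a) simp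
      also have "\<dots> = \<bar>(Nf ^^ n) g x\<bar>" using elim(1) h_pos[of x] by (simp add: abs_mult flip: elim(1))
      also have "\<dots> \<le> (1 + C0) * r ^ n * (\<bar>Ch\<bar> * ?s)" using elim(2) bound by simp
      also have "\<dots> = a * (C * r ^ n * ?s)" using a by (simp add: C_def)
      finally show ?case using a(1) by simp
    qed
  qed (use C0 in auto)
qed

text \<open>With S the strong norm of the initial density, the fibre norms satisfy a recursion with
  factor \<alpha> and inhomogeneity C r^n S. It is solved by guessing the bound D \<beta>^n (X + S)
  and checking it by induction.\<close>

lemma exponential_convergence:
  assumes P1_2: "P1_2 f \<phi> h \<nu> lam Bs norm_s Bw norm_w Pf Nf"
    and G1: "G1 G \<nu> norm_o" and G2: "G2_inf m \<nu> norm_o Bw norm_w" and G3: "G3 norm_o"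
  shows "\<exists>D \<beta>::real. 0 \<le> \<beta> \<and> \<beta> < 1 \<and> (\<forall>\<mu> \<in> V_inf m \<nu> norm_o Bs h Pf. \<forall>n\<ge>1.
    norm_inf m norm_o ((T ^^ n) \<mu>) \<le> ereal (D * \<beta> ^ n) * norm_S_inf m norm_o norm_s \<mu>)"
proof -
  obtain \<alpha> where \<alpha>: "0 \<le> \<alpha>" "\<alpha> < 1"
    "AE \<gamma> in \<nu>. \<forall>\<mu>\<in>signed_measures. norm_o (push_signed (fibre_map G \<gamma>) \<mu>) \<le> \<alpha> * norm_o \<mu> + \<bar>\<mu> UNIV\<bar>"
    and N: "is_norm_on_signed norm_o"
    using G1 unfolding G1_def by blast
  obtain C r where C: "0 \<le> C" "0 \<le> r" "r < 1"
    "\<And>\<mu> n. \<mu> \<in> V_inf m \<nu> norm_o Bs h Pf \<Longrightarrow>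
      AE x in \<nu>. \<bar>phi1 m ((T ^^ n) \<mu>) x\<bar> \<le> C * r ^ n * norm_s (phi1 m \<mu>)"
    by (rule density_decay[OF P1_2 N G2 G3]) blast
  have Bs: "normed_function_space \<nu> Bs norm_s" using P1_2 by (simp add: P1_2_def)
  \<comment> \<open>The midpoint between max \<alpha> r and 1. The gap above \<alpha> matters: for r
    = \<alpha> the recursion may produce terms of size n \<alpha>^n.\<close>
  define \<beta> where "\<beta> = (1 + max \<alpha> r) / 2"
  have \<beta>: "\<alpha> < \<beta>" "r \<le> \<beta>" "0 \<le> \<beta>" "\<beta> < 1" using \<alpha> C by (auto simp: \<beta>_def)
  \<comment> \<open>The induction step needs C \<le> D (\<beta> - \<alpha>), and the case n = 0
    needs D \<ge> 1.\<close>
  define D where "D = 1 + C / (\<beta> - \<alpha>)"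
  have "D * (\<beta> - \<alpha>) = (\<beta> - \<alpha>) + C" using \<beta>(1) by (simp add: D_def distrib_right)
  then have D: "1 \<le> D" "C \<le> D * (\<beta> - \<alpha>)"
    using C(1) \<beta>(1) by (auto simp: D_def)
  have "norm_inf m norm_o ((T ^^ n) \<mu>) \<le> ereal (D * \<beta> ^ n) * norm_S_inf m norm_o norm_s \<mu>"
    if \<mu>: "\<mu> \<in> V_inf m \<nu> norm_o Bs h Pf" for \<mu> n
  proof -
    have \<mu>': "\<mu> \<in> AB m" "phi1 m \<mu> \<in> Bs" "AE x in \<nu>. projection_h h Pf (phi1 m \<mu>) x = 0"
      "norm_inf m norm_o \<mu> < \<infinity>"
      using \<mu> by (auto simp: V_inf_def S_inf_def L_inf_def)
    have s: "0 \<le> norm_s (phi1 m \<mu>)" using Bs \<mu>'(2) by (simp add: normed_function_space_def)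
    define S where "S = norm_s (phi1 m \<mu>)"
    have AEm: "AE x in m. ereal (norm_o (restriction m \<mu> x)) \<le> norm_inf m norm_o \<mu>"
      unfolding norm_inf_def by (rule AE_le_ess_sup)
    \<comment> \<open>This uses that m is not the zero measure, whose essential suprema would be
      minus infinity.\<close>
    have n0: "0 \<le> norm_inf m norm_o \<mu>"
    proof -
      have "AE x in m. 0 \<le> norm_inf m norm_o \<mu>"
        using AEm
      proof eventually_elim
        case (elim x)
        have "0 \<le> norm_o (restriction m \<mu> x)"
          using N restriction_signed_measure[OF compact_fibre \<mu>'(1)] by (simp add: is_norm_on_signed_def)
        then show ?case using elim by (meson ereal_less_eq(5) order.trans)
      qed
      then show ?thesis using prob_space.AE_const[OF prob_space_m] by simp
    qed
    then obtain X where X: "norm_inf m norm_o \<mu> = ereal X" "0 \<le> X"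
      using \<mu>'(4) by (cases "norm_inf m norm_o \<mu>") auto
    \<comment> \<open>The induction runs on almost everywhere bounds; the essential supremum is
      taken only once, afterwards.\<close>
    have "(T ^^ n) \<mu> \<in> AB m \<and> (AE x in \<nu>. norm_o (restriction m ((T ^^ n) \<mu>) x) \<le> D * \<beta> ^ n * (X + S))" for n
    proof (induction n)
      case 0
      have "X \<le> D * (X + S)"
        using D(1) X(2) s mult_mono[of 1 D X "X + S"] by (simp add: S_def)
      then show ?case using AEm \<mu>'(1) by (auto simp: AE_m_iff X(1) elim!: eventually_mono)
    next
      case (Suc n)
      then have A: "(T ^^ n) \<mu> \<in> AB m"
        and X': "AE x in \<nu>. norm_o (restriction m ((T ^^ n) \<mu>) x) \<le> D * \<beta> ^ n * (X + S)" by auto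
      have le: "\<alpha> * (D * \<beta> ^ n * (X + S)) + C * r ^ n * S \<le> D * \<beta> ^ Suc n * (X + S)"
      proof -
        have "C * r ^ n * S \<le> D * (\<beta> - \<alpha>) * \<beta> ^ n * (X + S)"
          using C D \<beta> s X(2) by (intro mult_mono power_mono) (auto simp: S_def)
        then show ?thesis by (simp add: algebra_simps)
      qed
      have "AE x in \<nu>. norm_o (restriction m (T ((T ^^ n) \<mu>)) x)
          \<le> \<alpha> * (D * \<beta> ^ n * (X + S)) + C * r ^ n * S"
        by (rule norm_restriction_T_le[OF N \<alpha>(1,3) A X']) (use C(4)[OF \<mu>] in \<open>simp add: S_def\<close>)
      then have "AE x in \<nu>. norm_o (restriction m ((T ^^ Suc n) \<mu>) x) \<le> D * \<beta> ^ Suc n * (X + S)"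
        using le by (auto elim!: eventually_mono)
      then show ?case using T_in_AB[OF A] by simp
    qed
    then have "norm_inf m norm_o ((T ^^ n) \<mu>) \<le> ereal (D * \<beta> ^ n * (X + S))"
      unfolding norm_inf_def by (intro ess_sup_le) (simp add: AE_m_iff)
    then show ?thesis
      by (simp add: norm_S_inf_def X(1) S_def add.commute)
  qed
  then show ?thesis using \<beta> by blast
qed

end

theorem theoremA:
  fixes f :: "'m::polish_space \<Rightarrow> 'm"
    and G :: "'m \<times> 'k::{metric_space, second_countable_topology} \<Rightarrow> 'k"
    and \<phi> h :: "'m \<Rightarrow> real" and m \<nu> :: "'m measure" and lam :: real
    and Bs Bw :: "('m \<Rightarrow> real) set" and norm_s norm_w :: "('m \<Rightarrow> real) \<Rightarrow> real"
    and Pf Nf :: "('m \<Rightarrow> real) \<Rightarrow> 'm \<Rightarrow> real"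
    and d :: nat and P :: "nat \<Rightarrow> 'm set"
    and norm_o :: "('k set \<Rightarrow> real) \<Rightarrow> real"
  assumes "compact (UNIV :: 'k set)"
    and "f \<in> borel_measurable borel" and "G \<in> borel_measurable borel"
    and "P1_1 f \<phi> m h \<nu> lam" and "P1_2 f \<phi> h \<nu> lam Bs norm_s Bw norm_w Pf Nf"
    and "P2 f \<nu> d P"
    and "P3 f G m"
    and "G1 G \<nu> norm_o"
    and "G2_inf m \<nu> norm_o Bw norm_w"
    and "G3 norm_o"
  shows "\<exists>(D::real) (\<beta>::real). 0 \<le> \<beta> \<and> \<beta> < 1 \<and>
    (\<forall>\<mu> \<in> (V_inf m \<nu> norm_o Bs h Pf :: (('m \<times> 'k) set \<Rightarrow> real) set). \<forall>n\<ge>1.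
       norm_inf m norm_o ((normalized_transfer_F f G \<phi> h lam d P m ^^ n) \<mu>)
         \<le> ereal (D * \<beta> ^ n) * norm_S_inf m norm_o norm_s \<mu>)"
proof -
  interpret skew_product_system f G \<phi> h m \<nu> lam d P
    using assms(1-4,6) by unfold_locales
  show ?thesis
    by (rule exponential_convergence[OF assms(5,8-10)])
qed

end
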